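(* Let $E$ be an elliptic curve over $\mathbb{Q}$ defined by $y^2=f(x)$, where $f\in\mathbb{Q}[x]$ is a polynomial of degree $3$ or $4$, and assume the Mordell–Weil rank of $E(\mathbb{Q})$ is positive. Let $m\ge3$ be an odd integer, $a$ a non-zero rational number, and $E':y^2=x^m+a^2$. Then there exists a rational function $D\in\mathbb{Q}(v_1,v_2,v_3)$ such that the elliptic curve $Dy^2=f(x)$ has positive Mordell–Weil rank over $\mathbb{Q}(v_1,v_2,v_3)$ and the Jacobian of the curve $y^2=x^m+a^2D$ has Mordell–Weil rank at least $3$ over $\mathbb{Q}(v_1,v_2,v_3)$.
   Context: $\mathbb{Q}(v_1,v_2,v_3)$ is the rational function field in three independent variables. For a rational function $D$, the quadratic twist of $y^2=f(x)$ by $D$ is $Dy^2=f(x)$, and the $2m$-twist of $y^2=x^m+a^2$ by $D$ is $y^2=x^m+a^2D$. *)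

theory Defs
  imports
    "HOL-Algebra.Algebraic_Closure_Type"
    "HOL-Algebra.Free_Abelian_Groups"
    "HOL-Library.Extended_Nat"
begin

hide_const (open) up_ring.monom up_ring.coeff

section \<open>The curve \<open>d y\<^sup>2 = f(x)\<close>\<close>

text \<open>
  Let \<open>deg f = 2g + 1\<close> or \<open>2g + 2\<close>. The smooth projective model of \<open>d y\<^sup>2 = f(x)\<close> (for \<open>d \<noteq> 0\<close> and
  \<open>f\<close> without multiple roots in an algebraic closure) is glued from the two affine charts
  \<open>d y\<^sup>2 = f(x)\<close> and \<open>d w\<^sup>2 = f\<^sup>*(u)\<close>, where \<open>u = 1/x\<close>, \<open>w = y/x\<^bsup>g+1\<^esup>\<close> and \<open>f\<^sup>*(u) = u\<^bsup>2g+2\<^esup> f(1/u)\<close>.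
  The points at infinity are the points \<open>(u, w) = (0, w)\<close> of the second chart. If the degree of \<open>f\<close>
  is odd there is just one, with \<open>w = 0\<close>; otherwise \<open>d w\<^sup>2\<close> is the leading coefficient of \<open>f\<close>.
\<close>

datatype 'k curve_point = Affine 'k 'k | Infinite 'k

definition curve_genus :: "'k::field poly \<Rightarrow> nat"
  where "curve_genus f = (degree f - 1) div 2"

definition curve_points :: "'k::field \<Rightarrow> 'k poly \<Rightarrow> 'k curve_point set" where
  "curve_points d f =
     {Affine x y |x y. d * y ^ 2 = poly f x} \<union>
     {Infinite w |w. d * w ^ 2 = coeff f (2 * curve_genus f + 2)}"

definition chart_at_infinity :: "'k::field poly \<Rightarrow> 'k poly" where
  "chart_at_infinity f =
     (let n = 2 * curve_genus f + 2 in \<Sum>i\<le>n. monom (coeff f i) (n - i))"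

text \<open>Polynomials in \<open>x, y\<close> have type \<open>'k poly poly\<close>; the inner variable is \<open>x\<close>, the outer one \<open>y\<close>.\<close>

definition curve_eq :: "'k::field \<Rightarrow> 'k poly \<Rightarrow> 'k poly poly"
  where "curve_eq d f = [:- f, 0, [:d:]:]"

text \<open>
  The order of vanishing at the point \<open>(x\<^sub>0, y\<^sub>0)\<close> of the function given by \<open>H\<close>: the largest \<open>n\<close> such
  that \<open>H\<close> lies in the \<open>n\<close>-th power of the maximal ideal \<open>(x - x\<^sub>0, y - y\<^sub>0)\<close> of the coordinate ring
  \<open>k[x,y]/(d y\<^sup>2 - f(x))\<close>.
\<close>

definition affine_ord ::
    "'k::field \<Rightarrow> 'k poly \<Rightarrow> 'k \<Rightarrow> 'k \<Rightarrow> 'k poly poly \<Rightarrow> nat" where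
  "affine_ord d f x0 y0 H =
     (GREATEST n. \<exists>Q R. H = Q * curve_eq d f +
        (\<Sum>i\<le>n. R i * [:[:- x0, 1:]:] ^ i * [:[:- y0:], 1:] ^ (n - i)))"

text \<open>
  Give \<open>x\<close> weight \<open>1\<close> and \<open>y\<close> weight \<open>g + 1\<close>. The rational functions on the curve are the quotients
  \<open>G/H\<close> of two polynomials of weighted degree at most a common \<open>N\<close>. The change of chart turns such
  a polynomial \<open>H(x, y)\<close> into \<open>u\<^bsup>N\<^esup> H(1/u, w/u\<^bsup>g+1\<^esup>)\<close>, and the factors \<open>u\<^bsup>N\<^esup>\<close> cancel in the quotient.
\<close>

definition weight_le :: "nat \<Rightarrow> nat \<Rightarrow> 'k::field poly poly \<Rightarrow> bool" where
  "weight_le g N H \<longleftrightarrow> (\<forall>i j. coeff (coeff H j) i \<noteq> 0 \<longrightarrow> i + (g + 1) * j \<le> N)"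

definition change_chart :: "nat \<Rightarrow> nat \<Rightarrow> 'k::field poly poly \<Rightarrow> 'k poly poly" where
  "change_chart g N H =
     (\<Sum>j\<le>degree H. \<Sum>i\<le>degree (coeff H j).
        monom (monom (coeff (coeff H j) i) (N - (i + (g + 1) * j))) j)"

fun form_ord :: "'k::field \<Rightarrow> 'k poly \<Rightarrow> nat \<Rightarrow> 'k poly poly \<Rightarrow> 'k curve_point \<Rightarrow> nat" where
  "form_ord d f N H (Affine x y) = affine_ord d f x y H"
| "form_ord d f N H (Infinite w) =
     affine_ord d (chart_at_infinity f) 0 w (change_chart (curve_genus f) N H)"


section \<open>Divisor classes over an algebraically closed field\<close>

definition divisor_group ::
    "'k::alg_closed_field \<Rightarrow> 'k poly \<Rightarrow> ('k curve_point \<Rightarrow>\<^sub>0 int) monoid"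
  where "divisor_group d f = free_Abelian_group (curve_points d f)"

definition divisor_degree :: "('p \<Rightarrow>\<^sub>0 int) \<Rightarrow> int"
  where "divisor_degree A = (\<Sum>P\<in>Poly_Mapping.keys A. Poly_Mapping.lookup A P)"

definition principal_divisors ::
    "'k::alg_closed_field \<Rightarrow> 'k poly \<Rightarrow> ('k curve_point \<Rightarrow>\<^sub>0 int) set" where
  "principal_divisors d f =
     {A \<in> carrier (divisor_group d f). \<exists>N G H.
        weight_le (curve_genus f) N G \<and> \<not> curve_eq d f dvd G \<and>
        weight_le (curve_genus f) N H \<and> \<not> curve_eq d f dvd H \<and>
        (\<forall>P\<in>curve_points d f. Poly_Mapping.lookup A P =
           int (form_ord d f N G P) - int (form_ord d f N H P))}"

definition picard_group ::
    "'k::alg_closed_field \<Rightarrow> 'k poly \<Rightarrow> ('k curve_point \<Rightarrow>\<^sub>0 int) set monoid"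
  where "picard_group d f = divisor_group d f Mod principal_divisors d f"

definition divisor_class ::
    "'k::alg_closed_field \<Rightarrow> 'k poly \<Rightarrow> ('k curve_point \<Rightarrow>\<^sub>0 int) \<Rightarrow> ('k curve_point \<Rightarrow>\<^sub>0 int) set"
  where "divisor_class d f A = principal_divisors d f #>\<^bsub>divisor_group d f\<^esub> A"


section \<open>Rank of an abelian group\<close>

definition int_independent :: "('a, 'b) monoid_scheme \<Rightarrow> 'a set \<Rightarrow> bool" where
  "int_independent G B \<longleftrightarrow> finite B \<and>
     (\<forall>n :: 'a \<Rightarrow> int. finprod G (\<lambda>b. b [^]\<^bsub>G\<^esub> n b) B = \<one>\<^bsub>G\<^esub> \<longrightarrow> (\<forall>b\<in>B. n b = 0))"

text \<open>The rank of the subgroup \<open>S\<close> of the abelian group \<open>G\<close>.\<close>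

definition subgroup_rank :: "('a, 'b) monoid_scheme \<Rightarrow> 'a set \<Rightarrow> enat" where
  "subgroup_rank G S = (SUP B\<in>{B. B \<subseteq> S \<and> B \<subseteq> carrier G \<and> int_independent G B}. enat (card B))"


section \<open>Jacobians and elliptic curves over a field \<open>K\<close>\<close>

definition galois_group :: "('k::field alg_closure \<Rightarrow> 'k alg_closure) set" where
  "galois_group = {\<sigma>. bij \<sigma> \<and> (\<forall>x y. \<sigma> (x + y) = \<sigma> x + \<sigma> y) \<and>
     (\<forall>x y. \<sigma> (x * y) = \<sigma> x * \<sigma> y) \<and> (\<forall>c. \<sigma> (to_ac c) = to_ac c)}"

text \<open>
  The \<open>K\<close>-rational points of the Jacobian of \<open>d y\<^sup>2 = f(x)\<close>, for perfect \<open>K\<close>: the Galois-invariant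
  divisor classes of degree \<open>0\<close> on the curve over the algebraic closure of \<open>K\<close>.
\<close>

definition jacobian_points ::
    "'k::field \<Rightarrow> 'k poly \<Rightarrow> ('k alg_closure curve_point \<Rightarrow>\<^sub>0 int) set set" where
  "jacobian_points d f =
     (let d' = to_ac d; f' = map_poly to_ac f in
      {divisor_class d' f' A |A.
         A \<in> carrier (divisor_group d' f') \<and> divisor_degree A = 0 \<and>
         (\<forall>\<sigma>\<in>galois_group.
            divisor_class d' f' (frag_extend (frag_of \<circ> map_curve_point \<sigma>) A) =
            divisor_class d' f' A)})"

definition jacobian_rank :: "'k::field \<Rightarrow> 'k poly \<Rightarrow> enat" where
  "jacobian_rank d f =
     subgroup_rank (picard_group (to_ac d) (map_poly to_ac f)) (jacobian_points d f)"

definition elliptic_curve :: "'k::field \<Rightarrow> 'k poly \<Rightarrow> 'k curve_point \<Rightarrow> bool" where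
  "elliptic_curve d f O\<^sub>E \<longleftrightarrow> d \<noteq> 0 \<and> degree f \<in> {3, 4} \<and>
     rsquarefree (map_poly to_ac f) \<and> O\<^sub>E \<in> curve_points d f"

text \<open>
  The group law on the set \<open>E(K)\<close> of \<open>K\<close>-rational points of an elliptic curve with origin \<open>O\<close> is the
  one for which the injection \<open>P \<mapsto> [P - O]\<close> into the Picard group is a homomorphism;
  here \<open>E(K)\<close> is identified with its image under this injection.
\<close>

definition mordell_weil_group ::
    "'k::field \<Rightarrow> 'k poly \<Rightarrow> 'k curve_point \<Rightarrow> ('k alg_closure curve_point \<Rightarrow>\<^sub>0 int) set set" where
  "mordell_weil_group d f O\<^sub>E =
     {divisor_class (to_ac d) (map_poly to_ac f)
        (frag_of (map_curve_point to_ac P) - frag_of (map_curve_point to_ac O\<^sub>E)) |P.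
      P \<in> curve_points d f}"

definition mordell_weil_rank :: "'k::field \<Rightarrow> 'k poly \<Rightarrow> 'k curve_point \<Rightarrow> enat" where
  "mordell_weil_rank d f O\<^sub>E =
     subgroup_rank (picard_group (to_ac d) (map_poly to_ac f)) (mordell_weil_group d f O\<^sub>E)"


section \<open>The rational function field \<open>\<rat>(v\<^sub>1, v\<^sub>2, v\<^sub>3)\<close>\<close>

type_synonym ratfun3 = "rat poly poly poly fract"

definition ratfun3_const :: "rat \<Rightarrow> ratfun3"
  where "ratfun3_const c = to_fract [:[:[:c:]:]:]"

end

theory Submission
  imports Defs "HOL-Computational_Algebra.Formal_Laurent_Series"
begin

text \<open>
  Take \<open>D = (W/a)\<^sup>2\<close> to be a square in \<open>K = \<rat>(v\<^sub>1, v\<^sub>2, v\<^sub>3)\<close>. The twist of \<open>E\<close> by \<open>D\<close> is then isomorphic to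
  \<open>E\<close> itself, and a point of \<open>E(\<rat>)\<close> that is torsion over the algebraic closure of \<open>K\<close> is already
  torsion over that of \<open>\<rat>\<close>: a function with divisor \<open>n (P - O)\<close> amounts to a polynomial form with
  prescribed zeros, a \<open>\<rat>\<close>-linear condition on its coefficients, so a \<open>\<rat>\<close>-linear functional turns a
  solution over the large field into one over \<open>\<rat>\<close>.

  On \<open>y\<^sup>2 = x\<^sup>m + W\<^sup>2\<close>, for a suitable \<open>W \<in> \<rat>(t)\<close>, there are three explicit points \<open>P\<^sub>i = (x\<^sub>i, y\<^sub>i)\<close>. Let
  \<open>\<theta>\<close> be the derivation of \<open>K[x]\<close> that extends \<open>d/dt\<close> and multiplies \<open>x\<^sup>m + W\<^sup>2\<close> by a constant. If
  \<open>\<Sum> n\<^sub>i (P\<^sub>i - \<infinity>)\<close> is the divisor of \<open>h\<close>, then summing the residues of the differential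
  \<open>(\<theta> h / h) dx/y\<close> gives \<open>\<Sum> n\<^sub>i \<theta>(x - x\<^sub>i)(x\<^sub>i) / y\<^sub>i = 0\<close>, an algebraic form of Abel's theorem. For the
  chosen points this is a polynomial identity in \<open>t\<close> which forces \<open>n\<^sub>1 = n\<^sub>2 = n\<^sub>3 = 0\<close>.
\<close>

text \<open>The ranks are defined by divisors over an algebraic closure, with orders given by powers
  of maximal ideals. Orders are therefore translated into orders of Laurent series along a branch,
  and a principal divisor with bounded poles into one form A + B y with prescribed zeros: conditions
  on such a form are linear, those on a quotient of forms are not. The linear functional serves a
  second time for the Jacobian, because \<theta> acts on K[x] and not on polynomials over the
  closure of K.

  The curve y^2 = x^m + W^2 is isotrivial: scaling x by W^(2/m) and y by W makes it constant. Hence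
  \<theta> acts on y as multiplication by an element of K, and up to a sign and a power of W, the
  quantity \<theta>(x - x_P)(x_P) / y_P is the t-derivative of the abelian integral of dx/y up to P.
  The bound m \<ge> 3 makes dx/y regular at infinity. The sum of residues itself is carried out as
  Lagrange interpolation of polynomials.\<close>

section \<open>Ring morphisms and evaluation of polynomials in two variables\<close>

locale ring_morphism =
  fixes h :: "'a::comm_ring_1 \<Rightarrow> 'b::comm_ring_1"
  assumes hom_1 [simp]: "h 1 = 1"
    and hom_add [simp]: "h (x + y) = h x + h y"
    and hom_mult [simp]: "h (x * y) = h x * h y"
begin

lemma hom_0 [simp]: "h 0 = 0"
  using hom_add[of 0 0] by simp

lemma hom_uminus [simp]: "h (- x) = - h x"
  using hom_add[of x "- x"] by (simp add: eq_neg_iff_add_eq_0 add.commute)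

lemma hom_diff [simp]: "h (x - y) = h x - h y"
  using hom_add[of x "- y"] by simp

lemma hom_sum: "h (sum g A) = (\<Sum>x\<in>A. h (g x))"
  by (induction A rule: infinite_finite_induct) auto

lemma hom_power [simp]: "h (x ^ n) = h x ^ n"
  by (induction n) auto

lemma hom_of_nat: "h (of_nat n) = of_nat n"
  by (induction n) auto

lemma hom_of_int: "h (of_int n) = of_int n"
  by (cases n) (auto simp: hom_of_nat simp flip: of_nat_Suc)

lemma coeff_map [simp]: "coeff (map_poly h p) n = h (coeff p n)"
  by (simp add: coeff_map_poly)

lemma map_poly_pCons_hom [simp]: "map_poly h (pCons a p) = pCons (h a) (map_poly h p)"
  by (simp add: map_poly_pCons)

lemma map_poly_morphism: "ring_morphism (map_poly h)"
proof
  show "map_poly h 1 = 1"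
    by simp
  show "map_poly h (p + q) = map_poly h p + map_poly h q" for p q
    by (rule poly_eqI) simp
  show "map_poly h (p * q) = map_poly h p * map_poly h q" for p q
    by (rule poly_eqI) (simp add: coeff_mult hom_sum)
qed

lemma eval_morphism: "ring_morphism (\<lambda>p. poly (map_poly h p) \<xi>)"
proof -
  interpret m: ring_morphism "map_poly h"
    by (rule map_poly_morphism)
  show ?thesis
    by unfold_locales auto
qed

lemma hom_poly: "h (poly p x) = poly (map_poly h p) (h x)"
  by (induction p) (auto simp: map_poly_pCons)

end

lemma ring_morphism_comp:
  assumes "ring_morphism g" "ring_morphism h"
  shows "ring_morphism (\<lambda>x. g (h x))"
proof -
  interpret g: ring_morphism g by fact
  interpret h: ring_morphism h by fact
  show ?thesis
    by unfold_locales auto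
qed

text \<open>With \<open>h\<close> the inclusion of constants into a ring of series, this is the
  pullback of a form to the parametrized branch (\<open>\<xi>\<close>, \<open>\<eta>\<close>). All
  orders of vanishing are computed through it.\<close>

definition eval2 :: "('a::comm_ring_1 \<Rightarrow> 'b::comm_ring_1) \<Rightarrow> 'b \<Rightarrow> 'b \<Rightarrow> 'a poly poly \<Rightarrow> 'b"
  where "eval2 h \<xi> \<eta> H = poly (map_poly (\<lambda>p. poly (map_poly h p) \<xi>) H) \<eta>"

lemma (in ring_morphism) eval2_morphism: "ring_morphism (eval2 h \<xi> \<eta>)"
proof -
  interpret e: ring_morphism "\<lambda>p. poly (map_poly h p) \<xi>"
    by (rule eval_morphism)
  show ?thesis
    using e.eval_morphism[of \<eta>] by (simp add: eval2_def[abs_def])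
qed

lemma (in ring_morphism) eval2_pCons [simp]:
  "eval2 h \<xi> \<eta> (pCons p H) = poly (map_poly h p) \<xi> + \<eta> * eval2 h \<xi> \<eta> H"
proof -
  interpret e: ring_morphism "\<lambda>p. poly (map_poly h p) \<xi>"
    by (rule eval_morphism)
  show ?thesis
    by (simp add: eval2_def)
qed

lemma eval2_0 [simp]: "eval2 h \<xi> \<eta> 0 = 0"
  by (simp add: eval2_def)

lemma eval2_hom:
  assumes "ring_morphism g" "ring_morphism h"
  shows "g (eval2 h \<xi> \<eta> H) = eval2 (\<lambda>x. g (h x)) (g \<xi>) (g \<eta>) H"
proof -
  interpret g: ring_morphism g by fact
  interpret h: ring_morphism h by fact
  interpret gh: ring_morphism "\<lambda>x. g (h x)"
    by (rule ring_morphism_comp[OF assms])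
  have *: "g (poly (map_poly h p) \<xi>) = poly (map_poly (\<lambda>x. g (h x)) p) (g \<xi>)" for p
    by (induction p) auto
  show ?thesis
    by (induction H) (auto simp: *)
qed

interpretation fps_const: ring_morphism "fps_const :: 'a::field \<Rightarrow> 'a fps"
  by unfold_locales auto

interpretation fls_const: ring_morphism "fls_const :: 'a::field \<Rightarrow> 'a fls"
  by unfold_locales (auto simp: fls_plus_const fls_const_mult_const)

declare fps_const.hom_add [simp del] fps_const.hom_mult [simp del] fps_const.hom_uminus [simp del]
  fps_const.hom_diff [simp del] fps_const.hom_power [simp del]
  fls_const.hom_add [simp del] fls_const.hom_mult [simp del] fls_const.hom_uminus [simp del]
  fls_const.hom_diff [simp del] fls_const.hom_power [simp del]

interpretation fps_to_fls: ring_morphism "fps_to_fls :: 'a::field fps \<Rightarrow> 'a fls"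
  by unfold_locales (auto simp: fls_plus_const fls_times_fps_to_fls)

lemma fps_to_fls_eval2:
  fixes \<xi> \<eta> :: "'a::field fps"
  shows
  "fps_to_fls (eval2 fps_const \<xi> \<eta> H) = eval2 fls_const (fps_to_fls \<xi>) (fps_to_fls \<eta>) H"
  using eval2_hom[OF fps_to_fls.ring_morphism_axioms fps_const.ring_morphism_axioms, of \<xi> \<eta> H]
  by simp

section \<open>Local parametrizations\<close>

text \<open>The last clause says that the series variable is a uniformizer of the curve. At a branch
  point y0 = 0 it is compared with y, because there x - x0 vanishes doubly; elsewhere it is compared
  with x - x0.\<close>

definition local_param :: "'k::field \<Rightarrow> 'k poly \<Rightarrow> 'k \<Rightarrow> 'k \<Rightarrow> 'k fps \<Rightarrow> 'k fps \<Rightarrow> bool" where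
  "local_param d f x0 y0 \<xi> \<eta> \<longleftrightarrow> fps_nth \<xi> 0 = x0 \<and> fps_nth \<eta> 0 = y0 \<and>
     fps_const d * \<eta> ^ 2 = poly (map_poly fps_const f) \<xi> \<and>
     (if y0 = 0 then subdegree \<eta> = 1 else subdegree (\<xi> - fps_const x0) = 1)"

lemma fps_nth_poly_fps_const_0: "fps_nth (poly (map_poly fps_const p) \<xi>) 0 = poly p (fps_nth \<xi> 0)"
  for p :: "'k::field poly"
  by (induction p) auto

lemma (in ring_morphism) eval_pcompose:
  "poly (map_poly h (pcompose p q)) z = poly (map_poly h p) (poly (map_poly h q) z)"
proof -
  interpret e: ring_morphism "\<lambda>p. poly (map_poly h p) z"
    by (rule eval_morphism)
  show ?thesis
    by (induction p) (simp_all only: pcompose_pCons e.hom_add e.hom_mult, simp_all)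
qed

lemma poly_shift_fps:
  "poly (map_poly fps_const p) (fps_const c + \<xi>) = poly (map_poly fps_const (pcompose p [:c, 1:])) \<xi>"
  for p :: "'k::field poly"
  by (simp add: fps_const.eval_pcompose)

lemma poly_fps_const_fps_X: "poly (map_poly fps_const p) fps_X = fps_of_poly p"
  for p :: "'k::field poly"
  by (induction p) (auto simp: fps_of_poly_pCons)

lemma fps_compose_poly:
  fixes p :: "'k::field poly"
  assumes "fps_nth b 0 = 0"
  shows "poly (map_poly fps_const p) a oo b = poly (map_poly fps_const p) (a oo b)"
  by (induction p) (auto simp: fps_compose_add_distrib fps_compose_mult_distrib[OF assms])

text \<open>Away from the branch points, \<open>\<eta>\<close> is a square root of f(x0 + X) / d. At
  a branch point the roles are exchanged: \<open>\<eta>\<close> is X, and \<open>\<xi>\<close>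
  solves f(x0 + \<open>\<xi>\<close>) / d = X^2 by the compositional inverse of the left side, which
  exists because its linear coefficient is f'(x0) / d.\<close>

lemma local_param_exists:
  fixes d :: "'k::field_char_0"
  assumes d: "d \<noteq> 0" and on_curve: "d * y0 ^ 2 = poly f x0"
    and smooth: "y0 \<noteq> 0 \<or> poly (pderiv f) x0 \<noteq> 0"
  obtains \<xi> \<eta> where "local_param d f x0 y0 \<xi> \<eta>"
proof (cases "y0 = 0")
  case False
  define g where "g = fps_of_poly (smult (1/d) (pcompose f [:x0, 1:]))"
  have g0: "fps_nth g 0 = y0 ^ 2"
    using d on_curve by (simp add: g_def poly_0_coeff_0[symmetric] poly_pcompose field_simps)
  \<comment> \<open>The first argument selects a root of the constant coefficient; returning
    \<open>y0\<close> fixes the sign of the square root.\<close>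
  define \<eta> where "\<eta> = fps_radical (\<lambda>_ _. y0) (Suc 1) g"
  have "\<eta> ^ Suc 1 = g"
    unfolding \<eta>_def using False g0
    by (subst power_radical[symmetric]) (auto simp: numeral_2_eq_2)
  hence \<eta>: "\<eta> ^ 2 = g"
    by (simp add: numeral_2_eq_2)
  have Y0: "fps_nth \<eta> 0 = y0"
    by (simp add: \<eta>_def fps_radical_nth_0)
  have "fps_const d * g = poly (map_poly fps_const f) (fps_const x0 + fps_X)"
    using d by (simp add: poly_shift_fps poly_fps_const_fps_X g_def fps_of_poly_smult flip: mult.assoc)
  hence "local_param d f x0 y0 (fps_const x0 + fps_X) \<eta>"
    using False by (simp add: local_param_def \<eta> Y0)
  thus ?thesis
    by (rule that)
next
  case True
  define g where "g = fps_of_poly (smult (1/d) (pcompose f [:x0, 1:]))"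
  have g0: "fps_nth g 0 = 0"
    using on_curve True by (simp add: g_def poly_0_coeff_0[symmetric] poly_pcompose)
  have "coeff (pcompose f [:x0, 1:]) 1 = poly (pderiv (pcompose f [:x0, 1:])) 0"
    by (simp add: poly_0_coeff_0 coeff_pderiv)
  also have "\<dots> = poly (pderiv f) x0"
    by (simp add: pderiv_pcompose poly_pcompose pderiv_pCons)
  finally have g1: "fps_nth g 1 \<noteq> 0"
    using smooth True d by (simp add: g_def)
  define \<xi> where "\<xi> = fps_inv g oo (fps_X ^ 2 :: 'k fps)"
  have X2: "fps_nth (fps_X ^ 2 :: 'k fps) 0 = 0"
    by simp
  have inv0: "fps_nth (fps_inv g) 0 = 0"
    by (simp add: fps_inv_def)
  have "g oo \<xi> = (g oo fps_inv g) oo fps_X ^ 2"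
    unfolding \<xi>_def by (rule fps_compose_assoc) (use inv0 in auto)
  also have "\<dots> = fps_X ^ 2"
    using fps_inv_right[OF g0 g1] by (simp add: fps_X_power_compose)
  finally have gX: "g oo \<xi> = fps_X ^ 2" .
  have X0: "fps_nth \<xi> 0 = 0"
    by (simp add: \<xi>_def fps_compose_nth inv0)
  have "poly (map_poly fps_const f) (fps_const x0 + \<xi>) =
      fps_const d * (g oo \<xi>)"
    using d unfolding poly_shift_fps g_def fps_of_poly_smult
    by (simp add: fps_compose_mult_distrib[OF X0] fps_compose_poly[OF X0] X0
        flip: poly_fps_const_fps_X mult.assoc)
  hence "local_param d f x0 y0 (fps_const x0 + \<xi>) fps_X"
    using True by (simp add: local_param_def X0 gX)
  thus ?thesis
    by (rule that)
qed

section \<open>The order of vanishing at a smooth point\<close>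

text \<open>The ideal membership behind \<open>affine_ord\<close>, isolated because it is meaningful
  before the exponents are known to be bounded, and because it is a linear condition on
  \<open>H\<close> while the order is not.\<close>

definition vanishes :: "'k::field \<Rightarrow> 'k poly \<Rightarrow> 'k \<Rightarrow> 'k \<Rightarrow> nat \<Rightarrow> 'k poly poly \<Rightarrow> bool" where
  "vanishes d f x0 y0 n H \<longleftrightarrow> (\<exists>Q R. H = Q * curve_eq d f +
     (\<Sum>i\<le>n. R i * [:[:- x0, 1:]:] ^ i * [:[:- y0:], 1:] ^ (n - i)))"

lemma affine_ord_vanishes: "affine_ord d f x0 y0 H = (GREATEST n. vanishes d f x0 y0 n H)"
  by (simp add: affine_ord_def vanishes_def)

lemma vanishes_0: "vanishes d f x0 y0 0 H"
  unfolding vanishes_def by (rule exI[of _ 0], rule exI[of _ "\<lambda>_. H"]) simp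

lemma vanishes_add:
  assumes "vanishes d f x0 y0 n G" "vanishes d f x0 y0 n H"
  shows "vanishes d f x0 y0 n (G + H)"
proof -
  obtain Q R where 1: "G = Q * curve_eq d f +
     (\<Sum>i\<le>n. R i * [:[:- x0, 1:]:] ^ i * [:[:- y0:], 1:] ^ (n - i))"
    using assms unfolding vanishes_def by blast
  obtain Q' R' where 2: "H = Q' * curve_eq d f +
     (\<Sum>i\<le>n. R' i * [:[:- x0, 1:]:] ^ i * [:[:- y0:], 1:] ^ (n - i))"
    using assms unfolding vanishes_def by blast
  show ?thesis
    unfolding vanishes_def
    by (rule exI[of _ "Q + Q'"], rule exI[of _ "\<lambda>i. R i + R' i"], subst 1, subst 2)
       (simp only: sum.distrib distrib_right distrib_left ac_simps)
qed

lemma vanishes_mult_left: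
  assumes "vanishes d f x0 y0 n H"
  shows "vanishes d f x0 y0 n (G * H)"
proof -
  obtain Q R where 1: "H = Q * curve_eq d f +
     (\<Sum>i\<le>n. R i * [:[:- x0, 1:]:] ^ i * [:[:- y0:], 1:] ^ (n - i))"
    using assms unfolding vanishes_def by blast
  show ?thesis
    unfolding vanishes_def
    by (rule exI[of _ "G * Q"], rule exI[of _ "\<lambda>i. G * R i"], subst 1)
       (simp only: sum_distrib_left distrib_left mult.assoc)
qed

lemma vanishes_minus: "vanishes d f x0 y0 n H \<Longrightarrow> vanishes d f x0 y0 n (- H)"
  using vanishes_mult_left[of d f x0 y0 n H "-1"] by simp

lemma vanishes_diff:
  "vanishes d f x0 y0 n G \<Longrightarrow> vanishes d f x0 y0 n H \<Longrightarrow> vanishes d f x0 y0 n (G - H)"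
  using vanishes_add[OF _ vanishes_minus, of d f x0 y0 n G H] by simp

lemma vanishes_curve_eq: "vanishes d f x0 y0 n (Q * curve_eq d f)"
  unfolding vanishes_def by (rule exI[of _ Q], rule exI[of _ "\<lambda>_. 0"]) simp

text \<open>For an ideal M = (a, b) one has M^(n+1) = a M^n + b M^n. This recursion replaces the
  explicit sum in the later inductions on n.\<close>

lemma vanishes_Suc_iff:
  "vanishes d f x0 y0 (Suc n) H \<longleftrightarrow> (\<exists>G1 G2 Q. vanishes d f x0 y0 n G1 \<and> vanishes d f x0 y0 n G2 \<and>
     H = Q * curve_eq d f + [:[:- x0, 1:]:] * G1 + [:[:- y0:], 1:] * G2)"
  (is "?lhs \<longleftrightarrow> ?rhs")
proof
  define a b where "a = [:[:- x0, 1:]:]" and "b = [:[:- y0:], 1:]"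
  note v = vanishes_def[of d f x0 y0, folded a_def b_def]
  {
    assume ?lhs
    then obtain Q R where *: "H = Q * curve_eq d f + (\<Sum>i\<le>Suc n. R i * a ^ i * b ^ (Suc n - i))"
      unfolding v by blast
    define G1 where "G1 = 0 * curve_eq d f + (\<Sum>i\<le>n. R (Suc i) * a ^ i * b ^ (n - i))"
    have "vanishes d f x0 y0 n G1"
      unfolding v G1_def by (rule exI[of _ 0], rule exI[of _ "\<lambda>i. R (Suc i)"]) simp
    \<comment> \<open>Only the term of index 0 has no factor x - x0, so it alone is charged to y -
      y0.\<close>
    moreover have "vanishes d f x0 y0 n (R 0 * b ^ n)"
      unfolding v by (rule exI[of _ 0], rule exI[of _ "\<lambda>i. if i = 0 then R 0 else 0"])
        (simp add: if_distrib[of "\<lambda>x. x * _"] sum.delta' cong: if_cong)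
    moreover have "H = Q * curve_eq d f + a * G1 + b * (R 0 * b ^ n)"
      unfolding * sum.atMost_Suc_shift G1_def by (simp add: sum_distrib_left algebra_simps)
    ultimately show ?rhs
      unfolding a_def b_def by blast
  }
  {
    assume ?rhs
    then obtain G1 G2 Q where G: "vanishes d f x0 y0 n G1" "vanishes d f x0 y0 n G2"
      and H: "H = Q * curve_eq d f + a * G1 + b * G2"
      unfolding a_def b_def by blast
    obtain Q1 R1 where 1: "G1 = Q1 * curve_eq d f + (\<Sum>i\<le>n. R1 i * a ^ i * b ^ (n - i))"
      using G unfolding v by blast
    obtain Q2 R2 where 2: "G2 = Q2 * curve_eq d f + (\<Sum>i\<le>n. R2 i * a ^ i * b ^ (n - i))"
      using G unfolding v by blast
    have "vanishes d f x0 y0 (Suc n) (\<Sum>i\<le>n. R1 i * a ^ Suc i * b ^ (n - i))"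
      unfolding v by (rule exI[of _ 0], rule exI[of _ "\<lambda>i. case i of 0 \<Rightarrow> 0 | Suc j \<Rightarrow> R1 j"])
        (simp only: sum.atMost_Suc_shift, simp)
    moreover have "vanishes d f x0 y0 (Suc n) (\<Sum>i\<le>n. R2 i * a ^ i * b ^ (Suc n - i))"
      unfolding v
      by (rule exI[of _ 0], rule exI[of _ "\<lambda>i. if i = Suc n then 0 else R2 i"]) simp
    moreover have "H = (Q + a * Q1 + b * Q2) * curve_eq d f +
       ((\<Sum>i\<le>n. R1 i * a ^ Suc i * b ^ (n - i)) + (\<Sum>i\<le>n. R2 i * a ^ i * b ^ (Suc n - i)))"
      unfolding H 1 2
      by (simp add: sum_distrib_left Suc_diff_le distrib_left distrib_right ac_simps)
    ultimately show ?lhs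
      by (simp only: vanishes_add vanishes_curve_eq)
  }
qed

lemma vanishes_mult:
  "vanishes d f x0 y0 n G \<Longrightarrow> vanishes d f x0 y0 k H \<Longrightarrow> vanishes d f x0 y0 (n + k) (G * H)"
proof (induction n arbitrary: G)
  case 0
  thus ?case by (simp add: vanishes_mult_left)
next
  case (Suc n)
  then obtain G1 G2 Q where G: "vanishes d f x0 y0 n G1" "vanishes d f x0 y0 n G2"
    "G = Q * curve_eq d f + [:[:- x0, 1:]:] * G1 + [:[:- y0:], 1:] * G2"
    unfolding vanishes_Suc_iff by blast
  have "G * H = (Q * H) * curve_eq d f + [:[:- x0, 1:]:] * (G1 * H) + [:[:- y0:], 1:] * (G2 * H)"
    unfolding G(3) by (simp only: distrib_right distrib_left ac_simps)
  thus ?case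
    unfolding vanishes_Suc_iff add_Suc using Suc.IH[OF G(1) Suc.prems(2)] Suc.IH[OF G(2) Suc.prems(2)]
    by blast
qed

lemma vanishes_x: "vanishes d f x0 y0 1 [:[:- x0, 1:]:]"
  unfolding One_nat_def vanishes_Suc_iff
  by (rule exI[of _ 1], rule exI[of _ 0], rule exI[of _ 0]) (simp add: vanishes_0)

lemma vanishes_y: "vanishes d f x0 y0 1 [:[:- y0:], 1:]"
  unfolding One_nat_def vanishes_Suc_iff
  by (rule exI[of _ 0], rule exI[of _ 1], rule exI[of _ 0]) (simp add: vanishes_0)

text \<open>The Taylor expansion of d y^2 - f(x) at (x0, y0). Its linear part is nonzero exactly
  when the point is smooth, and it then relates x - x0 and y - y0 modulo the square of the maximal
  ideal.\<close>

lemma curve_eq_taylor: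
  fixes d :: "'k::field"
  assumes "d * y0 ^ 2 = poly f x0"
  obtains q where "curve_eq d f = [:[:d:]:] * [:[:- y0:], 1:] ^ 2 + [:[:2 * d * y0:]:] * [:[:- y0:], 1:]
     - [:[:poly (pderiv f) x0:]:] * [:[:- x0, 1:]:] - [:[:- x0, 1:]:] ^ 2 * [:q:]"
proof -
  define p where "p = synthetic_div f x0"
  have f: "f = [:- x0, 1:] * p + [:poly f x0:]"
    using synthetic_div_correct'[of x0 f] by (simp add: p_def)
  define q where "q = synthetic_div p x0"
  have p: "p = [:- x0, 1:] * q + [:poly p x0:]"
    using synthetic_div_correct'[of x0 p] by (simp add: q_def)
  have "poly (pderiv f) x0 = poly (pderiv ([:- x0, 1:] * p + [:poly f x0:])) x0"
    using f by simp
  also have "\<dots> = poly p x0"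
    by (simp only: pderiv_add pderiv_mult) (simp add: pderiv_pCons)
  finally have f': "poly (pderiv f) x0 = poly p x0" .
  have "f = [:- x0, 1:] ^ 2 * q + [:poly p x0:] * [:- x0, 1:] + [:poly f x0:]"
    by (subst f, subst p) (simp only: algebra_simps power2_eq_square)
  hence "curve_eq d f = [:-([:- x0, 1:] ^ 2 * q + [:poly p x0:] * [:- x0, 1:] + [:d * y0 ^ 2:]), 0, [:d:]:]"
    using assms by (simp add: curve_eq_def)
  also have "\<dots> = [:[:d:]:] * [:[:- y0:], 1:] ^ 2 + [:[:2 * d * y0:]:] * [:[:- y0:], 1:]
     - [:[:poly (pderiv f) x0:]:] * [:[:- x0, 1:]:] - [:[:- x0, 1:]:] ^ 2 * [:q:]"
    by (simp add: power2_eq_square f' algebra_simps)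
  finally show ?thesis
    by (rule that)
qed

text \<open>In the local ring at a smooth point, \<open>x - x\<^sub>0\<close> or \<open>y\<close> generates the maximal ideal.\<close>

lemma uniformizer:
  fixes d :: "'k::field_char_0"
  assumes d: "d \<noteq> 0" and on_curve: "d * y0 ^ 2 = poly f x0"
    and smooth: "y0 \<noteq> 0 \<or> poly (pderiv f) x0 \<noteq> 0"
  defines "z \<equiv> (if y0 = 0 then [:[:- y0:], 1:] else [:[:- x0, 1:]:])"
  obtains \<alpha> \<beta> where "vanishes d f x0 y0 2 ([:[:- x0, 1:]:] - [:[:\<alpha>:]:] * z)"
    and "vanishes d f x0 y0 2 ([:[:- y0:], 1:] - [:[:\<beta>:]:] * z)"
proof -
  define a b where "a = [:[:- x0, 1:]:]" and "b = [:[:- y0:], 1:]"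
  obtain q where q: "curve_eq d f = [:[:d:]:] * b ^ 2 + [:[:2 * d * y0:]:] * b
     - [:[:poly (pderiv f) x0:]:] * a - a ^ 2 * [:q:]"
    using curve_eq_taylor[OF on_curve] unfolding a_def b_def by blast
  have a2: "vanishes d f x0 y0 2 (a ^ 2)" and b2: "vanishes d f x0 y0 2 (b ^ 2)"
    using vanishes_mult[OF vanishes_x vanishes_x] vanishes_mult[OF vanishes_y vanishes_y]
    by (simp_all only: a_def b_def power2_eq_square one_add_one)
  \<comment> \<open>The linear part of the Taylor expansion: what remains of the equation once the
    quadratic terms are moved away, hence an element of the square of the maximal ideal.\<close>
  define s where "s = 1 * curve_eq d f - [:[:d:]:] * b ^ 2 + [:q:] * a ^ 2"
  have s2: "vanishes d f x0 y0 2 s"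
    unfolding s_def by (intro vanishes_add vanishes_diff vanishes_mult_left a2 b2 vanishes_curve_eq)
  have s: "s = [:[:2 * d * y0:]:] * b - [:[:poly (pderiv f) x0:]:] * a"
    unfolding s_def q by (simp only: mult_1_left) (simp only: algebra_simps)
  have zero: "vanishes d f x0 y0 2 0"
    using vanishes_curve_eq[of d f x0 y0 2 0] by simp
  show ?thesis
  proof (cases "y0 = 0")
    case False
    define \<beta> where "\<beta> = poly (pderiv f) x0 / (2 * d * y0)"
    have "[:[:1 / (2 * d * y0):]:] * s = b - [:[:\<beta>:]:] * a"
      using d False by (simp add: s \<beta>_def right_diff_distrib flip: mult.assoc one_pCons)
    hence "vanishes d f x0 y0 2 (b - [:[:\<beta>:]:] * a)"
      using vanishes_mult_left[OF s2] by metis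
    moreover have "vanishes d f x0 y0 2 (a - [:[:1:]:] * a)"
      using zero by (simp flip: one_pCons)
    ultimately show ?thesis
      by (intro that[of 1 \<beta>]) (simp_all only: z_def a_def b_def False if_False)
  next
    case True
    have f': "poly (pderiv f) x0 \<noteq> 0"
      using True smooth by simp
    have "[:[:1 / poly (pderiv f) x0:]:] * (- s) = a"
      using f' True by (simp add: s flip: one_pCons)
    hence "vanishes d f x0 y0 2 a"
      using vanishes_mult_left[OF vanishes_minus[OF s2]] by metis
    hence "vanishes d f x0 y0 2 (a - [:[:0:]:] * b)"
      by simp
    moreover have "vanishes d f x0 y0 2 (b - [:[:1:]:] * b)"
      using zero by (simp flip: one_pCons)
    ultimately show ?thesis
      by (intro that[of 0 1]) (simp_all only: z_def a_def b_def True if_True simp_thms)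
  qed
qed

lemma vanishes_1_diff_value:
  fixes d :: "'k::field"
  obtains c where "vanishes d f x0 y0 1 (H - [:[:c:]:])"
proof -
  define p where "p = poly H [:y0:]"
  have "poly (H - [:p:]) [:y0:] = 0"
    by (simp add: p_def)
  hence "[:- [:y0:], 1:] dvd H - [:p:]"
    by (simp only: poly_eq_0_iff_dvd)
  then obtain G1 where G1: "H - [:p:] = [:[:- y0:], 1:] * G1"
    by (auto simp: dvd_def)
  have "poly (p - [:poly p x0:]) x0 = 0"
    by simp
  hence "[:- x0, 1:] dvd p - [:poly p x0:]"
    by (simp only: poly_eq_0_iff_dvd)
  then obtain G2 where G2: "p - [:poly p x0:] = [:- x0, 1:] * G2"
    by (auto simp: dvd_def)
  have "H - [:[:poly p x0:]:] = (H - [:p:]) + [:p - [:poly p x0:]:]"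
    by simp
  also have "[:p - [:poly p x0:]:] = [:G2:] * [:[:- x0, 1:]:]"
    unfolding G2 by (simp add: mult.commute)
  also have "H - [:p:] = G1 * [:[:- y0:], 1:]"
    using G1 by (simp only: mult.commute)
  finally have "vanishes d f x0 y0 1 (H - [:[:poly p x0:]:])"
    by (simp only: vanishes_add vanishes_mult_left vanishes_x vanishes_y)
  thus ?thesis
    by (rule that)
qed

text \<open>The quotient M^n / M^(n+1) is spanned by z^n because M / M^2 is spanned by z. In the
  step, a and b are replaced by \<open>\<alpha>\<close> z and \<open>\<beta>\<close> z, and the two
  cofactors by their own leading terms, which gives the coefficient c1 \<open>\<alpha>\<close> + c2
  \<open>\<beta>\<close>.\<close>

lemma vanishes_leading_term:
  fixes d :: "'k::field_char_0"
  assumes d: "d \<noteq> 0" and on_curve: "d * y0 ^ 2 = poly f x0"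
    and smooth: "y0 \<noteq> 0 \<or> poly (pderiv f) x0 \<noteq> 0"
  defines "z \<equiv> (if y0 = 0 then [:[:- y0:], 1:] else [:[:- x0, 1:]:])"
  assumes "vanishes d f x0 y0 n H"
  shows "\<exists>c. vanishes d f x0 y0 (Suc n) (H - [:[:c:]:] * z ^ n)"
  using \<open>vanishes d f x0 y0 n H\<close>
proof (induction n arbitrary: H)
  case 0
  obtain c where "vanishes d f x0 y0 1 (H - [:[:c:]:])"
    by (rule vanishes_1_diff_value)
  thus ?case
    by (intro exI[of _ c]) simp
next
  case (Suc n)
  define a b where "a = [:[:- x0, 1:]:]" and "b = [:[:- y0:], 1:]"
  obtain \<alpha> \<beta> where ab: "vanishes d f x0 y0 2 (a - [:[:\<alpha>:]:] * z)"
      "vanishes d f x0 y0 2 (b - [:[:\<beta>:]:] * z)"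
    using uniformizer[OF d on_curve smooth] unfolding z_def a_def b_def by blast
  obtain G1 G2 Q where G: "vanishes d f x0 y0 n G1" "vanishes d f x0 y0 n G2"
    and H: "H = Q * curve_eq d f + a * G1 + b * G2"
    using Suc.prems unfolding vanishes_Suc_iff a_def b_def by blast
  obtain c1 where c1: "vanishes d f x0 y0 (Suc n) (G1 - [:[:c1:]:] * z ^ n)"
    using Suc.IH[OF G(1)] by blast
  obtain c2 where c2: "vanishes d f x0 y0 (Suc n) (G2 - [:[:c2:]:] * z ^ n)"
    using Suc.IH[OF G(2)] by blast
  have z: "vanishes d f x0 y0 1 z"
    unfolding z_def by (simp only: vanishes_x vanishes_y split: if_split) simp
  have zn: "vanishes d f x0 y0 n (z ^ n)"
  proof (induction n)
    case (Suc n)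
    thus ?case using vanishes_mult[OF z Suc] by simp
  qed (simp add: vanishes_0)
  have "H - [:[:c1 * \<alpha> + c2 * \<beta>:]:] * z ^ Suc n = Q * curve_eq d f +
     (a * (G1 - [:[:c1:]:] * z ^ n) + b * (G2 - [:[:c2:]:] * z ^ n) +
      [:[:c1:]:] * ((a - [:[:\<alpha>:]:] * z) * z ^ n) + [:[:c2:]:] * ((b - [:[:\<beta>:]:] * z) * z ^ n))"
  proof -
    have "[:[:c1 * \<alpha> + c2 * \<beta>:]:] = [:[:c1:]:] * [:[:\<alpha>:]:] + [:[:c2:]:] * [:[:\<beta>:]:]"
      by simp
    thus ?thesis
      unfolding H power_Suc by (simp only: algebra_simps)
  qed
  moreover have "vanishes d f x0 y0 (Suc (Suc n)) (a * (G1 - [:[:c1:]:] * z ^ n))"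
    "vanishes d f x0 y0 (Suc (Suc n)) (b * (G2 - [:[:c2:]:] * z ^ n))"
    using vanishes_mult[OF vanishes_x c1] vanishes_mult[OF vanishes_y c2]
    by (simp_all only: a_def b_def plus_1_eq_Suc)
  moreover have "vanishes d f x0 y0 (Suc (Suc n)) ((a - [:[:\<alpha>:]:] * z) * z ^ n)"
    "vanishes d f x0 y0 (Suc (Suc n)) ((b - [:[:\<beta>:]:] * z) * z ^ n)"
    using vanishes_mult[OF ab(1) zn] vanishes_mult[OF ab(2) zn]
    by (simp_all only: add_2_eq_Suc)
  ultimately show ?case
    by (intro exI[of _ "c1 * \<alpha> + c2 * \<beta>"])
       (simp only: vanishes_add vanishes_curve_eq vanishes_mult_left)
qed

lemma fps_X_power_dvd_iff: "fps_X ^ n dvd g \<longleftrightarrow> g = 0 \<or> n \<le> subdegree g"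
  for g :: "'k::field fps"
  by (cases "g = 0") (auto simp: fps_dvd_iff)

lemma eval2_curve_eq:
  assumes "local_param d f x0 y0 \<xi> \<eta>"
  shows "eval2 fps_const \<xi> \<eta> (curve_eq d f) = 0"
proof -
  interpret e: ring_morphism "\<lambda>p. poly (map_poly fps_const p) \<xi>"
    by (rule fps_const.eval_morphism)
  show ?thesis
    using assms unfolding curve_eq_def fps_const.eval2_pCons e.hom_uminus
    by (simp add: local_param_def power2_eq_square mult.left_commute mult.commute)
qed

lemma vanishes_imp_dvd:
  assumes "local_param d f x0 y0 \<xi> \<eta>" "vanishes d f x0 y0 n H"
  shows "fps_X ^ n dvd eval2 fps_const \<xi> \<eta> H"
  using assms(2)
proof (induction n arbitrary: H)
  case (Suc n)
  interpret e: ring_morphism "eval2 fps_const \<xi> \<eta>"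
    by (rule fps_const.eval2_morphism)
  obtain G1 G2 Q where G: "vanishes d f x0 y0 n G1" "vanishes d f x0 y0 n G2"
    and H: "H = Q * curve_eq d f + [:[:- x0, 1:]:] * G1 + [:[:- y0:], 1:] * G2"
    using Suc.prems unfolding vanishes_Suc_iff by blast
  have X_dvd: "fps_X dvd g" if "fps_nth g 0 = 0" for g :: "'a fps"
    using that fps_X_power_dvd_iff[of 1 g] subdegree_eq_0_iff[of g] by (cases "g = 0") auto
  have "fps_X dvd \<xi> - fps_const x0" "fps_X dvd \<eta> - fps_const y0"
    using assms(1) by (auto simp: local_param_def intro!: X_dvd)
  moreover have "eval2 fps_const \<xi> \<eta> H = (\<xi> - fps_const x0) * eval2 fps_const \<xi> \<eta> G1
      + (\<eta> - fps_const y0) * eval2 fps_const \<xi> \<eta> G2"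
    unfolding H e.hom_add e.hom_mult eval2_curve_eq[OF assms(1)] by (simp flip: fps_const_neg)
  ultimately show ?case
    using Suc.IH[OF G(1)] Suc.IH[OF G(2)] by (simp add: mult_dvd_mono)
qed auto

text \<open>The pullback of z has order 1, so a leading term c z^n with c nonzero would give the
  pullback of \<open>H\<close> order exactly n. Divisibility by one more power of X forces c =
  0.\<close>

lemma dvd_imp_vanishes:
  fixes d :: "'k::field_char_0"
  assumes d: "d \<noteq> 0" and on_curve: "d * y0 ^ 2 = poly f x0"
    and smooth: "y0 \<noteq> 0 \<or> poly (pderiv f) x0 \<noteq> 0"
    and param: "local_param d f x0 y0 \<xi> \<eta>"
    and "fps_X ^ n dvd eval2 fps_const \<xi> \<eta> H"
  shows "vanishes d f x0 y0 n H"
  using assms(5)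
proof (induction n)
  case (Suc n)
  interpret e: ring_morphism "eval2 fps_const \<xi> \<eta>"
    by (rule fps_const.eval2_morphism)
  define z where "z = (if y0 = 0 then [:[:- y0:], 1:] else [:[:- x0, 1:]:])"
  have "vanishes d f x0 y0 n H"
    using Suc by (meson dvd_trans le_imp_power_dvd le_SucI le_refl)
  then obtain c where c: "vanishes d f x0 y0 (Suc n) (H - [:[:c:]:] * z ^ n)"
    using vanishes_leading_term[OF d on_curve smooth] unfolding z_def by blast
  define w where "w = (if y0 = 0 then \<eta> else \<xi> - fps_const x0)"
  have w: "subdegree w = 1"
    using param by (auto simp: w_def local_param_def)
  have "eval2 fps_const \<xi> \<eta> (H - [:[:c:]:] * z ^ n) = eval2 fps_const \<xi> \<eta> H - fps_const c * w ^ n"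
    unfolding e.hom_diff e.hom_mult e.hom_power by (simp add: z_def w_def flip: fps_const_neg)
  hence "fps_X ^ Suc n dvd eval2 fps_const \<xi> \<eta> H - fps_const c * w ^ n"
    using vanishes_imp_dvd[OF param c] by simp
  hence "fps_X ^ Suc n dvd fps_const c * w ^ n"
    using dvd_diff[OF Suc.prems] by fastforce
  moreover have "w \<noteq> 0"
    using w by auto
  ultimately have "c = 0"
    using w by (cases "c = 0") (simp_all add: fps_X_power_dvd_iff del: power_Suc)
  thus ?case
    using c by simp
qed (simp add: vanishes_0)

lemma vanishes_iff_le_subdegree:
  fixes d :: "'k::field_char_0"
  assumes d: "d \<noteq> 0" and on_curve: "d * y0 ^ 2 = poly f x0"
    and smooth: "y0 \<noteq> 0 \<or> poly (pderiv f) x0 \<noteq> 0"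
    and param: "local_param d f x0 y0 \<xi> \<eta>"
    and nz: "eval2 fps_const \<xi> \<eta> H \<noteq> 0"
  shows "vanishes d f x0 y0 n H \<longleftrightarrow> n \<le> subdegree (eval2 fps_const \<xi> \<eta> H)"
  using dvd_imp_vanishes[OF d on_curve smooth param, of n H] vanishes_imp_dvd[OF param, of n H] nz
  by (auto simp: fps_X_power_dvd_iff)

section \<open>Laurent expansions at the points of the curve\<close>

fun curve_conj :: "'k::field curve_point \<Rightarrow> 'k curve_point" where
  "curve_conj (Affine x y) = Affine x (- y)"
| "curve_conj (Infinite w) = Infinite (- w)"

text \<open>At infinity too the series are those of x and y themselves: with chart coordinates u and
  w these are 1/u and w / u^(g+1), so poles appear and Laurent series are needed.\<close>

fun expansion :: "'k::field \<Rightarrow> 'k poly \<Rightarrow> 'k curve_point \<Rightarrow> 'k fls \<Rightarrow> 'k fls \<Rightarrow> bool" where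
  "expansion d f (Affine x y) \<xi> \<eta> \<longleftrightarrow>
     (\<exists>a b. local_param d f x y a b \<and> \<xi> = fps_to_fls a \<and> \<eta> = fps_to_fls b)"
| "expansion d f (Infinite w) \<xi> \<eta> \<longleftrightarrow>
     (\<exists>a b. local_param d (chart_at_infinity f) 0 w a b \<and> \<xi> = inverse (fps_to_fls a) \<and>
            \<eta> = fps_to_fls b / fps_to_fls a ^ (curve_genus f + 1))"

fun form_vanishes :: "'k::field \<Rightarrow> 'k poly \<Rightarrow> nat \<Rightarrow> nat \<Rightarrow> 'k poly poly \<Rightarrow> 'k curve_point \<Rightarrow> bool" where
  "form_vanishes d f N n H (Affine x y) = vanishes d f x y n H"
| "form_vanishes d f N n H (Infinite w) =
     vanishes d (chart_at_infinity f) 0 w n (change_chart (curve_genus f) N H)"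

fun ramification :: "'k::field curve_point \<Rightarrow> int" where
  "ramification (Affine x y) = (if y = 0 then 2 else 1)"
| "ramification (Infinite w) = (if w = 0 then 2 else 1)"

text \<open>The order of the pole of x. A form of weight N is a section of N times the polar divisor
  of x, and its order as a section is the order of the function plus N times this number.\<close>

fun pole_order :: "'k::field curve_point \<Rightarrow> int" where
  "pole_order (Affine x y) = 0"
| "pole_order (Infinite w) = (if w = 0 then 2 else 1)"

text \<open>The order of a polynomial at the image of the point under the double cover x of the
  projective line.\<close>

fun base_order :: "'k::field curve_point \<Rightarrow> 'k poly \<Rightarrow> int" where
  "base_order (Affine x y) p = int (order x p)"
| "base_order (Infinite w) p = - int (degree p)"

lemma poly_map_fls_eq_sum:
  fixes p :: "'k::field poly"
  assumes "degree p \<le> n"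
  shows "poly (map_poly fls_const p) z = (\<Sum>i\<le>n. fls_const (coeff p i) * z ^ i)"
proof -
  have "degree (map_poly fls_const p) = degree p"
    by (rule degree_map_poly) auto
  hence "poly (map_poly fls_const p) z = (\<Sum>i\<le>n. coeff (map_poly fls_const p) i * z ^ i)"
    unfolding poly_altdef using assms
    by (intro sum.mono_neutral_left) (auto intro: le_degree)
  thus ?thesis
    by simp
qed

lemma degree_le_chart: "degree f \<le> 2 * curve_genus f + 2"
  by (simp add: curve_genus_def)

lemma coeff_chart_at_infinity:
  "j \<le> 2 * curve_genus f + 2 \<Longrightarrow> coeff (chart_at_infinity f) j = coeff f (2 * curve_genus f + 2 - j)"
proof -
  define n where "n = 2 * curve_genus f + 2"
  assume "j \<le> 2 * curve_genus f + 2"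
  hence "j \<le> n" by (simp add: n_def)
  have "coeff (chart_at_infinity f) j = (\<Sum>i\<le>n. if n - i = j then coeff f i else 0)"
    by (simp add: chart_at_infinity_def coeff_sum Let_def n_def)
  also have "\<dots> = (\<Sum>i\<in>{n - j}. coeff f i)"
    using \<open>j \<le> n\<close> by (intro sum.mono_neutral_cong_right) auto
  finally show ?thesis
    by (simp add: n_def)
qed

lemma degree_chart_at_infinity: "degree (chart_at_infinity f) \<le> 2 * curve_genus f + 2"
  unfolding chart_at_infinity_def Let_def
  by (intro degree_sum_le) (auto intro: order.trans[OF degree_monom_le])

lemma poly_chart_at_infinity:
  fixes f :: "'k::field poly"
  assumes "a \<noteq> 0"
  shows "poly (map_poly fls_const (chart_at_infinity f)) a =
    a ^ (2 * curve_genus f + 2) * poly (map_poly fls_const f) (inverse a)"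
proof -
  define n where "n = 2 * curve_genus f + 2"
  have "poly (map_poly fls_const (chart_at_infinity f)) a =
      (\<Sum>j\<le>n. fls_const (coeff f (n - j)) * a ^ j)"
    unfolding poly_map_fls_eq_sum[OF degree_chart_at_infinity]
    by (intro sum.cong) (auto simp: coeff_chart_at_infinity n_def)
  also have "\<dots> = (\<Sum>i\<le>n. fls_const (coeff f i) * a ^ (n - i))"
    by (rule sum.reindex_bij_witness[of _ "\<lambda>i. n - i" "\<lambda>i. n - i"]) auto
  also have "\<dots> = (\<Sum>i\<le>n. a ^ n * (fls_const (coeff f i) * inverse a ^ i))"
    using assms by (intro sum.cong) (auto simp: power_diff field_simps)
  also have "\<dots> = a ^ n * poly (map_poly fls_const f) (inverse a)"
    by (simp only: poly_map_fls_eq_sum[OF degree_le_chart] n_def[symmetric] sum_distrib_left)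
  finally show ?thesis
    by (simp add: n_def)
qed

lemma local_param_uminus: "local_param d f x0 y0 \<xi> \<eta> \<Longrightarrow> local_param d f x0 (- y0) \<xi> (- \<eta>)"
  by (simp add: local_param_def split: if_splits)

lemma expansion_conj: "expansion d f P \<xi> \<eta> \<Longrightarrow> expansion d f (curve_conj P) \<xi> (- \<eta>)"
proof (cases P)
  case (Affine x y)
  assume "expansion d f P \<xi> \<eta>"
  then obtain a b where "local_param d f x y a b" "\<xi> = fps_to_fls a" "\<eta> = fps_to_fls b"
    unfolding Affine by auto
  thus ?thesis
    unfolding Affine by (auto intro!: exI[of _ a] exI[of _ "- b"] local_param_uminus)
next
  case (Infinite w)
  assume "expansion d f P \<xi> \<eta>"
  then obtain a b where "local_param d (chart_at_infinity f) 0 w a b" "\<xi> = inverse (fps_to_fls a)"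
      "\<eta> = fps_to_fls b / fps_to_fls a ^ (curve_genus f + 1)"
    unfolding Infinite by auto
  thus ?thesis
    unfolding Infinite by (auto intro!: exI[of _ a] exI[of _ "- b"] local_param_uminus)
qed

text \<open>At a branch point f = (x - x0) q with q(x0) = f'(x0) nonzero, so x - x0 is d y^2 times a
  unit and has twice the order of y.\<close>

lemma local_param_subdegree_x:
  fixes d :: "'k::field_char_0"
  assumes d: "d \<noteq> 0" and on_curve: "d * y0 ^ 2 = poly f x0"
    and smooth: "y0 \<noteq> 0 \<or> poly (pderiv f) x0 \<noteq> 0"
    and param: "local_param d f x0 y0 \<xi> \<eta>"
  shows "subdegree (\<xi> - fps_const x0) = (if y0 = 0 then 2 else 1)"
proof (cases "y0 = 0")
  case True
  interpret e: ring_morphism "\<lambda>p. poly (map_poly fps_const p) \<xi>"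
    by (rule fps_const.eval_morphism)
  define q where "q = synthetic_div f x0"
  have f: "f = [:- x0, 1:] * q"
    using synthetic_div_correct'[of x0 f] on_curve True by (simp add: q_def)
  have "poly (pderiv f) x0 = poly q x0"
    unfolding f pderiv_mult by (simp add: pderiv_pCons)
  hence q0: "poly q x0 \<noteq> 0"
    using smooth True by simp
  have q_unit: "fps_nth (poly (map_poly fps_const q) \<xi>) 0 \<noteq> 0"
    using q0 param by (simp add: fps_nth_poly_fps_const_0 local_param_def)
  have eq: "fps_const d * \<eta> ^ 2 = (\<xi> - fps_const x0) * poly (map_poly fps_const q) \<xi>"
    using param e.hom_mult[of "[:- x0, 1:]" q, folded f]
    by (simp add: local_param_def flip: fps_const_neg)
  have "subdegree \<eta> = 1"
    using param True by (simp add: local_param_def)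
  moreover from this have "\<eta> \<noteq> 0"
    by auto
  ultimately have "subdegree (fps_const d * \<eta> ^ 2) = 2" "fps_const d * \<eta> ^ 2 \<noteq> 0"
    using d by (simp_all add: subdegree_mult)
  hence "subdegree (\<xi> - fps_const x0) + subdegree (poly (map_poly fps_const q) \<xi>) = 2"
    unfolding eq by (subst (asm) subdegree_mult) auto
  moreover have "subdegree (poly (map_poly fps_const q) \<xi>) = 0"
    using q_unit by simp
  ultimately show ?thesis
    using True by simp
qed (use param in \<open>auto simp: local_param_def\<close>)

text \<open>The weight bound keeps the subtractions of exponents in \<open>change_chart\<close> from
  being truncated, which makes the change of chart an honest substitution times a^N.\<close>

lemma change_chart_eval:
  fixes H :: "'k::field poly poly"
  assumes a: "a \<noteq> 0" and wt: "weight_le g N H"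
  shows "eval2 fls_const a b (change_chart g N H) =
     a ^ N * eval2 fls_const (inverse a) (b / a ^ (g + 1)) H"
proof -
  interpret e: ring_morphism "eval2 fls_const a b"
    by (rule fls_const.eval2_morphism)
  interpret i: ring_morphism "\<lambda>p. poly (map_poly fls_const p) (inverse a)"
    by (rule fls_const.eval_morphism)
  interpret l: ring_morphism "\<lambda>p. poly (map_poly fls_const p) a"
    by (rule fls_const.eval_morphism)
  have mono: "eval2 fls_const a b (monom (monom c k) j) = fls_const c * a ^ k * b ^ j" for c k j
    unfolding eval2_def by (simp add: map_poly_monom poly_monom)
  have "eval2 fls_const (inverse a) (b / a ^ (g + 1)) H =
     (\<Sum>j\<le>degree H. poly (map_poly fls_const (coeff H j)) (inverse a) * (b / a ^ (g + 1)) ^ j)"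
  proof -
    have "degree (map_poly (\<lambda>p. poly (map_poly fls_const p) (inverse a)) H) \<le> degree H"
      by (rule map_poly_degree_leq)
    hence "eval2 fls_const (inverse a) (b / a ^ (g + 1)) H = (\<Sum>j\<le>degree H.
        coeff (map_poly (\<lambda>p. poly (map_poly fls_const p) (inverse a)) H) j * (b / a ^ (g + 1)) ^ j)"
      unfolding eval2_def poly_altdef by (intro sum.mono_neutral_left) (auto simp: coeff_eq_0)
    thus ?thesis
      by simp
  qed
  also have "\<dots> = (\<Sum>j\<le>degree H. \<Sum>i\<le>degree (coeff H j).
      fls_const (coeff (coeff H j) i) * inverse a ^ i * (b / a ^ (g + 1)) ^ j)"
    by (intro sum.cong refl) (simp add: poly_map_fls_eq_sum[OF order.refl] sum_distrib_right)
  finally have "a ^ N * eval2 fls_const (inverse a) (b / a ^ (g + 1)) H =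
      (\<Sum>j\<le>degree H. \<Sum>i\<le>degree (coeff H j).
        a ^ N * (fls_const (coeff (coeff H j) i) * inverse a ^ i * (b / a ^ (g + 1)) ^ j))"
    by (simp add: sum_distrib_left)
  also have "\<dots> = (\<Sum>j\<le>degree H. \<Sum>i\<le>degree (coeff H j).
        fls_const (coeff (coeff H j) i) * a ^ (N - (i + (g + 1) * j)) * b ^ j)"
  proof (intro sum.cong refl)
    fix j i
    show "a ^ N * (fls_const (coeff (coeff H j) i) * inverse a ^ i * (b / a ^ (g + 1)) ^ j) =
      fls_const (coeff (coeff H j) i) * a ^ (N - (i + (g + 1) * j)) * b ^ j"
    proof (cases "coeff (coeff H j) i = 0")
      case False
      hence "i + (g + 1) * j \<le> N"
        using wt unfolding weight_le_def by blast
      then obtain r where N: "N = i + (g + 1) * j + r"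
        using le_Suc_ex by blast
      define c where "c = a ^ (g + 1)"
      have "c \<noteq> 0"
        using a by (simp add: c_def)
      have "a ^ N = a ^ i * c ^ j * a ^ r"
        unfolding N power_add power_mult c_def ..
      moreover have "N - (i + (g + 1) * j) = r"
        by (simp add: N)
      ultimately show ?thesis
        using a \<open>c \<noteq> 0\<close> unfolding c_def[symmetric]
        by (simp add: power_divide power_inverse field_simps)
    qed auto
  qed
  also have "\<dots> = eval2 fls_const a b (change_chart g N H)"
    unfolding change_chart_def e.hom_sum mono ..
  finally show ?thesis ..
qed

section \<open>Valuations\<close>

text \<open>The common setting for the elliptic curve and for the curve of degree m, both over an
  algebraic closure. Absence of multiple roots is smoothness of the affine chart.\<close>

locale hyperelliptic =
  fixes d :: "'k::{alg_closed_field, field_char_0}" and f :: "'k poly"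
  assumes d_nonzero: "d \<noteq> 0" and squarefree: "rsquarefree f" and degree_pos: "degree f > 0"
begin

lemma f_nonzero: "f \<noteq> 0"
  using degree_pos by auto

lemma affine_smooth: "d * y ^ 2 = poly f x \<Longrightarrow> y \<noteq> 0 \<or> poly (pderiv f) x \<noteq> 0"
  using squarefree unfolding rsquarefree_roots by fastforce

lemma degree_cases: "degree f = 2 * curve_genus f + 1 \<or> degree f = 2 * curve_genus f + 2"
  using degree_pos unfolding curve_genus_def by presburger

lemma Infinite_in_points_iff: "Infinite w \<in> curve_points d f \<longleftrightarrow> d * w ^ 2 = coeff f (2 * curve_genus f + 2)"
  by (auto simp: curve_points_def)

lemma Affine_in_points_iff: "Affine x y \<in> curve_points d f \<longleftrightarrow> d * y ^ 2 = poly f x"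
  by (auto simp: curve_points_def)

lemma conj_in_points [simp]: "curve_conj P \<in> curve_points d f \<longleftrightarrow> P \<in> curve_points d f"
  by (cases P) (auto simp: Infinite_in_points_iff Affine_in_points_iff)

lemma Infinite_degree:
  assumes "Infinite w \<in> curve_points d f"
  shows "degree f = (if w = 0 then 2 * curve_genus f + 1 else 2 * curve_genus f + 2)"
proof -
  have "coeff f (2 * curve_genus f + 2) = 0 \<longleftrightarrow> degree f = 2 * curve_genus f + 1"
    using degree_cases
  proof
    assume "degree f = 2 * curve_genus f + 2"
    thus ?thesis
      using f_nonzero by (metis add_left_cancel leading_coeff_0_iff one_eq_numeral_iff semiring_norm(83))
  qed (simp add: coeff_eq_0)
  thus ?thesis
    using assms degree_cases d_nonzero by (auto simp: Infinite_in_points_iff)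
qed

lemma infinite_on_curve:
  "Infinite w \<in> curve_points d f \<Longrightarrow> d * w ^ 2 = poly (chart_at_infinity f) 0"
  by (simp add: Infinite_in_points_iff poly_0_coeff_0 coeff_chart_at_infinity)

text \<open>When w = 0 the degree is odd, and the derivative at 0 of the reversed polynomial is the
  leading coefficient of f.\<close>

lemma infinite_smooth:
  assumes "Infinite w \<in> curve_points d f"
  shows "w \<noteq> 0 \<or> poly (pderiv (chart_at_infinity f)) 0 \<noteq> 0"
proof (cases "w = 0")
  case True
  hence "degree f = 2 * curve_genus f + 1"
    using Infinite_degree[OF assms] by simp
  hence "coeff f (2 * curve_genus f + 1) \<noteq> 0"
    using f_nonzero by (metis leading_coeff_0_iff)
  thus ?thesis
    by (simp add: poly_0_coeff_0 coeff_pderiv coeff_chart_at_infinity)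
qed auto

lemma expansion_exists:
  assumes "P \<in> curve_points d f"
  obtains \<xi> \<eta> where "expansion d f P \<xi> \<eta>"
proof (cases P)
  case (Affine x y)
  hence "d * y ^ 2 = poly f x"
    using assms by (simp add: Affine_in_points_iff)
  then obtain a b where "local_param d f x y a b"
    using local_param_exists[OF d_nonzero] affine_smooth by metis
  thus ?thesis
    using that unfolding Affine by fastforce
next
  case (Infinite w)
  then obtain a b where "local_param d (chart_at_infinity f) 0 w a b"
    using local_param_exists[OF d_nonzero] infinite_smooth infinite_on_curve assms by metis
  thus ?thesis
    using that unfolding Infinite by fastforce
qed

lemma infinite_param_nonzero:
  assumes "Infinite w \<in> curve_points d f" "local_param d (chart_at_infinity f) 0 w a b"
  shows "a \<noteq> 0" "subdegree a = (if w = 0 then 2 else 1)"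
proof -
  show *: "subdegree a = (if w = 0 then 2 else 1)"
    using local_param_subdegree_x[OF d_nonzero infinite_on_curve[OF assms(1)]
      infinite_smooth[OF assms(1)] assms(2)] by simp
  show "a \<noteq> 0"
    using * by (auto split: if_splits)
qed

lemma fps_to_fls_poly:
  "fps_to_fls (poly (map_poly fps_const p) a) = poly (map_poly fls_const p) (fps_to_fls a)"
  for p :: "'k poly"
  by (induction p) (auto simp: fls_plus_const)

lemma expansion_curve:
  assumes "P \<in> curve_points d f" "expansion d f P \<xi> \<eta>"
  shows "fls_const d * \<eta> ^ 2 = poly (map_poly fls_const f) \<xi>"
proof (cases P)
  case (Affine x y)
  then obtain a b where ab: "local_param d f x y a b" "\<xi> = fps_to_fls a" "\<eta> = fps_to_fls b"
    using assms by auto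
  have "fps_to_fls (fps_const d * b ^ 2) = fps_to_fls (poly (map_poly fps_const f) a)"
    using ab by (simp add: local_param_def)
  thus ?thesis
    unfolding fps_to_fls.hom_mult fps_to_fls.hom_power fps_to_fls_poly ab(2,3) by simp
next
  case (Infinite w)
  then obtain a b where ab: "local_param d (chart_at_infinity f) 0 w a b"
    "\<xi> = inverse (fps_to_fls a)" "\<eta> = fps_to_fls b / fps_to_fls a ^ (curve_genus f + 1)"
    using assms by auto
  have a: "fps_to_fls a \<noteq> 0"
    using infinite_param_nonzero ab(1) assms(1) Infinite by auto
  have "fps_to_fls (fps_const d * b ^ 2) = fps_to_fls (poly (map_poly fps_const (chart_at_infinity f)) a)"
    using ab by (simp add: local_param_def)
  moreover define c where "c = fps_to_fls a ^ (2 * curve_genus f + 2)"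
  ultimately have "fls_const d * fps_to_fls b ^ 2 = c * poly (map_poly fls_const f) \<xi>"
    unfolding fps_to_fls.hom_mult fps_to_fls.hom_power fps_to_fls_poly poly_chart_at_infinity[OF a] ab(2)
    by simp
  moreover have "\<eta> ^ 2 = fps_to_fls b ^ 2 / c"
    unfolding c_def
    by (simp add: ab(3) power_divide power2_eq_square power_add mult_2 algebra_simps)
       (simp add: power_mult power2_eq_square)
  moreover have "c \<noteq> 0"
    using a by (simp add: c_def)
  ultimately show ?thesis
    by simp
qed

text \<open>At an affine point the power of x - x0 is split off, and the cofactor is a unit. At
  infinity p(1/u) is the reversed polynomial in u divided by u^(deg p), and the reversed polynomial
  has a nonzero constant term.\<close>

lemma fls_subdegree_expansion_poly:
  assumes P: "P \<in> curve_points d f" "expansion d f P \<xi> \<eta>" and p: "p \<noteq> 0"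
  shows "poly (map_poly fls_const p) \<xi> \<noteq> 0"
    and "fls_subdegree (poly (map_poly fls_const p) \<xi>) = ramification P * base_order P p"
proof -
  have "poly (map_poly fls_const p) \<xi> \<noteq> 0 \<and>
    fls_subdegree (poly (map_poly fls_const p) \<xi>) = ramification P * base_order P p"
  proof (cases P)
    case (Affine x y)
    then obtain a b where ab: "local_param d f x y a b" "\<xi> = fps_to_fls a" "\<eta> = fps_to_fls b"
      using assms by auto
    have on_curve: "d * y ^ 2 = poly f x"
      using P(1) by (simp add: Affine Affine_in_points_iff)
    interpret e: ring_morphism "\<lambda>p. poly (map_poly fps_const p) a"
      by (rule fps_const.eval_morphism)
    obtain q where q: "p = [:- x, 1:] ^ order x p * q" "poly q x \<noteq> 0"
      using order_decomp[OF p, of x] by (metis poly_eq_0_iff_dvd)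
    have a: "subdegree (a - fps_const x) = (if y = 0 then 2 else 1)"
      by (rule local_param_subdegree_x[OF d_nonzero on_curve affine_smooth[OF on_curve] ab(1)])
    have q0: "fps_nth (poly (map_poly fps_const q) a) 0 \<noteq> 0"
      using q(2) ab(1) by (simp add: fps_nth_poly_fps_const_0 local_param_def)
    have eq: "poly (map_poly fps_const p) a = (a - fps_const x) ^ order x p * poly (map_poly fps_const q) a"
      by (subst q(1), simp only: e.hom_mult e.hom_power) (simp flip: fps_const_neg)
    have "a - fps_const x \<noteq> 0"
      using a by (metis subdegree_0 zero_neq_numeral zero_neq_one)
    moreover have "poly (map_poly fps_const q) a \<noteq> 0"
      using q0 by auto
    ultimately have "poly (map_poly fps_const p) a \<noteq> 0"
      "subdegree (poly (map_poly fps_const p) a) = order x p * (if y = 0 then 2 else 1)"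
      unfolding eq using a q0 by auto
    thus ?thesis
      unfolding Affine ab(2) fps_to_fls_poly[symmetric] by (auto simp: fls_subdegree_fls_to_fps)
  next
    case (Infinite w)
    then obtain a b where ab: "local_param d (chart_at_infinity f) 0 w a b"
      "\<xi> = inverse (fps_to_fls a)" "\<eta> = fps_to_fls b / fps_to_fls a ^ (curve_genus f + 1)"
      using assms by auto
    note a = infinite_param_nonzero[OF P(1)[unfolded Infinite] ab(1)]
    have A: "fps_to_fls a \<noteq> 0"
      using a by auto
    have r: "map_poly fls_const (reflect_poly p) = reflect_poly (map_poly fls_const p)"
      using p by (intro poly_eqI) (simp add: coeff_reflect_poly degree_map_poly)
    have "poly (map_poly fls_const (reflect_poly p)) (fps_to_fls a) =
        fps_to_fls a ^ degree p * poly (map_poly fls_const p) \<xi>"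
      unfolding r using A by (simp add: poly_reflect_poly_nz ab(2) degree_map_poly)
    hence eq: "poly (map_poly fls_const p) \<xi> = fps_to_fls (poly (map_poly fps_const (reflect_poly p)) a)
         / fps_to_fls a ^ degree p"
      using A by (simp add: fps_to_fls_poly field_simps)
    have "fps_nth (poly (map_poly fps_const (reflect_poly p)) a) 0 \<noteq> 0"
      using ab(1) p by (simp add: fps_nth_poly_fps_const_0 local_param_def poly_0_coeff_0)
    hence "poly (map_poly fps_const (reflect_poly p)) a \<noteq> 0"
      "subdegree (poly (map_poly fps_const (reflect_poly p)) a) = 0"
      by auto
    thus ?thesis
      unfolding eq Infinite using A a
      by (auto simp: fls_subdegree_fls_to_fps fls_divide_subdegree fls_subdegree_pow)
  qed
  thus "poly (map_poly fls_const p) \<xi> \<noteq> 0"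
    and "fls_subdegree (poly (map_poly fls_const p) \<xi>) = ramification P * base_order P p"
    by auto
qed

text \<open>Parity at a root of f: the order of the left side is even, that of the right side odd
  unless both vanish. So f / d is not a square of a rational function, which is the irreducibility
  of the curve.\<close>

lemma norm_eq_0:
  assumes "smult d (A ^ 2) = B ^ 2 * f"
  shows "A = 0 \<and> B = 0"
proof (cases "B = 0")
  case True
  thus ?thesis
    using assms d_nonzero by auto
next
  case False
  obtain r where r: "poly f r = 0"
    using alg_closed_imp_poly_has_root[OF degree_pos] by blast
  have "order r f = 1"
    using rsquarefree_root_order[OF squarefree r f_nonzero] .
  moreover have "A \<noteq> 0"
    using False assms f_nonzero d_nonzero by auto
  moreover have "order r (smult d (A ^ 2)) = order r (B ^ 2 * f)"
    using assms by simp
  ultimately have "2 * order r A = 2 * order r B + 1"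
    using False f_nonzero d_nonzero
    by (simp add: order_smult order_mult order_power_n_n power2_eq_square)
  thus ?thesis
    by presburger
qed

lemma reduce_mod_curve: "\<exists>Q A B. H = Q * curve_eq d f + [:A, B:]"
proof (induction H)
  case 0
  show ?case
    by (rule exI[of _ 0], rule exI[of _ 0], rule exI[of _ 0]) simp
next
  case (pCons p H)
  then obtain Q A B where H: "H = Q * curve_eq d f + [:A, B:]"
    by blast
  have "pCons p H = pCons 0 H + [:p:]"
    by simp
  also have "pCons 0 H = pCons 0 (Q * curve_eq d f) + [:0, A, B:]"
    by (simp add: H)
  also have "pCons 0 (Q * curve_eq d f) = pCons 0 Q * curve_eq d f"
    by simp
  also have "[:0, A, B:] = [:smult (1 / d) B:] * curve_eq d f + [:smult (1 / d) (B * f), A:]"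
    using d_nonzero by (simp add: curve_eq_def mult.commute)
  finally have "pCons p H = (pCons 0 Q + [:smult (1 / d) B:]) * curve_eq d f
      + [:smult (1 / d) (B * f) + p, A:]"
    by (simp add: distrib_right)
  thus ?case
    by blast
qed

lemma linear_dvd_iff: "curve_eq d f dvd [:A, B:] \<longleftrightarrow> A = 0 \<and> B = 0"
proof
  assume "curve_eq d f dvd [:A, B:]"
  hence "[:A, B:] = 0"
  proof (rule contrapos_pp)
    assume nz: "[:A, B:] \<noteq> 0"
    have "degree [:A, B:] < degree (curve_eq d f)"
      using d_nonzero by (simp add: curve_eq_def)
    with dvd_imp_degree_le[OF _ nz] show "\<not> curve_eq d f dvd [:A, B:]"
      by (metis not_le)
  qed
  thus "A = 0 \<and> B = 0"
    by simp
qed simp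

lemma expansion_curve_eq:
  assumes "P \<in> curve_points d f" "expansion d f P \<xi> \<eta>"
  shows "eval2 fls_const \<xi> \<eta> (curve_eq d f) = 0"
proof -
  interpret e: ring_morphism "\<lambda>p. poly (map_poly fls_const p) \<xi>"
    by (rule fls_const.eval_morphism)
  show ?thesis
    using expansion_curve[OF assms] unfolding curve_eq_def fls_const.eval2_pCons e.hom_uminus
    by (simp add: power2_eq_square mult.left_commute mult.commute)
qed

text \<open>If A + B y vanishes along one branch, then so does its norm d A^2 - B^2 f. This is a
  polynomial in x, and x is not constant on a branch. Thus expansion at a single point already
  embeds the coordinate ring.\<close>

lemma eval2_linear_eq_0_iff:
  assumes "P \<in> curve_points d f" "expansion d f P \<xi> \<eta>"
  shows "eval2 fls_const \<xi> \<eta> [:A, B:] = 0 \<longleftrightarrow> A = 0 \<and> B = 0"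
proof
  interpret e: ring_morphism "\<lambda>p. poly (map_poly fls_const p) \<xi>"
    by (rule fls_const.eval_morphism)
  define a b where "a = poly (map_poly fls_const A) \<xi>" and "b = poly (map_poly fls_const B) \<xi>"
  assume "eval2 fls_const \<xi> \<eta> [:A, B:] = 0"
  hence "a = - \<eta> * b"
    by (simp add: a_def b_def eq_neg_iff_add_eq_0)
  hence "fls_const d * a ^ 2 = b ^ 2 * (fls_const d * \<eta> ^ 2)"
    by (simp add: power2_eq_square)
  also have "fls_const d * \<eta> ^ 2 = poly (map_poly fls_const f) \<xi>"
    by (rule expansion_curve[OF assms])
  finally have "poly (map_poly fls_const ([:d:] * A ^ 2 - B ^ 2 * f)) \<xi> = 0"
    unfolding e.hom_diff e.hom_mult e.hom_power a_def b_def by simp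
  hence "[:d:] * A ^ 2 - B ^ 2 * f = 0"
    using fls_subdegree_expansion_poly(1)[OF assms] by blast
  thus "A = 0 \<and> B = 0"
    by (intro norm_eq_0) simp
qed simp

lemma eval2_eq_0_iff:
  assumes "P \<in> curve_points d f" "expansion d f P \<xi> \<eta>"
  shows "eval2 fls_const \<xi> \<eta> H = 0 \<longleftrightarrow> curve_eq d f dvd H"
proof -
  interpret e: ring_morphism "eval2 fls_const \<xi> \<eta>"
    by (rule fls_const.eval2_morphism)
  obtain Q A B where H: "H = Q * curve_eq d f + [:A, B:]"
    using reduce_mod_curve by blast
  have "curve_eq d f dvd H \<longleftrightarrow> curve_eq d f dvd [:A, B:]"
    unfolding H by (rule dvd_add_times_triv_left_iff)
  moreover have "eval2 fls_const \<xi> \<eta> H = eval2 fls_const \<xi> \<eta> [:A, B:]"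
    unfolding H e.hom_add e.hom_mult expansion_curve_eq[OF assms] by simp
  ultimately show ?thesis
    by (simp only: linear_dvd_iff eval2_linear_eq_0_iff[OF assms])
qed

lemma form_vanishes_expansion:
  assumes P: "P \<in> curve_points d f" "expansion d f P \<xi> \<eta>"
    and wt: "weight_le (curve_genus f) N H" and H: "\<not> curve_eq d f dvd H"
  shows "form_vanishes d f N n H P \<longleftrightarrow>
    int n \<le> fls_subdegree (eval2 fls_const \<xi> \<eta> H) + int N * pole_order P"
proof -
  have nz: "eval2 fls_const \<xi> \<eta> H \<noteq> 0"
    using eval2_eq_0_iff[OF P] H by simp
  show ?thesis
  proof (cases P)
    case (Affine x y)
    then obtain a b where ab: "local_param d f x y a b" "\<xi> = fps_to_fls a" "\<eta> = fps_to_fls b"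
      using P by auto
    have on_curve: "d * y ^ 2 = poly f x"
      using P(1) by (simp add: Affine Affine_in_points_iff)
    have "eval2 fps_const a b H \<noteq> 0"
      using nz unfolding ab(2,3) fps_to_fls_eval2[symmetric] by simp
    from vanishes_iff_le_subdegree[OF d_nonzero on_curve affine_smooth[OF on_curve] ab(1) this]
    show ?thesis
      unfolding Affine ab(2,3) fps_to_fls_eval2[symmetric] by (simp add: fls_subdegree_fls_to_fps)
  next
    case (Infinite w)
    then obtain a b where ab: "local_param d (chart_at_infinity f) 0 w a b"
      "\<xi> = inverse (fps_to_fls a)" "\<eta> = fps_to_fls b / fps_to_fls a ^ (curve_genus f + 1)"
      using P by auto
    note P' = P(1)[unfolded Infinite]
    have a: "fps_to_fls a \<noteq> 0" "subdegree a = (if w = 0 then 2 else 1)"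
      using infinite_param_nonzero[OF P' ab(1)] by auto
    define c where "c = eval2 fps_const a b (change_chart (curve_genus f) N H)"
    have eq: "fps_to_fls c = fps_to_fls a ^ N * eval2 fls_const \<xi> \<eta> H"
      unfolding c_def fps_to_fls_eval2 change_chart_eval[OF a(1) wt] ab(2,3) ..
    hence "c \<noteq> 0"
      using a nz by auto
    have "int (subdegree c) = fls_subdegree (fps_to_fls c)"
      by (simp add: fls_subdegree_fls_to_fps)
    also have "\<dots> = fls_subdegree (eval2 fls_const \<xi> \<eta> H) + int N * pole_order P"
      unfolding eq Infinite using a nz by (simp add: fls_subdegree_pow fls_subdegree_fls_to_fps)
    finally have order: "fls_subdegree (eval2 fls_const \<xi> \<eta> H) + int N * pole_order P = int (subdegree c)" ..
    show ?thesis
      unfolding order using \<open>c \<noteq> 0\<close>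
        vanishes_iff_le_subdegree[OF d_nonzero infinite_on_curve[OF P'] infinite_smooth[OF P'] ab(1)]
      by (simp add: Infinite c_def)
  qed
qed

text \<open>The exponents for which the form vanishes are exactly those up to the Laurent order.
  They form a finite nonempty initial segment, so \<open>GREATEST\<close> attains a true
  maximum.\<close>

lemma form_ord_expansion:
  assumes P: "P \<in> curve_points d f" "expansion d f P \<xi> \<eta>"
    and wt: "weight_le (curve_genus f) N H" and H: "\<not> curve_eq d f dvd H"
  shows "int (form_ord d f N H P) = fls_subdegree (eval2 fls_const \<xi> \<eta> H) + int N * pole_order P"
proof -
  define v where "v = fls_subdegree (eval2 fls_const \<xi> \<eta> H) + int N * pole_order P"
  have iff: "form_vanishes d f N n H P \<longleftrightarrow> int n \<le> v" for n
    unfolding v_def by (rule form_vanishes_expansion[OF assms])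
  have "form_vanishes d f N 0 H P"
    by (cases P) (simp_all add: vanishes_0)
  hence "v \<ge> 0"
    using iff[of 0] by simp
  moreover have "form_ord d f N H P = (GREATEST n. form_vanishes d f N n H P)"
    by (cases P) (simp_all add: affine_ord_vanishes)
  moreover have "(GREATEST n. int n \<le> v) = nat v"
    using \<open>v \<ge> 0\<close> by (intro Greatest_equality) auto
  ultimately show ?thesis
    by (simp add: iff v_def)
qed

definition val :: "'k curve_point \<Rightarrow> 'k poly poly \<Rightarrow> int" where
  "val P H = (let (\<xi>, \<eta>) = SOME (\<xi>, \<eta>). expansion d f P \<xi> \<eta> in fls_subdegree (eval2 fls_const \<xi> \<eta> H))"

lemma weight_le_mono: "weight_le g N H \<Longrightarrow> N \<le> N' \<Longrightarrow> weight_le g N' H"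
  unfolding weight_le_def by (meson order.trans)

lemma weight_le_exists:
  fixes H :: "'k poly poly"
  shows "\<exists>N. weight_le g N H"
proof (induction H)
  case (pCons p H)
  then obtain N where N: "weight_le g N H"
    by blast
  have "weight_le g (degree p + (g + 1) + N) (pCons p H)"
    unfolding weight_le_def
  proof (intro allI impI)
    fix i j
    assume "coeff (coeff (pCons p H) j) i \<noteq> 0"
    thus "i + (g + 1) * j \<le> degree p + (g + 1) + N"
      using N le_degree[of p i] unfolding weight_le_def
      by (cases j) (fastforce simp: algebra_simps)+
  qed
  thus ?case
    by blast
qed (auto simp: weight_le_def)

text \<open>The order of a form is defined without any parametrization. Comparing two expansions
  with it shows that the one picked by \<open>SOME\<close> in \<open>val\<close> does not
  matter.\<close>

lemma val_expansion:
  assumes P: "P \<in> curve_points d f" "expansion d f P \<xi> \<eta>" and H: "\<not> curve_eq d f dvd H"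
  shows "val P H = fls_subdegree (eval2 fls_const \<xi> \<eta> H)"
proof -
  obtain \<xi>' \<eta>' where e: "(SOME (\<xi>, \<eta>). expansion d f P \<xi> \<eta>) = (\<xi>', \<eta>')"
    by fastforce
  have "case (SOME (\<xi>, \<eta>). expansion d f P \<xi> \<eta>) of (\<xi>, \<eta>) \<Rightarrow> expansion d f P \<xi> \<eta>"
    by (rule someI_ex) (use P(2) in auto)
  hence P': "expansion d f P \<xi>' \<eta>'"
    by (simp add: e)
  obtain N where N: "weight_le (curve_genus f) N H"
    using weight_le_exists by blast
  show ?thesis
    using form_ord_expansion[OF P N H] form_ord_expansion[OF P(1) P' N H] by (simp add: val_def e)
qed

lemma form_ord_val:
  assumes "P \<in> curve_points d f" "weight_le (curve_genus f) N H" "\<not> curve_eq d f dvd H"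
  shows "int (form_ord d f N H P) = val P H + int N * pole_order P"
proof -
  obtain \<xi> \<eta> where "expansion d f P \<xi> \<eta>"
    using expansion_exists[OF assms(1)] .
  thus ?thesis
    using form_ord_expansion val_expansion assms by metis
qed

lemma form_vanishes_iff:
  assumes "P \<in> curve_points d f" "weight_le (curve_genus f) N H" "\<not> curve_eq d f dvd H"
  shows "form_vanishes d f N n H P \<longleftrightarrow> int n \<le> val P H + int N * pole_order P"
proof -
  obtain \<xi> \<eta> where "expansion d f P \<xi> \<eta>"
    using expansion_exists[OF assms(1)] .
  thus ?thesis
    using form_vanishes_expansion val_expansion assms by metis
qed

lemma curve_eq_not_dvd_mult:
  assumes "P \<in> curve_points d f" "\<not> curve_eq d f dvd G" "\<not> curve_eq d f dvd H"
  shows "\<not> curve_eq d f dvd G * H" and "val P (G * H) = val P G + val P H"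
proof -
  obtain \<xi> \<eta> where e: "expansion d f P \<xi> \<eta>"
    using expansion_exists[OF assms(1)] .
  interpret ev: ring_morphism "eval2 fls_const \<xi> \<eta>"
    by (rule fls_const.eval2_morphism)
  note z = eval2_eq_0_iff[OF assms(1) e]
  have GH: "eval2 fls_const \<xi> \<eta> G \<noteq> 0" "eval2 fls_const \<xi> \<eta> H \<noteq> 0"
    using assms z by auto
  thus *: "\<not> curve_eq d f dvd G * H"
    unfolding z[symmetric] by simp
  show "val P (G * H) = val P G + val P H"
    using GH assms * by (simp add: val_expansion[OF assms(1) e])
qed

lemma curve_points_nonempty: "\<exists>x y. Affine x y \<in> curve_points d f"
proof -
  obtain r where "poly f r = 0"
    using alg_closed_imp_poly_has_root[OF degree_pos] by blast
  thus ?thesis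
    by (intro exI[of _ r] exI[of _ 0]) (simp add: Affine_in_points_iff)
qed

lemma not_dvd_mult: "\<not> curve_eq d f dvd G \<Longrightarrow> \<not> curve_eq d f dvd H \<Longrightarrow> \<not> curve_eq d f dvd G * H"
  using curve_points_nonempty curve_eq_not_dvd_mult(1) by blast

lemmas val_mult = curve_eq_not_dvd_mult(2)

lemma val_cong:
  assumes "P \<in> curve_points d f" "\<not> curve_eq d f dvd H"
  shows "val P (Q * curve_eq d f + H) = val P H"
proof -
  obtain \<xi> \<eta> where e: "expansion d f P \<xi> \<eta>"
    using expansion_exists[OF assms(1)] .
  interpret ev: ring_morphism "eval2 fls_const \<xi> \<eta>"
    by (rule fls_const.eval2_morphism)
  have n: "\<not> curve_eq d f dvd Q * curve_eq d f + H"
    using assms(2) by (simp add: dvd_add_times_triv_left_iff)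
  show ?thesis
    unfolding val_expansion[OF assms(1) e assms(2)] val_expansion[OF assms(1) e n]
      ev.hom_add ev.hom_mult expansion_curve_eq[OF assms(1) e] by simp
qed

lemma const_dvd_iff [simp]: "curve_eq d f dvd [:p:] \<longleftrightarrow> p = 0"
  using linear_dvd_iff[of p 0] by simp

lemma val_poly:
  assumes "P \<in> curve_points d f" "p \<noteq> 0"
  shows "val P [:p:] = ramification P * base_order P p"
proof -
  obtain \<xi> \<eta> where e: "expansion d f P \<xi> \<eta>"
    using expansion_exists[OF assms(1)] .
  have "\<not> curve_eq d f dvd [:p:]"
    using assms(2) by simp
  from val_expansion[OF assms(1) e this] show ?thesis
    using fls_subdegree_expansion_poly(2)[OF assms(1) e assms(2)] by simp
qed

lemma val_y:
  assumes "P \<in> curve_points d f"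
  shows "2 * val P [:0, 1:] = ramification P * base_order P f"
proof -
  obtain \<xi> \<eta> where e: "expansion d f P \<xi> \<eta>"
    using expansion_exists[OF assms(1)] .
  have y: "\<not> curve_eq d f dvd [:0, 1:]"
    by (simp only: linear_dvd_iff) simp
  have "\<eta> \<noteq> 0"
    using eval2_eq_0_iff[OF assms(1) e, of "[:0, 1:]"] y by simp
  hence "2 * fls_subdegree \<eta> = fls_subdegree (fls_const d * \<eta> ^ 2)"
    using d_nonzero by (simp add: fls_subdegree_pow)
  also have "\<dots> = ramification P * base_order P f"
    unfolding expansion_curve[OF assms(1) e]
    by (rule fls_subdegree_expansion_poly(2)[OF assms(1) e f_nonzero])
  also have "fls_subdegree \<eta> = val P [:0, 1:]"
    using val_expansion[OF assms(1) e y] by simp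
  finally show ?thesis .
qed

lemma val_conj:
  assumes "P \<in> curve_points d f"
  shows "val (curve_conj P) [:A, B:] = val P [:A, - B:]"
proof (cases "A = 0 \<and> B = 0")
  case False
  obtain \<xi> \<eta> where e: "expansion d f P \<xi> \<eta>"
    using expansion_exists[OF assms(1)] .
  interpret ev: ring_morphism "\<lambda>p. poly (map_poly fls_const p) \<xi>"
    by (rule fls_const.eval_morphism)
  have n: "\<not> curve_eq d f dvd [:A, B:]" "\<not> curve_eq d f dvd [:A, - B:]"
    using False by (simp_all only: linear_dvd_iff) auto
  have P': "curve_conj P \<in> curve_points d f"
    using assms by simp
  show ?thesis
    unfolding val_expansion[OF P' expansion_conj[OF e] n(1)] val_expansion[OF assms e n(2)]
    by (simp add: ev.hom_uminus)
next
  case True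
  have "[:A, B:] = 0" "[:A, - B:] = 0"
    using True by auto
  thus ?thesis
    by (simp only: val_def eval2_0 split: prod.split) simp
qed

lemma val_add_ge:
  assumes "P \<in> curve_points d f" "\<not> curve_eq d f dvd G" "\<not> curve_eq d f dvd H"
    "\<not> curve_eq d f dvd G + H" "val P G \<ge> n" "val P H \<ge> n"
  shows "val P (G + H) \<ge> n"
proof -
  obtain \<xi> \<eta> where e: "expansion d f P \<xi> \<eta>"
    using expansion_exists[OF assms(1)] .
  interpret ev: ring_morphism "eval2 fls_const \<xi> \<eta>"
    by (rule fls_const.eval2_morphism)
  note v = val_expansion[OF assms(1) e]
  have "eval2 fls_const \<xi> \<eta> G + eval2 fls_const \<xi> \<eta> H \<noteq> 0"
    using eval2_eq_0_iff[OF assms(1) e, of "G + H"] assms(4) by simp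
  from fls_plus_subdegree[OF this] show ?thesis
    using assms(5,6) unfolding v[OF assms(2)] v[OF assms(3)] v[OF assms(4)] by simp
qed

section \<open>Principal divisors\<close>

text \<open>Any two forms have a common weight bound N, and the contributions N
  \<open>pole_order\<close> of numerator and denominator cancel.\<close>

lemma principal_divisors_iff:
  "A \<in> principal_divisors d f \<longleftrightarrow> A \<in> carrier (divisor_group d f) \<and>
     (\<exists>G H. \<not> curve_eq d f dvd G \<and> \<not> curve_eq d f dvd H \<and>
       (\<forall>P\<in>curve_points d f. Poly_Mapping.lookup A P = val P G - val P H))"
  (is "?lhs \<longleftrightarrow> ?rhs")
proof
  assume ?lhs
  then obtain N G H where "A \<in> carrier (divisor_group d f)"
     "weight_le (curve_genus f) N G" "\<not> curve_eq d f dvd G"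
     "weight_le (curve_genus f) N H" "\<not> curve_eq d f dvd H"
     "\<forall>P\<in>curve_points d f. Poly_Mapping.lookup A P =
        int (form_ord d f N G P) - int (form_ord d f N H P)"
    unfolding principal_divisors_def by blast
  thus ?rhs
    by (intro conjI exI[of _ G] exI[of _ H]) (auto simp: form_ord_val)
next
  assume ?rhs
  then obtain G H where A: "A \<in> carrier (divisor_group d f)"
    and GH: "\<not> curve_eq d f dvd G" "\<not> curve_eq d f dvd H"
       "\<forall>P\<in>curve_points d f. Poly_Mapping.lookup A P = val P G - val P H"
    by blast
  obtain N1 N2 where "weight_le (curve_genus f) N1 G" "weight_le (curve_genus f) N2 H"
    using weight_le_exists by blast
  hence "weight_le (curve_genus f) (max N1 N2) G" "weight_le (curve_genus f) (max N1 N2) H"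
    by (auto intro: weight_le_mono)
  thus ?lhs
    unfolding principal_divisors_def using A GH
    by (intro CollectI conjI exI[of _ "max N1 N2"] exI[of _ G] exI[of _ H])
       (auto simp: form_ord_val)
qed

lemma principal_divisors_subgroup: "subgroup (principal_divisors d f) (divisor_group d f)"
proof
  show "principal_divisors d f \<subseteq> carrier (divisor_group d f)"
    by (auto simp: principal_divisors_def)
  have one: "\<not> curve_eq d f dvd 1"
    using const_dvd_iff[of 1] by (simp add: one_pCons)
  show "\<one>\<^bsub>divisor_group d f\<^esub> \<in> principal_divisors d f"
    unfolding principal_divisors_iff by (auto simp: divisor_group_def intro!: exI[of _ 1] one)
  fix A B
  assume "A \<in> principal_divisors d f" "B \<in> principal_divisors d f"
  then obtain G H G' H' where GH: "\<not> curve_eq d f dvd G" "\<not> curve_eq d f dvd H"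
      "\<forall>P\<in>curve_points d f. Poly_Mapping.lookup A P = val P G - val P H"
    and GH': "\<not> curve_eq d f dvd G'" "\<not> curve_eq d f dvd H'"
      "\<forall>P\<in>curve_points d f. Poly_Mapping.lookup B P = val P G' - val P H'"
    and AB: "A \<in> carrier (divisor_group d f)" "B \<in> carrier (divisor_group d f)"
    unfolding principal_divisors_iff by blast
  have "A \<otimes>\<^bsub>divisor_group d f\<^esub> B \<in> carrier (divisor_group d f)"
    using AB unfolding divisor_group_def
    by (meson group.is_monoid group_free_Abelian_group monoid.m_closed)
  thus "A \<otimes>\<^bsub>divisor_group d f\<^esub> B \<in> principal_divisors d f"
    unfolding principal_divisors_iff using GH GH'
    by (intro conjI exI[of _ "G * G'"] exI[of _ "H * H'"])
       (auto simp: not_dvd_mult val_mult lookup_add divisor_group_def)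
next
  fix A
  assume "A \<in> principal_divisors d f"
  then obtain G H where GH: "\<not> curve_eq d f dvd G" "\<not> curve_eq d f dvd H"
      "\<forall>P\<in>curve_points d f. Poly_Mapping.lookup A P = val P G - val P H"
    and A: "A \<in> carrier (divisor_group d f)"
    unfolding principal_divisors_iff by blast
  have "inv\<^bsub>divisor_group d f\<^esub> A = - A" "- A \<in> carrier (divisor_group d f)"
    using A by (auto simp: divisor_group_def)
  thus "inv\<^bsub>divisor_group d f\<^esub> A \<in> principal_divisors d f"
    unfolding principal_divisors_iff using GH
    by (intro conjI exI[of _ H] exI[of _ G]) auto
qed

end

section \<open>From principal divisors to polynomial forms\<close>

lemma poly_dvd_of_order_le:
  fixes p q :: "'k::alg_closed_field poly"
  assumes "p \<noteq> 0" "q \<noteq> 0" "\<And>c. order c p \<le> order c q"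
  shows "p dvd q"
  using assms
proof (induction "degree p" arbitrary: p q)
  case 0
  thus ?case
    by (metis is_unit_iff_degree unit_imp_dvd)
next
  case (Suc n)
  then obtain c where c: "poly p c = 0"
    using alg_closed_imp_poly_has_root[of p] by auto
  have "order c p \<noteq> 0"
    using c Suc.prems(1) by (simp add: order_root)
  hence "poly q c = 0"
    using Suc.prems(2) Suc.prems(3)[of c] by (auto simp: order_root)
  obtain p' where p': "p = [:- c, 1:] * p'"
    using c unfolding poly_eq_0_iff_dvd by (elim dvdE)
  obtain q' where q': "q = [:- c, 1:] * q'"
    using \<open>poly q c = 0\<close> unfolding poly_eq_0_iff_dvd by (elim dvdE)
  have nz: "p' \<noteq> 0" "q' \<noteq> 0"
    using p' q' Suc.prems by auto
  have "n = degree p'"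
    using Suc.hyps(2) nz(1) unfolding p' by (subst (asm) degree_mult_eq) auto
  moreover have "order e p' \<le> order e q'" for e
    using Suc.prems(3)[of e] Suc.prems(1,2) unfolding p' q' by (simp add: order_mult del: mult_pCons_left)
  ultimately have "p' dvd q'"
    using Suc.hyps(1) nz by blast
  thus ?case
    unfolding p' q' by (rule mult_dvd_mono[OF dvd_refl])
qed

lemma square_root_exists:
  fixes c :: "'k::alg_closed_field"
  obtains y where "y ^ 2 = c"
proof -
  obtain y where "poly [:- c, 0, 1:] y = 0"
    using alg_closed_imp_poly_has_root[of "[:- c, 0, 1:]"] by auto
  hence "y ^ 2 = c"
    by (simp add: power2_eq_square algebra_simps)
  thus ?thesis
    by (rule that)
qed

lemma curve_conj_conj [simp]: "curve_conj (curve_conj P) = P"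
  by (cases P) auto

lemma pole_order_conj [simp]: "pole_order (curve_conj P) = pole_order P"
  by (cases P) auto

lemma curve_conj_eq_iff: "curve_conj P = Q \<longleftrightarrow> P = curve_conj Q"
  by (metis curve_conj_conj)

text \<open>As a form of weight 1 it has divisor P plus the conjugate of P. For P at infinity the
  constant 1 does this, since a form of weight 1 gains \<open>pole_order\<close> there.\<close>

fun base_poly :: "'k::field curve_point \<Rightarrow> 'k poly" where
  "base_poly (Affine x y) = [:- x, 1:]"
| "base_poly (Infinite w) = 1"

lemma base_poly_nonzero [simp]: "base_poly P \<noteq> 0"
  by (cases P) auto

context hyperelliptic
begin

lemma affine_point_exists: "\<exists>y. Affine x y \<in> curve_points d f"
proof -
  obtain y where "y ^ 2 = poly f x / d"
    by (rule square_root_exists)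
  thus ?thesis
    using d_nonzero by (intro exI[of _ y]) (simp add: Affine_in_points_iff)
qed

lemma infinite_point_exists: "\<exists>w. Infinite w \<in> curve_points d f"
proof -
  obtain y where "y ^ 2 = coeff f (2 * curve_genus f + 2) / d"
    by (rule square_root_exists)
  thus ?thesis
    using d_nonzero by (intro exI[of _ y]) (simp add: Infinite_in_points_iff)
qed

lemma ramification_pos: "ramification P > 0"
  by (cases P) auto

lemma base_order_smult: "c \<noteq> 0 \<Longrightarrow> base_order P (smult c p) = base_order P p"
  by (cases P) (auto simp: order_smult)

lemma val_conj_poly: "P \<in> curve_points d f \<Longrightarrow> val (curve_conj P) [:p:] = val P [:p:]"
  using val_conj[of P p 0] by simp

lemma val_poly_mult:
  "P \<in> curve_points d f \<Longrightarrow> p \<noteq> 0 \<Longrightarrow> q \<noteq> 0 \<Longrightarrow> val P [:p * q:] = val P [:p:] + val P [:q:]"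
  using val_mult[of P "[:p:]" "[:q:]"] by (simp add: mult.commute)

lemma val_poly_power:
  "P \<in> curve_points d f \<Longrightarrow> p \<noteq> 0 \<Longrightarrow> val P [:p ^ n:] = int n * val P [:p:]"
proof (induction n)
  case 0
  thus ?case
    by (cases P) (simp_all add: val_poly)
next
  case (Suc n)
  thus ?case
    by (simp add: val_poly_mult algebra_simps)
qed

lemma smult_2: "smult 2 p = p + p" for p :: "'k poly"
  by (metis one_add_one smult_1_left smult_add_left)

text \<open>Adding and subtracting the conjugate form separates the two coefficients.\<close>

lemma val_linear_ge:
  assumes P: "P \<in> curve_points d f" and "val P [:A, B:] \<ge> n" "val (curve_conj P) [:A, B:] \<ge> n"
  shows "A \<noteq> 0 \<Longrightarrow> ramification P * base_order P A \<ge> n"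
    and "B \<noteq> 0 \<Longrightarrow> 2 * ramification P * base_order P B + ramification P * base_order P f \<ge> 2 * n"
proof -
  have ge: "val P [:A, B:] \<ge> n" "val P [:A, - B:] \<ge> n"
    using assms by (simp_all add: val_conj)
  show "ramification P * base_order P A \<ge> n" if "A \<noteq> 0"
  proof -
    have "val P ([:A, B:] + [:A, - B:]) \<ge> n"
      using ge that by (intro val_add_ge[OF P]) (simp_all add: linear_dvd_iff del: add_pCons, simp add: linear_dvd_iff)
    also have "[:A, B:] + [:A, - B:] = [:smult 2 A:]"
      by (simp only: smult_2) simp
    finally show ?thesis
      using that by (simp add: val_poly[OF P] base_order_smult)
  qed
  show "2 * ramification P * base_order P B + ramification P * base_order P f \<ge> 2 * n" if "B \<noteq> 0"
  proof -
    have nd: "\<not> curve_eq d f dvd [:0, 1:]"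
      by (simp only: linear_dvd_iff) simp
    have ge': "val P [:- A, B:] \<ge> n"
    proof -
      have "[:- A, B:] = [:[:- 1:]:] * [:A, - B:]"
        by simp
      moreover have "val P ([:[:- 1:]:] * [:A, - B:]) = val P [:[:- 1:]:] + val P [:A, - B:]"
        using that by (intro val_mult[OF P]) (simp_all add: linear_dvd_iff)
      moreover have "val P [:[:- 1:]:] = ramification P * base_order P [:- 1:]"
        by (rule val_poly[OF P]) simp
      moreover have "base_order P [:- 1:] = 0"
        by (cases P) (simp_all add: order_0I)
      ultimately show ?thesis
        using ge by (simp del: mult_pCons_left mult_pCons_right)
    qed
    have "val P ([:A, B:] + [:- A, B:]) \<ge> n"
      using ge ge' that
      by (intro val_add_ge[OF P]) (simp_all add: linear_dvd_iff del: add_pCons, simp add: linear_dvd_iff)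
    also have "[:A, B:] + [:- A, B:] = [:smult 2 B:] * [:0, 1:]"
      by (simp only: smult_2) simp
    also have "val P \<dots> = val P [:smult 2 B:] + val P [:0, 1:]"
      using that nd by (intro val_mult[OF P]) auto
    finally show ?thesis
      using that val_y[OF P] by (simp add: val_poly[OF P] base_order_smult)
  qed
qed

text \<open>The affine coordinate ring is integrally closed: if (A + B y) / h has no affine poles,
  then A / h and B / h are polynomials. At a branch point y adds only half a unit to the order
  measured in x - c, and this half is lost because orders are integers.\<close>

lemma dvd_of_val_ge:
  assumes h: "h \<noteq> 0"
    and ge: "\<And>x y. Affine x y \<in> curve_points d f \<Longrightarrow> val (Affine x y) [:A, B:] \<ge> val (Affine x y) [:h:]"
  shows "h dvd A" "h dvd B"
proof -
  have *: "(A \<noteq> 0 \<longrightarrow> order c h \<le> order c A) \<and> (B \<noteq> 0 \<longrightarrow> order c h \<le> order c B)" for c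
  proof -
    obtain y where P: "Affine c y \<in> curve_points d f"
      using affine_point_exists by blast
    have P': "Affine c (- y) \<in> curve_points d f"
      using P by (simp add: Affine_in_points_iff)
    have "val (Affine c y) [:A, B:] \<ge> val (Affine c y) [:h:]"
      "val (curve_conj (Affine c y)) [:A, B:] \<ge> val (Affine c y) [:h:]"
      using ge[OF P] ge[OF P'] val_conj_poly[OF P, of h] by simp_all
    note v = val_linear_ge[OF P this]
    have f: "order c f = (if y = 0 then 1 else 0)"
    proof (cases "y = 0")
      case True
      hence "poly f c = 0"
        using P by (simp add: Affine_in_points_iff)
      thus ?thesis
        using rsquarefree_root_order[OF squarefree _ f_nonzero] True by simp
    next
      case False
      hence "poly f c \<noteq> 0"
        using P d_nonzero by (auto simp: Affine_in_points_iff)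
      thus ?thesis
        using False by (simp add: order_0I)
    qed
    show ?thesis
      using v by (auto simp: val_poly[OF P h] f split: if_splits)
  qed
  show "h dvd A"
    using * h by (cases "A = 0") (auto intro: poly_dvd_of_order_le)
  show "h dvd B"
    using * h by (cases "B = 0") (auto intro: poly_dvd_of_order_le)
qed

definition norm_poly :: "'k poly \<Rightarrow> 'k poly \<Rightarrow> 'k poly" where
  "norm_poly A B = A ^ 2 - smult (1 / d) (B ^ 2 * f)"

lemma norm_poly_nonzero: "A \<noteq> 0 \<or> B \<noteq> 0 \<Longrightarrow> norm_poly A B \<noteq> 0"
proof
  assume "A \<noteq> 0 \<or> B \<noteq> 0" "norm_poly A B = 0"
  hence "smult d (A ^ 2) = B ^ 2 * f"
    using d_nonzero by (simp add: norm_poly_def)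
  thus False
    using norm_eq_0 \<open>A \<noteq> 0 \<or> B \<noteq> 0\<close> by blast
qed

lemma val_norm_poly:
  assumes P: "P \<in> curve_points d f" and "A \<noteq> 0 \<or> B \<noteq> 0"
  shows "val P [:norm_poly A B:] = val P [:A, B:] + val P [:A, - B:]"
proof -
  have "[:A, B:] * [:A, - B:] = [:- smult (1 / d) (B ^ 2):] * curve_eq d f + [:norm_poly A B:]"
    using d_nonzero by (simp add: curve_eq_def norm_poly_def power2_eq_square mult.commute)
  hence "val P [:norm_poly A B:] = val P ([:A, B:] * [:A, - B:])"
    using val_cong[OF P, of "[:norm_poly A B:]"] norm_poly_nonzero[OF assms(2)]
    by (simp only: const_dvd_iff simp_thms)
  also have "\<dots> = val P [:A, B:] + val P [:A, - B:]"
    using assms(2) by (intro val_mult[OF P]) (simp_all add: linear_dvd_iff)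
  finally show ?thesis .
qed

text \<open>The denominator is rationalized: G / H times h0 equals G H' h0 divided by the norm of H,
  where H' is the conjugate of H. The product has no affine poles, so the division by the norm is
  exact.\<close>

lemma principal_divisor_polynomial:
  assumes D: "D \<in> principal_divisors d f" and h0: "h0 \<noteq> 0"
    and effective: "\<And>x y. Affine x y \<in> curve_points d f \<Longrightarrow>
       Poly_Mapping.lookup D (Affine x y) + val (Affine x y) [:h0:] \<ge> 0"
  obtains A B where "A \<noteq> 0 \<or> B \<noteq> 0"
    and "\<And>P. P \<in> curve_points d f \<Longrightarrow> val P [:A, B:] = Poly_Mapping.lookup D P + val P [:h0:]"
proof -
  obtain G H where GH: "\<not> curve_eq d f dvd G" "\<not> curve_eq d f dvd H"
    and lookup: "\<And>P. P \<in> curve_points d f \<Longrightarrow> Poly_Mapping.lookup D P = val P G - val P H"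
    using D unfolding principal_divisors_iff by blast
  obtain Q A2 B2 where H: "H = Q * curve_eq d f + [:A2, B2:]"
    using reduce_mod_curve by blast
  have 2: "A2 \<noteq> 0 \<or> B2 \<noteq> 0"
    using GH(2) unfolding H by (auto simp: dvd_add_times_triv_left_iff)
  have valH: "val P H = val P [:A2, B2:]" if "P \<in> curve_points d f" for P
    unfolding H using that 2 by (intro val_cong) (auto simp: linear_dvd_iff)
  define h where "h = norm_poly A2 B2"
  have h: "h \<noteq> 0"
    unfolding h_def by (rule norm_poly_nonzero[OF 2])
  define F where "F = G * [:A2, - B2:] * [:h0:]"
  have nd: "\<not> curve_eq d f dvd [:A2, - B2:]" "\<not> curve_eq d f dvd [:h0:]"
    using 2 h0 by (auto simp: linear_dvd_iff)
  have F: "\<not> curve_eq d f dvd F"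
    unfolding F_def by (intro not_dvd_mult GH nd)
  obtain Q' A3 B3 where F': "F = Q' * curve_eq d f + [:A3, B3:]"
    using reduce_mod_curve by blast
  have 3: "A3 \<noteq> 0 \<or> B3 \<noteq> 0"
    using F unfolding F' by (auto simp: dvd_add_times_triv_left_iff)
  have val3: "val P [:A3, B3:] = Poly_Mapping.lookup D P + val P [:h0:] + val P [:h:]"
    if P: "P \<in> curve_points d f" for P
  proof -
    have "val P [:A3, B3:] = val P F"
      unfolding F' using P 3 by (intro val_cong[symmetric]) (auto simp: linear_dvd_iff)
    also have "\<dots> = val P G + val P [:A2, - B2:] + val P [:h0:]"
      unfolding F_def using GH nd by (simp only: val_mult[OF P] not_dvd_mult simp_thms)
    finally show ?thesis
      using val_norm_poly[OF P 2] lookup[OF P] valH[OF P] by (simp add: h_def)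
  qed
  have "val (Affine x y) [:A3, B3:] \<ge> val (Affine x y) [:h:]" if "Affine x y \<in> curve_points d f" for x y
    using val3[OF that] effective[OF that] by simp
  from dvd_of_val_ge[OF h this] obtain A B where AB: "A3 = h * A" "B3 = h * B"
    by (auto elim!: dvdE)
  have nz: "A \<noteq> 0 \<or> B \<noteq> 0"
    using 3 AB by auto
  show ?thesis
  proof (rule that[OF nz])
    fix P
    assume P: "P \<in> curve_points d f"
    have "[:A3, B3:] = [:h:] * [:A, B:]"
      by (simp add: AB)
    moreover have "val P ([:h:] * [:A, B:]) = val P [:h:] + val P [:A, B:]"
      using h nz by (intro val_mult[OF P]) (auto simp: linear_dvd_iff)
    ultimately show "val P [:A, B:] = Poly_Mapping.lookup D P + val P [:h0:]"
      using val3[OF P] by simp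
  qed
qed

lemma val_base_poly:
  assumes "P \<in> curve_points d f" "Q \<in> curve_points d f"
  shows "val Q [:base_poly P:] + pole_order Q = of_bool (Q = P) + of_bool (Q = curve_conj P)"
proof -
  have sq: "b = a \<or> b = - a" if "d * a ^ 2 = c" "d * b ^ 2 = c" for a b c
    using that d_nonzero by (metis mult_left_cancel power2_eq_iff)
  have "val Q [:base_poly P:] = ramification Q * base_order Q (base_poly P)"
    by (rule val_poly[OF assms(2)]) simp
  moreover have "order x [:- a, 1:] = of_bool (x = a)" for x a :: 'k
  proof (cases "x = a")
    case True
    thus ?thesis
      using order_power_n_n[of a 1] by simp
  qed (simp add: order_0I)
  moreover have neg: "a = - a \<longleftrightarrow> a = 0" "- a = a \<longleftrightarrow> a = 0" for a :: 'k
    by (auto simp: eq_neg_iff_add_eq_0 neg_eq_iff_add_eq_0 simp flip: mult_2)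
  moreover have "val Q [:base_poly P:] + pole_order Q = of_bool (Q = P) + of_bool (Q = curve_conj P)"
    if "val Q [:base_poly P:] = ramification Q * base_order Q (base_poly P)"
      "\<And>x a :: 'k. order x [:- a, 1:] = of_bool (x = a)"
  proof (cases P)
    case P: (Affine x y)
    show ?thesis
    proof (cases Q)
      case Q: (Affine x' y')
      have "y' = y \<or> y' = - y" if "x' = x"
        using assms that unfolding P Q Affine_in_points_iff by (intro sq) auto
      thus ?thesis
        using that unfolding P Q by (auto simp: neg)
    qed (use that in \<open>auto simp: P\<close>)
  next
    case P: (Infinite w)
    show ?thesis
    proof (cases Q)
      case Q: (Infinite w')
      have "w' = w \<or> w' = - w"
        using assms unfolding P Q Infinite_in_points_iff by (intro sq) auto
      thus ?thesis
        using that unfolding P Q by (auto simp: neg)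
    qed (use that in \<open>auto simp: P\<close>)
  qed
  ultimately show ?thesis
    by blast
qed

section \<open>Multiples of the difference of two points\<close>

lemma lookup_multiple_diff:
  "Poly_Mapping.lookup (frag_cmul (int n) (frag_of P - frag_of S)) Q =
     int n * of_bool (Q = P) - int n * of_bool (Q = S)"
  by (auto simp: lookup_minus algebra_simps)

text \<open>Multiplying by the n-th power of the form with divisor S + S' turns the poles at S into
  zeros at the conjugate S'. The result is a form of weight n, and all conditions on it are
  vanishing conditions.\<close>

lemma principal_imp_form:
  assumes P: "P \<in> curve_points d f" and S: "S \<in> curve_points d f"
    and principal: "frag_cmul (int n) (frag_of P - frag_of S) \<in> principal_divisors d f"
  obtains A B where "A \<noteq> 0 \<or> B \<noteq> 0" "weight_le (curve_genus f) n [:A, B:]"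
    "\<And>Q. Q \<in> curve_points d f \<Longrightarrow> val Q [:A, B:] + int n * pole_order Q =
       int n * of_bool (Q = P) + int n * of_bool (Q = curve_conj S)"
proof -
  define h where "h = base_poly S ^ n"
  have h: "h \<noteq> 0"
    by (simp add: h_def)
  have valh: "val Q [:h:] = int n * (of_bool (Q = S) + of_bool (Q = curve_conj S) - pole_order Q)"
    if "Q \<in> curve_points d f" for Q
    using val_base_poly[OF S that] that by (simp add: h_def val_poly_power flip: eq_diff_eq)
  obtain A B where nz: "A \<noteq> 0 \<or> B \<noteq> 0" and val: "\<And>Q. Q \<in> curve_points d f \<Longrightarrow>
      val Q [:A, B:] = Poly_Mapping.lookup (frag_cmul (int n) (frag_of P - frag_of S)) Q + val Q [:h:]"
  proof (rule principal_divisor_polynomial[OF principal h])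
    fix x y
    assume "Affine x y \<in> curve_points d f"
    from valh[OF this] show "Poly_Mapping.lookup (frag_cmul (int n) (frag_of P - frag_of S)) (Affine x y)
        + val (Affine x y) [:h:] \<ge> 0"
      unfolding lookup_multiple_diff by (simp add: algebra_simps)
  qed blast
  have val': "val Q [:A, B:] + int n * pole_order Q =
       int n * of_bool (Q = P) + int n * of_bool (Q = curve_conj S)" if "Q \<in> curve_points d f" for Q
    using val[OF that] valh[OF that] unfolding lookup_multiple_diff by (simp add: algebra_simps)
  \<comment> \<open>The order is bounded at a point at infinity and at its conjugate, since at one
    of them alone the leading terms of A and B y could cancel. Together the bounds limit both
    degrees.\<close>
  obtain w where w: "Infinite w \<in> curve_points d f"
    using infinite_point_exists by blast
  have w': "curve_conj (Infinite w) \<in> curve_points d f"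
    using w by (simp only: conj_in_points)
  have "val Q [:A, B:] \<ge> - int n * pole_order Q" if "Q \<in> curve_points d f" for Q
  proof -
    have "int n * of_bool (Q = P) + int n * of_bool (Q = curve_conj S) \<ge> 0"
      by simp
    with val'[OF that] show ?thesis
      by linarith
  qed
  from this[OF w] this[OF w'] have "val (Infinite w) [:A, B:] \<ge> - int n * pole_order (Infinite w)"
    "val (curve_conj (Infinite w)) [:A, B:] \<ge> - int n * pole_order (Infinite w)"
    by simp_all
  note bounds = val_linear_ge[OF w this]
  have "A \<noteq> 0 \<longrightarrow> degree A \<le> n" "B \<noteq> 0 \<longrightarrow> degree B + (curve_genus f + 1) \<le> n"
    using bounds Infinite_degree[OF w] by (auto split: if_splits)
  hence "weight_le (curve_genus f) n [:A, B:]"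
    unfolding weight_le_def using le_degree[of A] le_degree[of B]
    by (fastforce simp: coeff_pCons split: nat.splits)
  from that[OF nz this val'] show ?thesis .
qed

text \<open>Only lower bounds are assumed, because a linear functional preserves vanishing but may
  increase it. The excess at Q and at its conjugate adds up to the excess of the norm over
  \<open>h\<close>. The norm is divisible by \<open>h\<close>, and the bound at infinity makes its
  degree no larger, so it is a constant multiple of \<open>h\<close> and every excess is 0.\<close>

lemma form_imp_principal:
  assumes P: "P \<in> curve_points d f" and S: "S \<in> curve_points d f"
    and nz: "A \<noteq> 0 \<or> B \<noteq> 0"
    and ge: "\<And>Q. Q \<in> curve_points d f \<Longrightarrow> val Q [:A, B:] + int n * pole_order Q \<ge>
       int n * of_bool (Q = P) + int n * of_bool (Q = curve_conj S)"
  shows "frag_cmul (int n) (frag_of P - frag_of S) \<in> principal_divisors d f"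
proof -
  define N where "N = norm_poly A B"
  define h where "h = (base_poly P * base_poly S) ^ n"
  have N: "N \<noteq> 0"
    unfolding N_def by (rule norm_poly_nonzero[OF nz])
  have h: "h \<noteq> 0"
    by (simp add: h_def)
  define excess where "excess Q = val Q [:A, B:] + int n * pole_order Q -
    (int n * of_bool (Q = P) + int n * of_bool (Q = curve_conj S))" for Q
  have valh: "val Q [:h:] = int n * (of_bool (Q = P) + of_bool (Q = curve_conj P) +
      of_bool (Q = S) + of_bool (Q = curve_conj S) - 2 * pole_order Q)" if Q: "Q \<in> curve_points d f" for Q
    using val_base_poly[OF P Q] val_base_poly[OF S Q]
    by (simp add: h_def val_poly_power[OF Q] val_poly_mult[OF Q] flip: eq_diff_eq)
  have excess: "excess Q + excess (curve_conj Q) = val Q [:N:] - val Q [:h:]"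
    if Q: "Q \<in> curve_points d f" for Q
    unfolding excess_def N_def val_norm_poly[OF Q nz] valh[OF Q] val_conj[OF Q]
    by (simp add: curve_conj_eq_iff algebra_simps)
  have excess_nonneg: "excess Q \<ge> 0" if "Q \<in> curve_points d f" for Q
    using ge[OF that] by (simp add: excess_def)
  have N_ge_h: "val Q [:N:] \<ge> val Q [:h:]" if "Q \<in> curve_points d f" for Q
    using excess[OF that] excess_nonneg[OF that] excess_nonneg[of "curve_conj Q"] that by simp
  have "h dvd N"
    using dvd_of_val_ge(1)[OF h, of N 0] N_ge_h by simp
  then obtain q where q: "N = h * q"
    by (elim dvdE)
  obtain w where w: "Infinite w \<in> curve_points d f"
    using infinite_point_exists by blast
  have "degree N \<le> degree h"
    using N_ge_h[OF w] ramification_pos[of "Infinite w"] by (simp add: val_poly[OF w] N h split: if_splits)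
  hence "degree q = 0"
    using N unfolding q by (subst (asm) degree_mult_eq) auto
  then obtain c where "q = [:c:]"
    by (metis degree_eq_zeroE)
  hence Nh: "N = smult c h" "c \<noteq> 0"
    using q N by auto
  have excess_0: "excess Q = 0" if Q: "Q \<in> curve_points d f" for Q
  proof -
    have "val Q [:N:] = val Q [:h:]"
      using Nh N h by (simp add: val_poly[OF Q] base_order_smult)
    thus ?thesis
      using excess[OF Q] excess_nonneg[OF Q] excess_nonneg[of "curve_conj Q"] Q by simp
  qed
  have "frag_cmul (int n) (frag_of P - frag_of S) \<in> carrier (divisor_group d f)"
    using P S keys_cmul[of "int n" "frag_of P - frag_of S"] keys_diff[of "frag_of P" "frag_of S"]
    by (auto simp: divisor_group_def)
  moreover have "Poly_Mapping.lookup (frag_cmul (int n) (frag_of P - frag_of S)) Q =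
      val Q [:A, B:] - val Q [:base_poly S ^ n:]" if Q: "Q \<in> curve_points d f" for Q
    using excess_0[OF Q] val_base_poly[OF S Q] unfolding excess_def lookup_multiple_diff
    by (simp add: val_poly_power[OF Q] algebra_simps flip: eq_diff_eq)
  moreover have "\<not> curve_eq d f dvd [:A, B:]" "\<not> curve_eq d f dvd [:base_poly S ^ n:]"
    using nz by (simp_all add: linear_dvd_iff)
  ultimately show ?thesis
    unfolding principal_divisors_iff by blast
qed

end

section \<open>Vanishing conditions under semilinear maps\<close>

text \<open>Substituting y / s for y carries the equation of the twist by s^2 to the equation of the
  original curve, and the ideal of (x0, y0 / s) to that of (x0, y0).\<close>

lemma vanishes_twist:
  fixes s :: "'k::field"
  assumes s: "s \<noteq> 0" and "vanishes (d * s ^ 2) f x0 (y0 / s) n H"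
  shows "vanishes d f x0 y0 n (pcompose H [:0, [:1 / s:]:])"
  using assms(2)
proof (induction n arbitrary: H)
  case (Suc n)
  define \<tau> where "\<tau> = (\<lambda>H. pcompose H [:0, [:1 / s:]:])"
  obtain G1 G2 Q where G: "vanishes (d * s ^ 2) f x0 (y0 / s) n G1"
      "vanishes (d * s ^ 2) f x0 (y0 / s) n G2"
    and H: "H = Q * curve_eq (d * s ^ 2) f + [:[:- x0, 1:]:] * G1 + [:[:- (y0 / s):], 1:] * G2"
    using Suc.prems unfolding vanishes_Suc_iff by blast
  have "\<tau> (curve_eq (d * s ^ 2) f) = curve_eq d f"
    using s by (simp add: \<tau>_def curve_eq_def pcompose_pCons power2_eq_square)
  moreover have "\<tau> [:[:- (y0 / s):], 1:] = [:[:1 / s:]:] * [:[:- y0:], 1:]"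
    by (simp add: \<tau>_def pcompose_pCons one_pCons)
  moreover have "\<tau> [:[:- x0, 1:]:] = [:[:- x0, 1:]:]"
    by (simp add: \<tau>_def)
  ultimately have "\<tau> H = \<tau> Q * curve_eq d f + [:[:- x0, 1:]:] * \<tau> G1
      + [:[:- y0:], 1:] * ([:[:1 / s:]:] * \<tau> G2)"
    unfolding H by (simp only: \<tau>_def pcompose_add pcompose_mult ac_simps)
  moreover have "vanishes d f x0 y0 n (\<tau> G1)" "vanishes d f x0 y0 n ([:[:1 / s:]:] * \<tau> G2)"
    using Suc.IH[OF G(1)] Suc.IH[OF G(2)] unfolding \<tau>_def by (simp_all only: vanishes_mult_left)
  ultimately show ?case
    unfolding vanishes_Suc_iff \<tau>_def by blast
qed (simp add: vanishes_0)

text \<open>\<open>\<iota>\<close> and \<open>\<kappa>\<close> map a common base to two rings, and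
  \<open>\<Lambda>\<close> is linear over the base without being multiplicative. Rings are allowed
  in place of fields so that the notion passes to polynomials, coefficient by coefficient,
  twice.\<close>

locale semilinear =
  \<iota>: ring_morphism \<iota> + \<kappa>: ring_morphism \<kappa>
  for \<iota> :: "'a::comm_ring_1 \<Rightarrow> 'b::comm_ring_1" and \<kappa> :: "'a \<Rightarrow> 'c::comm_ring_1" +
  fixes \<Lambda> :: "'b \<Rightarrow> 'c"
  assumes add: "\<Lambda> (x + y) = \<Lambda> x + \<Lambda> y"
    and scale: "\<Lambda> (\<iota> q * x) = \<kappa> q * \<Lambda> x"
begin

lemma zero [simp]: "\<Lambda> 0 = 0"
  using add[of 0 0] by simp

lemma sum: "\<Lambda> (sum g A) = (\<Sum>x\<in>A. \<Lambda> (g x))"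
  by (induction A rule: infinite_finite_induct) (auto simp: add)

lemma semilinear_map_poly: "semilinear (map_poly \<iota>) (map_poly \<kappa>) (map_poly \<Lambda>)"
proof -
  interpret mi: ring_morphism "map_poly \<iota>"
    by (rule \<iota>.map_poly_morphism)
  interpret mk: ring_morphism "map_poly \<kappa>"
    by (rule \<kappa>.map_poly_morphism)
  show ?thesis
  proof unfold_locales
    show "map_poly \<Lambda> (p + q) = map_poly \<Lambda> p + map_poly \<Lambda> q" for p q
      by (rule poly_eqI) (simp add: coeff_map_poly add)
    show "map_poly \<Lambda> (map_poly \<iota> p * q) = map_poly \<kappa> p * map_poly \<Lambda> q" for p q
      by (rule poly_eqI) (simp add: coeff_map_poly coeff_mult sum scale)
  qed
qed

end

lemma chart_at_infinity_map:
  assumes "ring_morphism h" "curve_genus (map_poly h f) = curve_genus f"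
  shows "chart_at_infinity (map_poly h f) = map_poly h (chart_at_infinity f)"
proof -
  interpret ring_morphism h by fact
  interpret m: ring_morphism "map_poly h" by (rule map_poly_morphism)
  show ?thesis
    using assms(2) by (simp add: chart_at_infinity_def Let_def m.hom_sum map_poly_monom)
qed

text \<open>Written with a common bound on the degrees in place of the degrees themselves, because a
  functional applied to the coefficients may lower them.\<close>

lemma change_chart_linear:
  fixes A B :: "'k::field poly"
  assumes "degree A \<le> n" "degree B \<le> n"
  shows "change_chart g N [:A, B:] =
    [:\<Sum>i\<le>n. monom (coeff A i) (N - i), \<Sum>i\<le>n. monom (coeff B i) (N - (i + (g + 1))):]"
proof -
  define T where "T j = (\<Sum>i\<le>degree (coeff [:A, B:] j).
     monom (monom (coeff (coeff [:A, B:] j) i) (N - (i + (g + 1) * j))) j)" for j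
  have "change_chart g N [:A, B:] = (\<Sum>j\<le>degree [:A, B:]. T j)"
    by (simp add: change_chart_def T_def)
  also have "\<dots> = (\<Sum>j\<le>1. T j)"
    by (intro sum.mono_neutral_left) (auto simp: T_def coeff_pCons split: nat.splits)
  also have "\<dots> = T 0 + T 1"
    by simp
  also have "T 0 = [:\<Sum>i\<le>degree A. monom (coeff A i) (N - i):]"
    by (simp add: T_def monom_0 flip: monom_sum)
       (simp add: monom_0[symmetric] monom_sum)
  also have "(\<Sum>i\<le>degree A. monom (coeff A i) (N - i)) = (\<Sum>i\<le>n. monom (coeff A i) (N - i))"
    using assms(1) by (intro sum.mono_neutral_left) (auto simp: coeff_eq_0)
  also have "T 1 = monom (\<Sum>i\<le>degree B. monom (coeff B i) (N - (i + (g + 1)))) 1"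
    by (simp add: T_def monom_sum)
  also have "(\<Sum>i\<le>degree B. monom (coeff B i) (N - (i + (g + 1)))) =
      (\<Sum>i\<le>n. monom (coeff B i) (N - (i + (g + 1))))"
    using assms(2) by (intro sum.mono_neutral_left) (auto simp: coeff_eq_0)
  finally show ?thesis
    by (simp add: monom_Suc monom_0)
qed

text \<open>The generators of the ideal and the equation of the curve come from the base. So
  \<open>\<Lambda>\<close> acts on the arbitrary cofactors, while the generators are merely
  transported from \<open>\<iota>\<close> to \<open>\<kappa>\<close>.\<close>

lemma vanishes_semilinear:
  fixes \<iota> :: "'a::field \<Rightarrow> 'b::field" and \<kappa> :: "'a \<Rightarrow> 'c::field"
  assumes "semilinear \<iota> \<kappa> \<Lambda>" "vanishes (\<iota> d) (map_poly \<iota> f) (\<iota> x0) (\<iota> y0) n H"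
  shows "vanishes (\<kappa> d) (map_poly \<kappa> f) (\<kappa> x0) (\<kappa> y0) n (map_poly (map_poly \<Lambda>) H)"
  using assms(2)
proof (induction n arbitrary: H)
  case (Suc n)
  interpret s0: semilinear \<iota> \<kappa> \<Lambda> by fact
  interpret s1: semilinear "map_poly \<iota>" "map_poly \<kappa>" "map_poly \<Lambda>"
    by (rule s0.semilinear_map_poly)
  interpret s2: semilinear "map_poly (map_poly \<iota>)" "map_poly (map_poly \<kappa>)" "map_poly (map_poly \<Lambda>)"
    by (rule s1.semilinear_map_poly)
  obtain G1 G2 Q where G: "vanishes (\<iota> d) (map_poly \<iota> f) (\<iota> x0) (\<iota> y0) n G1"
      "vanishes (\<iota> d) (map_poly \<iota> f) (\<iota> x0) (\<iota> y0) n G2"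
    and H: "H = Q * curve_eq (\<iota> d) (map_poly \<iota> f) + [:[:- \<iota> x0, 1:]:] * G1 + [:[:- \<iota> y0:], 1:] * G2"
    using Suc.prems unfolding vanishes_Suc_iff by blast
  have images: "curve_eq (\<iota> d) (map_poly \<iota> f) = map_poly (map_poly \<iota>) (curve_eq d f)"
    "[:[:- \<iota> x0, 1:]:] = map_poly (map_poly \<iota>) [:[:- x0, 1:]:]"
    "[:[:- \<iota> y0:], 1:] = map_poly (map_poly \<iota>) [:[:- y0:], 1:]"
    "map_poly (map_poly \<kappa>) (curve_eq d f) = curve_eq (\<kappa> d) (map_poly \<kappa> f)"
    "map_poly (map_poly \<kappa>) [:[:- x0, 1:]:] = [:[:- \<kappa> x0, 1:]:]"
    "map_poly (map_poly \<kappa>) [:[:- y0:], 1:] = [:[:- \<kappa> y0:], 1:]"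
    by (simp_all add: curve_eq_def)
  have "map_poly (map_poly \<Lambda>) H = map_poly (map_poly \<Lambda>) Q * curve_eq (\<kappa> d) (map_poly \<kappa> f) +
     [:[:- \<kappa> x0, 1:]:] * map_poly (map_poly \<Lambda>) G1 + [:[:- \<kappa> y0:], 1:] * map_poly (map_poly \<Lambda>) G2"
    unfolding H mult.commute[of Q] images s2.add s2.scale by (simp only: mult.commute)
  thus ?case
    unfolding vanishes_Suc_iff using Suc.IH[OF G(1)] Suc.IH[OF G(2)] by blast
qed (simp add: vanishes_0)

lemma form_vanishes_semilinear:
  fixes \<iota> :: "'a::field \<Rightarrow> 'b::field" and \<kappa> :: "'a \<Rightarrow> 'c::field"
  assumes sl: "semilinear \<iota> \<kappa> \<Lambda>"
    and van: "form_vanishes (\<iota> d) (map_poly \<iota> f) N n [:A, B:] (map_curve_point \<iota> P)"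
  shows "form_vanishes (\<kappa> d) (map_poly \<kappa> f) N n [:map_poly \<Lambda> A, map_poly \<Lambda> B:] (map_curve_point \<kappa> P)"
proof -
  interpret s0: semilinear \<iota> \<kappa> \<Lambda> by fact
  interpret s1: semilinear "map_poly \<iota>" "map_poly \<kappa>" "map_poly \<Lambda>"
    by (rule s0.semilinear_map_poly)
  have inj: "\<iota> x \<noteq> 0" "\<kappa> x \<noteq> 0" if "x \<noteq> 0" for x
    using s0.\<iota>.hom_mult[of x "inverse x"] s0.\<kappa>.hom_mult[of x "inverse x"] that by auto
  have genus: "curve_genus (map_poly \<iota> f) = curve_genus f" "curve_genus (map_poly \<kappa> f) = curve_genus f"
    using inj by (auto simp: curve_genus_def degree_map_poly)
  have AB: "map_poly (map_poly \<Lambda>) [:A, B:] = [:map_poly \<Lambda> A, map_poly \<Lambda> B:]"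
    by (simp add: map_poly_pCons)
  show ?thesis
  proof (cases P)
    case (Affine x y)
    thus ?thesis
      using vanishes_semilinear[OF sl, of d f x y n "[:A, B:]"] van by (simp only: AB) simp
  next
    case (Infinite w)
    define k where "k = max (degree A) (degree B)"
    have k: "degree A \<le> k" "degree B \<le> k"
      "degree (map_poly \<Lambda> A) \<le> k" "degree (map_poly \<Lambda> B) \<le> k"
      using map_poly_degree_leq[of \<Lambda> A] map_poly_degree_leq[of \<Lambda> B] by (auto simp: k_def)
    have chart: "change_chart (curve_genus f) N [:map_poly \<Lambda> A, map_poly \<Lambda> B:] =
       map_poly (map_poly \<Lambda>) (change_chart (curve_genus f) N [:A, B:])"
      unfolding change_chart_linear[OF k(1,2)] change_chart_linear[OF k(3,4)]
      by (simp add: map_poly_pCons s1.sum map_poly_monom coeff_map_poly)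
    show ?thesis
      using vanishes_semilinear[OF sl, of d "chart_at_infinity f" 0 w n
          "change_chart (curve_genus f) N [:A, B:]"] van
      by (simp add: Infinite chart genus chart_at_infinity_map s0.\<iota>.ring_morphism_axioms
          s0.\<kappa>.ring_morphism_axioms)
  qed
qed

fun twist_point :: "'k::field \<Rightarrow> 'k curve_point \<Rightarrow> 'k curve_point" where
  "twist_point s (Affine x y) = Affine x (y / s)"
| "twist_point s (Infinite w) = Infinite (w / s)"

lemma form_vanishes_twist:
  assumes s: "s \<noteq> 0"
    and van: "form_vanishes (d * s ^ 2) f N n [:A, B:] (twist_point s P)"
  shows "form_vanishes d f N n [:A, smult (1 / s) B:] P"
proof -
  have lin: "pcompose [:A', B':] [:0, [:1 / s:]:] = [:A', smult (1 / s) B':]" for A' B'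
    by (simp add: pcompose_pCons)
  show ?thesis
  proof (cases P)
    case (Affine x y)
    thus ?thesis
      using vanishes_twist[OF s, of d f x y n "[:A, B:]"] van by (simp only: lin) simp
  next
    case (Infinite w)
    define k where "k = max (degree A) (degree B)"
    have k: "degree A \<le> k" "degree B \<le> k" "degree (smult (1 / s) B) \<le> k"
      by (auto simp: k_def)
    have "change_chart (curve_genus f) N [:A, smult (1 / s) B:] =
       pcompose (change_chart (curve_genus f) N [:A, B:]) [:0, [:1 / s:]:]"
      unfolding change_chart_linear[OF k(1,2)] change_chart_linear[OF k(1,3)] lin
      by (auto simp: poly_eq_iff coeff_pCons coeff_sum sum_divide_distrib intro!: sum.cong
          split: nat.split)
    thus ?thesis
      using vanishes_twist[OF s, of d "chart_at_infinity f" 0 w n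
          "change_chart (curve_genus f) N [:A, B:]"] van
      by (simp add: Infinite)
  qed
qed

lemma linear_functional_exists:
  fixes \<iota> :: "'a::field \<Rightarrow> 'b::field"
  assumes "ring_morphism \<iota>" "z0 \<noteq> 0"
  obtains \<Lambda> :: "'b \<Rightarrow> 'a" where "\<And>x y. \<Lambda> (x + y) = \<Lambda> x + \<Lambda> y"
    "\<And>q x. \<Lambda> (\<iota> q * x) = q * \<Lambda> x" "\<Lambda> z0 = 1"
proof -
  interpret \<iota>: ring_morphism \<iota> by fact
  interpret vector_space_pair "\<lambda>q z. \<iota> q * z" "(*) :: 'a \<Rightarrow> 'a \<Rightarrow> 'a"
    by unfold_locales (auto simp: algebra_simps)
  have "\<not> vs1.dependent {z0}"
    using assms(2) by simp
  then obtain \<Lambda> where lin: "Vector_Spaces.linear (\<lambda>q z. \<iota> q * z) (*) \<Lambda>" and "\<Lambda> z0 = 1"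
    using linear_independent_extend[of "{z0}" "\<lambda>_. 1"] by auto
  thus ?thesis
    using that[of \<Lambda>] by (simp add: linear_add[OF lin] linear_scale[OF lin])
qed

section \<open>Torsion points of a constant curve\<close>

lemma twist_point_eq_iff: "s \<noteq> 0 \<Longrightarrow> twist_point s P = twist_point s Q \<longleftrightarrow> P = Q"
  by (cases P; cases Q) auto

lemma twist_point_conj: "twist_point s (curve_conj P) = curve_conj (twist_point s P)"
  by (cases P) auto

text \<open>The prescribed zeros are at points over the base field, where vanishing passes through
  \<open>\<Lambda>\<close>. At all other points only nonnegativity of the order is asked, and every
  form of weight n has it. That the divisor is then exactly the right one is the sharpness in
  \<open>form_imp_principal\<close>.\<close>

lemma principal_descent:
  fixes d :: "'a::field" and \<iota> :: "'a \<Rightarrow> 'b::{alg_closed_field, field_char_0}"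
    and \<kappa> :: "'a \<Rightarrow> 'c::{alg_closed_field, field_char_0}"
  assumes \<iota>: "ring_morphism \<iota>" and \<kappa>: "ring_morphism \<kappa>" and s: "s \<noteq> 0"
    and hb: "hyperelliptic (\<iota> d * s ^ 2) (map_poly \<iota> f)" and hc: "hyperelliptic (\<kappa> d) (map_poly \<kappa> f)"
    and P: "P \<in> curve_points d f" and S: "S \<in> curve_points d f"
    and principal: "frag_cmul (int n) (frag_of (twist_point s (map_curve_point \<iota> P)) -
        frag_of (twist_point s (map_curve_point \<iota> S))) \<in> principal_divisors (\<iota> d * s ^ 2) (map_poly \<iota> f)"
  shows "frag_cmul (int n) (frag_of (map_curve_point \<kappa> P) - frag_of (map_curve_point \<kappa> S))
      \<in> principal_divisors (\<kappa> d) (map_poly \<kappa> f)"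
proof -
  interpret \<iota>: ring_morphism \<iota> by fact
  interpret \<kappa>: ring_morphism \<kappa> by fact
  interpret b: hyperelliptic "\<iota> d * s ^ 2" "map_poly \<iota> f" by fact
  interpret c: hyperelliptic "\<kappa> d" "map_poly \<kappa> f" by fact
  have nz: "\<iota> x \<noteq> 0" "\<kappa> x \<noteq> 0" if "x \<noteq> 0" for x
    using \<iota>.hom_mult[of x "inverse x"] \<kappa>.hom_mult[of x "inverse x"] that by auto
  have inj: "inj \<iota>" "inj \<kappa>"
    using nz \<iota>.hom_diff \<kappa>.hom_diff by (metis injI right_minus_eq)+
  have genus: "curve_genus (map_poly \<iota> f) = curve_genus f" "curve_genus (map_poly \<kappa> f) = curve_genus f"
    using nz by (auto simp: curve_genus_def degree_map_poly)
  define tw where "tw Q = twist_point s (map_curve_point \<iota> Q)" for Q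
  have tw_pts: "tw Q \<in> curve_points (\<iota> d * s ^ 2) (map_poly \<iota> f)" if "Q \<in> curve_points d f" for Q
    using that s unfolding tw_def curve_points_def
    by (auto simp: genus power_divide simp flip: \<iota>.hom_poly \<iota>.hom_mult \<iota>.hom_power)
  have \<kappa>_pts: "map_curve_point \<kappa> Q \<in> curve_points (\<kappa> d) (map_poly \<kappa> f)" if "Q \<in> curve_points d f" for Q
    using that unfolding curve_points_def
    by (auto simp: genus simp flip: \<kappa>.hom_poly \<kappa>.hom_mult \<kappa>.hom_power)
  have conj_pts: "curve_conj Q \<in> curve_points d f" if "Q \<in> curve_points d f" for Q
    using that unfolding curve_points_def by auto
  have conj_map: "map_curve_point \<iota> (curve_conj Q) = curve_conj (map_curve_point \<iota> Q)"
    "map_curve_point \<kappa> (curve_conj Q) = curve_conj (map_curve_point \<kappa> Q)" for Q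
    by (cases Q; simp)+
  have tw_eq_iff: "tw Q = tw R \<longleftrightarrow> Q = R" for Q R
    unfolding tw_def twist_point_eq_iff[OF s] using inj_eq[OF curve_point.inj_map[OF inj(1)]] .
  have tw_conj: "tw (curve_conj Q) = curve_conj (tw Q)" for Q
    unfolding tw_def conj_map twist_point_conj ..
  obtain A B where AB: "A \<noteq> 0 \<or> B \<noteq> 0" and wt: "weight_le (curve_genus f) n [:A, B:]"
    and val: "\<And>Q. Q \<in> curve_points (\<iota> d * s ^ 2) (map_poly \<iota> f) \<Longrightarrow>
       b.val Q [:A, B:] + int n * pole_order Q = int n * of_bool (Q = tw P) + int n * of_bool (Q = curve_conj (tw S))"
    using b.principal_imp_form[OF tw_pts[OF P] tw_pts[OF S] principal[folded tw_def]] genus by metis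
  define B' where "B' = smult (1 / s) B"
  have AB': "A \<noteq> 0 \<or> B' \<noteq> 0"
    using AB s by (auto simp: B'_def)
  \<comment> \<open>The functional is normalized on a nonzero leading coefficient, so that the
    descended form is not zero.\<close>
  obtain z where z: "z \<noteq> 0" "z = lead_coeff A \<or> z = lead_coeff B'"
    using AB' by (metis leading_coeff_0_iff)
  obtain l where l: "\<And>x y. l (x + y) = l x + l y" "\<And>q x. l (\<iota> q * x) = q * l x" "l z = 1"
    using linear_functional_exists[OF \<iota> z(1)] by blast
  define \<Lambda> where "\<Lambda> x = \<kappa> (l x)" for x
  interpret sl: semilinear \<iota> \<kappa> \<Lambda>
    by unfold_locales (auto simp: \<Lambda>_def l)
  define A2 B2 where "A2 = map_poly \<Lambda> A" and "B2 = map_poly \<Lambda> B'"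
  have "\<Lambda> z = 1"
    by (simp add: \<Lambda>_def l)
  hence AB2: "A2 \<noteq> 0 \<or> B2 \<noteq> 0"
    using z by (metis A2_def B2_def coeff_0 coeff_map_poly sl.zero zero_neq_one)
  hence ndvd: "\<not> curve_eq (\<kappa> d) (map_poly \<kappa> f) dvd [:A2, B2:]"
    by (auto simp: c.linear_dvd_iff)
  have coeffs: "coeff (coeff [:A2, B2:] j) i = \<Lambda> (coeff (coeff [:A, B':] j) i)"
    "coeff (coeff [:A, B':] j) i \<noteq> 0 \<Longrightarrow> coeff (coeff [:A, B:] j) i \<noteq> 0" for i j
    by (auto simp: A2_def B2_def B'_def coeff_pCons coeff_map_poly split: nat.splits)
  have wt2: "weight_le (curve_genus f) n [:A2, B2:]"
    using wt coeffs unfolding weight_le_def by (metis sl.zero)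
  have key: "c.val (map_curve_point \<kappa> R) [:A2, B2:] + int n * pole_order (map_curve_point \<kappa> R) \<ge>
      int n * of_bool (R = P) + int n * of_bool (R = curve_conj S)" if R: "R \<in> curve_points d f" for R
  proof -
    \<comment> \<open>If P is the conjugate of S, the two conditions fall on one point and ask for
      order 2 n there.\<close>
    define k where "k = n * of_bool (R = P) + n * of_bool (R = curve_conj S)"
    have "int k \<le> b.val (tw R) [:A, B:] + int n * pole_order (tw R)"
      unfolding val[OF tw_pts[OF R]] tw_conj[symmetric] tw_eq_iff by (simp add: k_def)
    hence "form_vanishes (\<iota> d * s ^ 2) (map_poly \<iota> f) n k [:A, B:] (tw R)"
      using b.form_vanishes_iff[OF tw_pts[OF R], of n "[:A, B:]"] wt AB
      by (simp add: genus b.linear_dvd_iff)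
    hence "form_vanishes (\<iota> d) (map_poly \<iota> f) n k [:A, B':] (map_curve_point \<iota> R)"
      unfolding B'_def tw_def by (rule form_vanishes_twist[OF s])
    hence "form_vanishes (\<kappa> d) (map_poly \<kappa> f) n k [:A2, B2:] (map_curve_point \<kappa> R)"
      unfolding A2_def B2_def by (rule form_vanishes_semilinear[OF sl.semilinear_axioms])
    hence "int k \<le> c.val (map_curve_point \<kappa> R) [:A2, B2:] + int n * pole_order (map_curve_point \<kappa> R)"
      using c.form_vanishes_iff[OF \<kappa>_pts[OF R] _ ndvd, of n k] wt2 by (simp add: genus)
    thus ?thesis
      by (simp add: k_def)
  qed
  show ?thesis
  proof (rule c.form_imp_principal[OF \<kappa>_pts[OF P] \<kappa>_pts[OF S] AB2])
    fix Q
    assume Q: "Q \<in> curve_points (\<kappa> d) (map_poly \<kappa> f)"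
    show "int n * of_bool (Q = map_curve_point \<kappa> P) + int n * of_bool (Q = curve_conj (map_curve_point \<kappa> S))
        \<le> c.val Q [:A2, B2:] + int n * pole_order Q"
    proof (cases "\<exists>R\<in>curve_points d f. Q = map_curve_point \<kappa> R")
      case True
      then obtain R where R: "R \<in> curve_points d f" "Q = map_curve_point \<kappa> R"
        by blast
      have "Q = map_curve_point \<kappa> P \<longleftrightarrow> R = P" "Q = curve_conj (map_curve_point \<kappa> S) \<longleftrightarrow> R = curve_conj S"
        unfolding R conj_map(2)[symmetric] using inj_eq[OF curve_point.inj_map[OF inj(2)]] by auto
      thus ?thesis
        using key[OF R(1)] R(2) by simp
    next
      case False
      hence "Q \<noteq> map_curve_point \<kappa> P" "Q \<noteq> curve_conj (map_curve_point \<kappa> S)"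
        using P conj_pts[OF S] conj_map by metis+
      moreover have "0 \<le> c.val Q [:A2, B2:] + int n * pole_order Q"
        using c.form_ord_val[OF Q _ ndvd, of n] wt2 by (simp add: genus)
      ultimately show ?thesis
        by simp
    qed
  qed
qed

section \<open>A relation between differentials\<close>

lemma prod_power_dvd_of_order:
  fixes p :: "'k::field poly"
  assumes "finite I" "inj_on x I" "p \<noteq> 0" "\<And>i. i \<in> I \<Longrightarrow> k i \<le> order (x i) p"
  shows "(\<Prod>i\<in>I. [:- x i, 1:] ^ k i) dvd p"
  using assms
proof (induction I arbitrary: p rule: finite_induct)
  case (insert a I)
  have "[:- x a, 1:] ^ k a dvd p"
    using insert.prems(2,3) by (simp add: order_divides)
  then obtain q where q: "p = [:- x a, 1:] ^ k a * q"
    by (elim dvdE)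
  have "q \<noteq> 0"
    using q insert.prems(2) by auto
  have "k i \<le> order (x i) q" if i: "i \<in> I" for i
  proof -
    have "x i \<noteq> x a"
      using insert.prems(1) insert.hyps(2) i by (auto simp: inj_on_def)
    hence "order (x i) ([:- x a, 1:] ^ k a) = 0"
      by (intro order_0I) simp
    hence "order (x i) p = order (x i) q"
      unfolding q using insert.prems(2) q by (subst order_mult) auto
    thus ?thesis
      using insert.prems(3)[of i] i by simp
  qed
  hence "(\<Prod>i\<in>I. [:- x i, 1:] ^ k i) dvd q"
    using insert.IH[of q] insert.prems(1) \<open>q \<noteq> 0\<close> by simp
  thus ?case
    unfolding q using insert.hyps by (simp add: mult_dvd_mono del: mult_pCons_left)
qed auto

lemma degree_prod_linear:
  fixes x :: "'i \<Rightarrow> 'k::field"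
  assumes "finite I"
  shows "degree (\<Prod>i\<in>I. [:- x i, 1:] ^ k i) = sum k I"
    and "lead_coeff (\<Prod>i\<in>I. [:- x i, 1:] ^ k i) = 1"
proof -
  show "degree (\<Prod>i\<in>I. [:- x i, 1:] ^ k i) = sum k I"
    by (subst degree_prod_eq_sum_degree) (auto simp: degree_linear_power)
  show "lead_coeff (\<Prod>i\<in>I. [:- x i, 1:] ^ k i) = 1"
    by (simp add: lead_coeff_prod lead_coeff_power)
qed

text \<open>The sum is the coefficient of degree \<open>card I\<close> - 1 in the interpolation
  polynomial of p, which is p itself and has smaller degree. Equivalently, the residues of p /
  \<Prod> (x - x_i) add up to 0 when there is none at infinity.\<close>

lemma lagrange_sum_eq_0:
  fixes x :: "'i \<Rightarrow> 'k::field"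
  assumes I: "finite I" and inj: "inj_on x I" and deg: "degree p + 2 \<le> card I"
  shows "(\<Sum>i\<in>I. poly p (x i) / (\<Prod>j\<in>I - {i}. x i - x j)) = 0"
proof -
  define q where "q i = (\<Prod>j\<in>I - {i}. [:- x j, 1:] ^ 1)" for i
  have deg_q: "degree (q i) = card I - 1" and lc_q: "coeff (q i) (card I - 1) = 1" if "i \<in> I" for i
    using degree_prod_linear[of "I - {i}" x "\<lambda>_. 1"] I that by (simp_all add: q_def)
  have poly_q: "poly (q i) z = (\<Prod>j\<in>I - {i}. z - x j)" for i z
    by (simp add: q_def poly_prod algebra_simps)
  have q_nz: "poly (q i) (x i) \<noteq> 0" if "i \<in> I" for i
    unfolding poly_q using that I inj by (auto simp: inj_on_def)
  have q_0: "poly (q i) (x k) = 0" if "i \<in> I" "k \<in> I" "k \<noteq> i" for i k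
    unfolding poly_q using that I by auto
  define r where "r = (\<Sum>i\<in>I. smult (poly p (x i) / poly (q i) (x i)) (q i))"
  have "poly r (x k) = poly p (x k)" if "k \<in> I" for k
  proof -
    have "poly r (x k) = (\<Sum>i\<in>{k}. poly p (x i) / poly (q i) (x i) * poly (q i) (x k))"
      unfolding r_def poly_sum poly_smult using that I q_0 by (intro sum.mono_neutral_right) auto
    thus ?thesis
      using q_nz[OF that] by simp
  qed
  moreover have "degree r \<le> card I - 1"
    unfolding r_def using I deg_q by (intro degree_sum_le) (auto intro: order.trans[OF degree_smult_le])
  ultimately have "r = p"
    using deg card_image[OF inj] by (intro poly_eqI_degree[of "x ` I"]) auto
  have "(\<Sum>i\<in>I. poly p (x i) / (\<Prod>j\<in>I - {i}. x i - x j)) = coeff r (card I - 1)"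
    unfolding r_def coeff_sum using lc_q by (intro sum.cong) (auto simp: poly_q)
  also have "\<dots> = 0"
    unfolding \<open>r = p\<close> using deg by (intro coeff_eq_0) simp
  finally show ?thesis .
qed

text \<open>The degree bound makes constants go to constants and controls the behaviour at
  infinity.\<close>

locale poly_derivation =
  fixes \<theta> :: "'k::field_char_0 poly \<Rightarrow> 'k poly"
  assumes add: "\<theta> (p + q) = \<theta> p + \<theta> q"
    and mult: "\<theta> (p * q) = p * \<theta> q + q * \<theta> p"
    and degree_le: "degree (\<theta> p) \<le> degree p"
begin

lemma one: "\<theta> 1 = 0"
  using mult[of 1 1] by simp

lemma diff: "\<theta> (p - q) = \<theta> p - \<theta> q"
  using add[of "p - q" q] by simp

lemma const: "\<exists>c'. \<theta> [:c:] = [:c':]"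
  using degree_le[of "[:c:]"] by (metis degree_eq_zeroE degree_pCons_0 le_zero_eq)

lemma power: "\<theta> (p ^ Suc n) = of_nat (Suc n) * p ^ n * \<theta> p"
  by (induction n) (auto simp: mult algebra_simps)

text \<open>The logarithmic derivative \<Sum> n_i \<theta>(p_i) / p_i with denominators cleared. The
  factor in front is common to the product and its derivative.\<close>

lemma prod_power:
  assumes "finite I" "\<And>i. i \<in> I \<Longrightarrow> n i > 0"
  shows "\<theta> (\<Prod>i\<in>I. p i ^ n i) = (\<Prod>i\<in>I. p i ^ (n i - 1)) *
    (\<Sum>i\<in>I. of_nat (n i) * \<theta> (p i) * (\<Prod>j\<in>I - {i}. p j))"
  using assms
proof (induction I rule: finite_induct)
  case (insert a I)
  obtain k where k: "n a = Suc k"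
    using insert.prems[of a] gr0_conv_Suc by auto
  have split: "(\<Prod>i\<in>I. p i ^ n i) = (\<Prod>i\<in>I. p i ^ (n i - 1)) * (\<Prod>i\<in>I. p i)"
    unfolding prod.distrib[symmetric]
    using insert.prems by (intro prod.cong refl) (metis insertCI mult.commute power_eq_if not_gr0)
  have "(\<Sum>i\<in>I. of_nat (n i) * \<theta> (p i) * (\<Prod>j\<in>insert a I - {i}. p j)) =
      p a * (\<Sum>i\<in>I. of_nat (n i) * \<theta> (p i) * (\<Prod>j\<in>I - {i}. p j))"
    unfolding sum_distrib_left
  proof (intro sum.cong refl)
    fix i
    assume "i \<in> I"
    hence "insert a I - {i} = insert a (I - {i})"
      using insert.hyps by auto
    thus "of_nat (n i) * \<theta> (p i) * (\<Prod>j\<in>insert a I - {i}. p j) =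
        p a * (of_nat (n i) * \<theta> (p i) * (\<Prod>j\<in>I - {i}. p j))"
      using insert.hyps by simp
  qed
  moreover have "insert a I - {a} = I"
    using insert.hyps by auto
  ultimately have sum: "(\<Sum>i\<in>insert a I. of_nat (n i) * \<theta> (p i) * (\<Prod>j\<in>insert a I - {i}. p j)) =
      of_nat (n a) * \<theta> (p a) * prod p I + p a * (\<Sum>i\<in>I. of_nat (n i) * \<theta> (p i) * (\<Prod>j\<in>I - {i}. p j))"
    using insert.hyps by simp
  have IH: "\<theta> (\<Prod>i\<in>I. p i ^ n i) = (\<Prod>i\<in>I. p i ^ (n i - 1)) *
    (\<Sum>i\<in>I. of_nat (n i) * \<theta> (p i) * (\<Prod>j\<in>I - {i}. p j))"
    using insert by simp
  have "\<theta> (\<Prod>i\<in>insert a I. p i ^ n i) = \<theta> (p a ^ Suc k * (\<Prod>i\<in>I. p i ^ n i))"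
    using insert.hyps k by simp
  also have "\<dots> = p a ^ Suc k * \<theta> (\<Prod>i\<in>I. p i ^ n i) + (\<Prod>i\<in>I. p i ^ n i) * \<theta> (p a ^ Suc k)"
    by (rule mult)
  also have "\<dots> = (p a ^ k * (\<Prod>i\<in>I. p i ^ (n i - 1))) *
     (of_nat (n a) * \<theta> (p a) * prod p I + p a * (\<Sum>i\<in>I. of_nat (n i) * \<theta> (p i) * (\<Prod>j\<in>I - {i}. p j)))"
    unfolding IH power k unfolding split by (simp add: algebra_simps)
  also have "p a ^ k * (\<Prod>i\<in>I. p i ^ (n i - 1)) = (\<Prod>i\<in>insert a I. p i ^ (n i - 1))"
    using insert.hyps k by simp
  finally show ?case
    unfolding sum .
qed (simp add: one)

text \<open>
  If \<open>h = A + B y\<close> has divisor \<open>\<Sum> n\<^sub>i P\<^sub>i - n \<infinity>\<close> on \<open>y\<^sup>2 = F\<close>, then the \<open>y\<close>-part of the logarithmic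
  derivative \<open>\<theta> h / h\<close> has simple poles at the \<open>x\<^sub>i\<close>, with residues proportional to \<open>n\<^sub>i / y\<^sub>i\<close>, and
  vanishes to order at least two at infinity. The sum of the residues is therefore zero.
\<close>

lemma residue_sum:
  assumes F: "\<theta> F = smult \<mu> F" "degree F \<ge> 3"
    and I: "finite I" "inj_on x I" "\<And>i. i \<in> I \<Longrightarrow> n i > 0"
    and norm: "A ^ 2 - B ^ 2 * F = smult c (\<Prod>i\<in>I. [:- x i, 1:] ^ n i)" and c: "c \<noteq> 0"
    and at: "\<And>i. i \<in> I \<Longrightarrow> poly A (x i) = - poly B (x i) * y i" "\<And>i. i \<in> I \<Longrightarrow> poly A (x i) \<noteq> 0"
    and deg: "2 * degree A \<le> sum n I" "B \<noteq> 0 \<Longrightarrow> 2 * degree B + degree F \<le> sum n I"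
  shows "(\<Sum>i\<in>I. of_nat (n i) * poly (\<theta> [:- x i, 1:]) (x i) / y i) = 0"
proof (cases "I = {}")
  case False
  define p where "p i = [:- x i, 1:]" for i
  define \<Pi>0 where "\<Pi>0 = (\<Prod>i\<in>I. p i ^ (n i - 1))"
  define \<Pi>1 where "\<Pi>1 = (\<Prod>i\<in>I. p i)"
  define \<Sigma> where "\<Sigma> = (\<Sum>i\<in>I. of_nat (n i) * \<theta> (p i) * (\<Prod>j\<in>I - {i}. p j))"
  have \<Pi>: "(\<Prod>i\<in>I. p i ^ n i) = \<Pi>0 * \<Pi>1"
    unfolding \<Pi>0_def \<Pi>1_def prod.distrib[symmetric]
    using I(3) by (intro prod.cong refl) (metis mult.commute power_eq_if not_gr0)
  define N where "N = A ^ 2 - B ^ 2 * F"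
  have N: "N = [:c:] * (\<Pi>0 * \<Pi>1)"
    unfolding N_def norm \<Pi>[symmetric] p_def by simp
  obtain c' where c': "\<theta> [:c:] = [:c':]"
    using const by blast
  have \<theta>N: "\<theta> N = \<Pi>0 * ([:c':] * \<Pi>1 + [:c:] * \<Sigma>)"
  proof -
    have "\<theta> N = [:c:] * \<theta> (\<Pi>0 * \<Pi>1) + (\<Pi>0 * \<Pi>1) * \<theta> [:c:]"
      unfolding N by (rule mult)
    also have "\<theta> (\<Pi>0 * \<Pi>1) = \<Pi>0 * \<Sigma>"
      using prod_power[OF I(1), of n p] I(3) unfolding \<Pi> by (simp add: \<Pi>0_def \<Sigma>_def)
    finally show ?thesis
      unfolding c' by (simp only: algebra_simps)
  qed
  \<comment> \<open>With \<theta> y = (\<open>\<mu>\<close> / 2) y, this is twice the coefficient of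
    y in \<theta>(A + B y) (A - B y), that is, of the logarithmic derivative multiplied by the norm
    \<open>N\<close>.\<close>
  define S where "S = [:2:] * (A * \<theta> B - B * \<theta> A) + [:\<mu>:] * (A * B)"
  have \<theta>N': "\<theta> N = [:2:] * A * \<theta> A - [:2:] * B * \<theta> B * F - B ^ 2 * ([:\<mu>:] * F)"
  proof -
    have two: "[:2:] * q = q + q" for q :: "'k poly"
      unfolding numeral_poly[symmetric] by (rule mult_2)
    have "\<theta> N = \<theta> (A * A) - \<theta> (B * B * F)"
      unfolding N_def power2_eq_square diff ..
    also have "\<dots> = [:2:] * A * \<theta> A - [:2:] * B * \<theta> B * F - B ^ 2 * ([:\<mu>:] * F)"
      unfolding mult F(1) mult.assoc two by (simp add: algebra_simps power2_eq_square)
    finally show ?thesis .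
  qed
  \<comment> \<open>Multiplication by A expresses S through \<open>N\<close> and its derivative,
    both divisible by \<open>\<Pi>0\<close>. Since A does not vanish at the x_i, the factor
    \<open>\<Pi>0\<close> then divides S, and only simple poles remain.\<close>
  have AS: "A * S = N * ([:2:] * \<theta> B + [:\<mu>:] * B) - B * \<theta> N"
    unfolding \<theta>N' unfolding S_def N_def power2_eq_square by (simp only: algebra_simps)
  also have "\<dots> = \<Pi>0 * ([:c:] * \<Pi>1 * ([:2:] * \<theta> B + [:\<mu>:] * B) - B * ([:c':] * \<Pi>1 + [:c:] * \<Sigma>))"
    unfolding \<theta>N unfolding N by (simp only: algebra_simps)
  finally have AS': "A * S = \<Pi>0 * ([:c:] * \<Pi>1 * ([:2:] * \<theta> B + [:\<mu>:] * B) - B * ([:c':] * \<Pi>1 + [:c:] * \<Sigma>))" .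
  have \<Pi>0_nz: "\<Pi>0 \<noteq> 0"
    using I by (simp add: \<Pi>0_def p_def)
  have A_nz: "A \<noteq> 0" and B_nz: "B \<noteq> 0"
    using at False by force+
  have "\<Pi>0 dvd S"
  proof (cases "S = 0")
    case False
    have "n i - 1 \<le> order (x i) S" if i: "i \<in> I" for i
    proof -
      have "p i ^ (n i - 1) dvd \<Pi>0"
        unfolding \<Pi>0_def using I(1) i by (rule dvd_prodI)
      hence "p i ^ (n i - 1) dvd A * S"
        unfolding AS' by (rule dvd_mult2)
      hence "n i - 1 \<le> order (x i) (A * S)"
        using A_nz False unfolding p_def by (simp add: order_divides)
      also have "\<dots> = order (x i) A + order (x i) S"
        using A_nz False by (intro order_mult) simp
      finally show ?thesis
        using at(2)[OF i] by (simp add: order_0I)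
    qed
    thus ?thesis
      unfolding \<Pi>0_def p_def using I False by (intro prod_power_dvd_of_order) auto
  qed simp
  then obtain S0 where S0: "S = \<Pi>0 * S0"
    by (elim dvdE)
  have "\<Pi>0 * (A * S0) = \<Pi>0 * ([:c:] * \<Pi>1 * ([:2:] * \<theta> B + [:\<mu>:] * B) - B * ([:c':] * \<Pi>1 + [:c:] * \<Sigma>))"
    using AS' unfolding S0 by (simp only: mult.left_commute)
  hence AS0: "A * S0 = [:c:] * \<Pi>1 * ([:2:] * \<theta> B + [:\<mu>:] * B) - B * ([:c':] * \<Pi>1 + [:c:] * \<Sigma>)"
    using \<Pi>0_nz by (simp only: mult_cancel_left simp_thms)
  define Q where "Q i = (\<Prod>j\<in>I - {i}. x i - x j)" for i
  \<comment> \<open>At x_i the terms with \<open>\<Pi>1\<close> vanish, and A = - B y_i lets the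
    common factor B cancel.\<close>
  have main: "of_nat (n i) * poly (\<theta> (p i)) (x i) / y i = poly S0 (x i) / Q i / c" if i: "i \<in> I" for i
  proof -
    have \<Pi>1_0: "poly \<Pi>1 (x i) = 0"
      unfolding \<Pi>1_def poly_prod p_def using I(1) i by (intro prod_zero bexI[of _ i]) auto
    have "poly \<Sigma> (x i) = (\<Sum>k\<in>I. of_nat (n k) * poly (\<theta> (p k)) (x i) * (\<Prod>j\<in>I - {k}. x i - x j))"
      by (simp add: \<Sigma>_def poly_sum poly_prod p_def algebra_simps)
    also have "\<dots> = (\<Sum>k\<in>{i}. of_nat (n k) * poly (\<theta> (p k)) (x i) * (\<Prod>j\<in>I - {k}. x i - x j))"
      using I(1) i by (intro sum.mono_neutral_right) auto
    finally have \<Sigma>: "poly \<Sigma> (x i) = of_nat (n i) * poly (\<theta> (p i)) (x i) * Q i"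
      by (simp add: Q_def)
    have "poly (A * S0) (x i) = - poly B (x i) * (c * poly \<Sigma> (x i))"
      unfolding AS0 by (simp add: \<Pi>1_0)
    hence "y i * poly S0 (x i) = c * poly \<Sigma> (x i)"
      using at[OF i] by simp
    moreover have "Q i \<noteq> 0"
      unfolding Q_def using I i by (auto simp: inj_on_def)
    moreover have "y i \<noteq> 0"
      using at[OF i] by auto
    ultimately show ?thesis
      using c unfolding \<Sigma> by (simp add: field_simps)
  qed
  have "(\<Sum>i\<in>I. poly S0 (x i) / Q i) = 0"
  proof (cases "S0 = 0")
    case False
    have "S \<noteq> 0"
      using False S0 \<Pi>0_nz by simp
    have "degree S \<le> degree A + degree B"
    proof -
      have "degree (A * \<theta> B) \<le> degree A + degree B" "degree (B * \<theta> A) \<le> degree A + degree B"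
        using degree_mult_le[of A "\<theta> B"] degree_mult_le[of B "\<theta> A"] degree_le[of A] degree_le[of B]
        by linarith+
      thus ?thesis
        unfolding S_def using degree_mult_le[of A B]
        by (intro degree_add_le) (auto intro!: degree_diff_le order.trans[OF degree_smult_le])
    qed
    moreover have "degree S = degree \<Pi>0 + degree S0"
      unfolding S0 using \<Pi>0_nz False by (rule degree_mult_eq)
    moreover have "degree \<Pi>0 = (\<Sum>i\<in>I. n i - 1)"
      unfolding \<Pi>0_def p_def by (rule degree_prod_linear[OF I(1)])
    moreover have "(\<Sum>i\<in>I. n i - 1) + card I = sum n I"
    proof -
      have "(\<Sum>i\<in>I. n i - 1) + card I = (\<Sum>i\<in>I. (n i - 1) + 1)"
        by (simp only: sum.distrib) simp
      also have "\<dots> = sum n I"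
        using I(3) by (intro sum.cong) fastforce+
      finally show ?thesis .
    qed
    \<comment> \<open>The bounds give 2 deg S \<le> 2 (\<open>sum n I\<close>) - 3, and integrality
      improves this to deg S \<le> \<open>sum n I\<close> - 2. This is where degree at least 3 makes
      the differential regular at infinity.\<close>
    ultimately have "degree S0 + 2 \<le> card I"
      using deg(1) deg(2)[OF B_nz] F(2) by linarith
    thus ?thesis
      unfolding Q_def by (rule lagrange_sum_eq_0[OF I(1,2)])
  qed simp
  hence "(\<Sum>i\<in>I. poly S0 (x i) / Q i / c) = 0"
    by (simp only: sum_divide_distrib[symmetric] div_0)
  thus ?thesis
    using main by (simp add: p_def)
qed simp

end

section \<open>Relations between points on a curve with one point at infinity\<close>

interpretation to_ac: ring_morphism "to_ac :: 'k::field \<Rightarrow> 'k alg_closure"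
  by unfold_locales auto

declare to_ac.hom_add [simp del] to_ac.hom_mult [simp del] to_ac.hom_uminus [simp del]
  to_ac.hom_diff [simp del] to_ac.hom_power [simp del] to_ac.hom_0 [simp del] to_ac.hom_1 [simp del]

lemma map_poly_to_ac_eq_iff: "map_poly to_ac p = map_poly to_ac q \<longleftrightarrow> p = q"
  by (auto simp: poly_eq_iff)

lemma degree_map_poly_to_ac [simp]: "degree (map_poly to_ac p) = degree p"
  by (rule degree_map_poly) simp

lemma to_ac_in_points:
  assumes "Q \<in> curve_points d p"
  shows "map_curve_point to_ac Q \<in> curve_points (to_ac d) (map_poly to_ac p)"
proof -
  have "curve_genus (map_poly to_ac p) = curve_genus p"
    by (simp add: curve_genus_def)
  thus ?thesis
    using assms unfolding curve_points_def
    by (auto simp flip: to_ac.hom_poly to_ac_mult to_ac_power)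
qed

lemma Infinite_0_in_points: "odd (degree p) \<Longrightarrow> Infinite 0 \<in> curve_points d p"
  by (auto simp: curve_points_def curve_genus_def coeff_eq_0 elim!: oddE)

context hyperelliptic
begin

lemma val_affine_nonneg:
  assumes "Affine x y \<in> curve_points d f" "\<not> curve_eq d f dvd H"
  shows "val (Affine x y) H \<ge> 0"
proof -
  obtain N where "weight_le (curve_genus f) N H"
    using weight_le_exists by blast
  from form_ord_val[OF assms(1) this assms(2)] show ?thesis
    by simp
qed

lemma val_affine_eq_0_iff:
  assumes P: "Affine x y \<in> curve_points d f" and nz: "A \<noteq> 0 \<or> B \<noteq> 0"
  shows "val (Affine x y) [:A, B:] = 0 \<longleftrightarrow> poly A x + poly B x * y \<noteq> 0"
proof -
  obtain \<xi> \<eta> where e: "expansion d f (Affine x y) \<xi> \<eta>"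
    using expansion_exists[OF P] .
  then obtain a b where ab: "local_param d f x y a b" "\<xi> = fps_to_fls a" "\<eta> = fps_to_fls b"
    by auto
  have n: "\<not> curve_eq d f dvd [:A, B:]"
    using nz by (auto simp: linear_dvd_iff)
  have "eval2 fps_const a b [:A, B:] \<noteq> 0"
    using eval2_eq_0_iff[OF P e, of "[:A, B:]"] n unfolding ab(2,3) fps_to_fls_eval2[symmetric]
    by (simp only: fps_to_fls_eq_0_iff simp_thms)
  moreover have "fps_nth (eval2 fps_const a b [:A, B:]) 0 = poly A x + poly B x * y"
    using ab(1) by (simp add: fps_nth_poly_fps_const_0 local_param_def)
  moreover have "val (Affine x y) [:A, B:] = int (subdegree (eval2 fps_const a b [:A, B:]))"
    unfolding val_expansion[OF P e n] ab(2,3) fps_to_fls_eval2[symmetric]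
    by (rule fls_subdegree_fls_to_fps)
  ultimately show ?thesis
    by (simp add: subdegree_eq_0_iff)
qed

lemma principal_add:
  "D \<in> principal_divisors d f \<Longrightarrow> E \<in> principal_divisors d f \<Longrightarrow> D + E \<in> principal_divisors d f"
  using subgroup.m_closed[OF principal_divisors_subgroup, of D E] by (simp add: divisor_group_def)

lemma principal_zero: "0 \<in> principal_divisors d f"
  using subgroup.one_closed[OF principal_divisors_subgroup] by (simp add: divisor_group_def)

lemma principal_sum:
  "(\<And>i. i \<in> I \<Longrightarrow> D i \<in> principal_divisors d f) \<Longrightarrow> sum D I \<in> principal_divisors d f"
  by (induction I rule: infinite_finite_induct) (auto intro: principal_zero principal_add)

lemma principal_cmul_nat:
  "D \<in> principal_divisors d f \<Longrightarrow> frag_cmul (int n) D \<in> principal_divisors d f"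
  by (induction n) (auto simp: frag_cmul_distrib intro: principal_zero principal_add)

text \<open>For affine P this is the divisor of x - x(P). Since \<open>Infinite 0\<close> lies on
  the curve, it is the only point at infinity, and x has a double pole there.\<close>

lemma principal_fibre:
  assumes P: "P \<in> curve_points d f" and w: "Infinite 0 \<in> curve_points d f"
  shows "frag_of P + frag_of (curve_conj P) - frag_cmul 2 (frag_of (Infinite 0)) \<in> principal_divisors d f"
proof -
  have inf: "v = 0" if "Infinite v \<in> curve_points d f" for v
    using that w d_nonzero by (simp add: Infinite_in_points_iff)
  have "Poly_Mapping.keys (frag_of P + frag_of (curve_conj P) - frag_cmul 2 (frag_of (Infinite 0)))
      \<subseteq> {P, curve_conj P, Infinite 0}"
    using keys_diff[of "frag_of P + frag_of (curve_conj P)" "frag_cmul 2 (frag_of (Infinite 0))"]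
      keys_add[of "frag_of P" "frag_of (curve_conj P)"] keys_cmul[of 2 "frag_of (Infinite 0)"]
    by auto
  hence "frag_of P + frag_of (curve_conj P) - frag_cmul 2 (frag_of (Infinite 0)) \<in> carrier (divisor_group d f)"
    using P w by (auto simp: divisor_group_def)
  moreover have "Poly_Mapping.lookup (frag_of P + frag_of (curve_conj P) - frag_cmul 2 (frag_of (Infinite 0))) Q
      = val Q [:base_poly P:] - val Q [:1:]" if Q: "Q \<in> curve_points d f" for Q
  proof -
    have "val Q [:1:] = 0"
      using val_poly[OF Q, of 1] by (cases Q) simp_all
    moreover have "pole_order Q = 2 * of_bool (Q = Infinite 0)"
      using inf Q by (cases Q) auto
    moreover have "Poly_Mapping.lookup (frag_of P + frag_of (curve_conj P) -
        frag_cmul 2 (frag_of (Infinite 0))) Q =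
        of_bool (Q = P) + of_bool (Q = curve_conj P) - 2 * of_bool (Q = Infinite 0)"
      by (auto simp: lookup_add lookup_minus)
    ultimately show ?thesis
      using val_base_poly[OF P Q] by linarith
  qed
  moreover have "\<not> curve_eq d f dvd [:base_poly P:]" "\<not> curve_eq d f dvd [:1:]"
    by simp_all
  ultimately show ?thesis
    unfolding principal_divisors_iff by blast
qed

end

context poly_derivation
begin

text \<open>The function is given over the closure, whereas \<open>residue_sum\<close> needs A and B
  over the base field. A linear functional moves them there and keeps the zeros at the given points.
  Its norm is then divisible by \<Prod> (x - x_i)^(n_i) and has at most that degree, so it is a
  constant multiple of this product.\<close>

lemma points_relation_nat:
  fixes F :: "'k poly"
  assumes F: "\<theta> F = smult \<mu> F" "degree F \<ge> 3" "odd (degree F)"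
    and sqf: "rsquarefree (map_poly to_ac F)"
    and I: "finite I" "inj_on x I" "\<And>i. i \<in> I \<Longrightarrow> n i > 0"
    and on_curve: "\<And>i. i \<in> I \<Longrightarrow> y i ^ 2 = poly F (x i)" "\<And>i. i \<in> I \<Longrightarrow> y i \<noteq> 0"
    and principal: "(\<Sum>i\<in>I. frag_cmul (int (n i)) (frag_of (Affine (to_ac (x i)) (to_ac (y i))) -
        frag_of (Infinite 0))) \<in> principal_divisors 1 (map_poly to_ac F)"
  shows "(\<Sum>i\<in>I. of_nat (n i) * poly (\<theta> [:- x i, 1:]) (x i) / y i) = 0"
proof -
  define F' where "F' = map_poly to_ac F"
  interpret h: hyperelliptic "1 :: 'k alg_closure" F'
    using sqf F(2) by unfold_locales (auto simp: F'_def)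
  define P where "P i = Affine (to_ac (x i)) (to_ac (y i))" for i
  define D where "D = (\<Sum>i\<in>I. frag_cmul (int (n i)) (frag_of (P i) - frag_of (Infinite 0)))"
  have D: "D \<in> principal_divisors 1 F'"
    using principal by (simp add: D_def P_def F'_def)
  have P: "P i \<in> curve_points 1 F'" if "i \<in> I" for i
    using to_ac_in_points[of "Affine (x i) (y i)" 1 F] on_curve(1)[OF that]
    by (simp add: P_def F'_def curve_points_def)
  have "degree F' = degree F"
    by (simp add: F'_def)
  hence w: "Infinite 0 \<in> curve_points 1 F'"
    using F(3) by (intro Infinite_0_in_points) simp
  have P_eq_iff: "P i = P j \<longleftrightarrow> i = j" if "i \<in> I" "j \<in> I" for i j
    using I(2) that by (auto simp: P_def inj_on_def)
  have lookup: "Poly_Mapping.lookup D Q = (\<Sum>i\<in>I. int (n i) * of_bool (Q = P i)) -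
      of_bool (Q = Infinite 0) * int (sum n I)" for Q
    by (simp add: D_def lookup_sum lookup_minus of_bool_def right_diff_distrib sum_subtractf sum_distrib_left mult.commute)
  have lookup_P: "Poly_Mapping.lookup D (P i) = int (n i)" if i: "i \<in> I" for i
  proof -
    have "(\<Sum>j\<in>I. int (n j) * of_bool (P i = P j)) = (\<Sum>j\<in>{i}. int (n j) * of_bool (P i = P j))"
      using i I(1) P_eq_iff by (intro sum.mono_neutral_right) auto
    thus ?thesis
      unfolding lookup by (simp add: P_def)
  qed
  obtain A B where AB: "A \<noteq> 0 \<or> B \<noteq> 0"
    and val: "\<And>Q. Q \<in> curve_points 1 F' \<Longrightarrow> h.val Q [:A, B:] = Poly_Mapping.lookup D Q + h.val Q [:1:]"
  proof (rule h.principal_divisor_polynomial[OF D one_neq_zero])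
    fix a b
    assume "Affine a b \<in> curve_points 1 F'"
    thus "Poly_Mapping.lookup D (Affine a b) + h.val (Affine a b) [:1:] \<ge> 0"
      unfolding lookup by (simp add: h.val_poly sum_nonneg)
  qed blast
  have val_1: "h.val Q [:1:] = 0" if "Q \<in> curve_points 1 F'" for Q
    using h.val_poly[OF that, of 1] by (cases Q) simp_all
  have "h.val (Infinite 0) [:A, B:] = - int (sum n I)"
    using val[OF w] val_1[OF w] unfolding lookup by (simp add: P_def)
  hence "h.val (Infinite 0) [:A, B:] \<ge> - int (sum n I)"
    "h.val (curve_conj (Infinite 0)) [:A, B:] \<ge> - int (sum n I)"
    by simp_all
  note bounds = h.val_linear_ge[OF w this]
  have deg: "2 * degree A \<le> sum n I" "B \<noteq> 0 \<Longrightarrow> 2 * degree B + degree F \<le> sum n I"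
  proof -
    show "2 * degree A \<le> sum n I"
    proof (cases "A = 0")
      case False
      from bounds(1)[OF this] have "- int (sum n I) \<le> 2 * - int (degree A)"
        by (simp only: ramification.simps base_order.simps if_True simp_thms)
      thus ?thesis
        by linarith
    qed simp
    assume "B \<noteq> 0"
    from bounds(2)[OF this]
    have "2 * - int (sum n I) \<le> 2 * 2 * - int (degree B) + 2 * - int (degree F')"
      by (simp only: ramification.simps base_order.simps if_True simp_thms)
    thus "2 * degree B + degree F \<le> sum n I"
      using \<open>degree F' = degree F\<close> by linarith
  qed
  obtain z where z: "z \<noteq> 0" "z = lead_coeff A \<or> z = lead_coeff B"
    using AB by (metis leading_coeff_0_iff)
  obtain l where l: "\<And>a b. l (a + b) = l a + l b" "\<And>q a. l (to_ac q * a) = q * l a" "l z = 1"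
    using linear_functional_exists[OF to_ac.ring_morphism_axioms z(1)] by blast
  define \<Lambda> where "\<Lambda> a = to_ac (l a)" for a
  interpret sl: semilinear to_ac to_ac \<Lambda>
    by unfold_locales (auto simp: \<Lambda>_def l)
  have l_0: "l 0 = 0"
    using l(1)[of 0 0] by simp
  define A2 B2 where "A2 = map_poly l A" and "B2 = map_poly l B"
  \<comment> \<open>The descended form is viewed over the closure again, since valuations are
    available only there.\<close>
  define A3 B3 where "A3 = map_poly to_ac A2" and "B3 = map_poly to_ac B2"
  have AB3': "A3 = map_poly \<Lambda> A" "B3 = map_poly \<Lambda> B"
    by (auto simp: A3_def B3_def A2_def B2_def \<Lambda>_def poly_eq_iff coeff_map_poly l_0)
  have AB2: "A2 \<noteq> 0 \<or> B2 \<noteq> 0"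
    using z l(3) by (metis A2_def B2_def coeff_0 coeff_map_poly l_0 zero_neq_one)
  hence AB3: "A3 \<noteq> 0 \<or> B3 \<noteq> 0"
    unfolding A3_def B3_def by (metis map_poly_0 map_poly_to_ac_eq_iff)
  have ndvd: "\<not> curve_eq 1 F' dvd [:A3, B3:]" "\<not> curve_eq 1 F' dvd [:A3, - B3:]"
      "\<not> curve_eq 1 F' dvd [:A, B:]"
    using AB AB3 by (auto simp: h.linear_dvd_iff)
  have deg2: "2 * degree A2 \<le> sum n I" "B2 \<noteq> 0 \<Longrightarrow> 2 * degree B2 + degree F \<le> sum n I"
  proof -
    show "2 * degree A2 \<le> sum n I"
      using deg(1) map_poly_degree_leq[of l A] unfolding A2_def by linarith
    assume "B2 \<noteq> 0"
    hence "B \<noteq> 0"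
      by (auto simp: B2_def)
    from deg(2)[OF this] show "2 * degree B2 + degree F \<le> sum n I"
      using map_poly_degree_leq[of l B] unfolding B2_def by linarith
  qed
  have val_P: "h.val (P i) [:A3, B3:] \<ge> int (n i)" if i: "i \<in> I" for i
  proof -
    obtain N1 N2 where "weight_le (curve_genus F') N1 [:A, B:]" "weight_le (curve_genus F') N2 [:A3, B3:]"
      using h.weight_le_exists by blast
    hence wt: "weight_le (curve_genus F') (max N1 N2) [:A, B:]" "weight_le (curve_genus F') (max N1 N2) [:A3, B3:]"
      using h.weight_le_mono by (meson max.cobounded1 max.cobounded2)+
    have pole: "pole_order (P i) = 0"
      by (simp add: P_def)
    have "h.val (P i) [:A, B:] = int (n i)"
      using val[OF P[OF i]] val_1[OF P[OF i]] lookup_P[OF i] by simp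
    hence "form_vanishes 1 F' (max N1 N2) (n i) [:A, B:] (P i)"
      using h.form_vanishes_iff[OF P[OF i] wt(1) ndvd(3), of "n i"] pole by simp
    hence "form_vanishes (to_ac 1) (map_poly to_ac F) (max N1 N2) (n i) [:A, B:]
        (map_curve_point to_ac (Affine (x i) (y i)))"
      by (simp add: F'_def P_def)
    from form_vanishes_semilinear[OF sl.semilinear_axioms this]
    have "form_vanishes 1 F' (max N1 N2) (n i) [:A3, B3:] (P i)"
      by (simp add: F'_def P_def AB3')
    thus ?thesis
      using h.form_vanishes_iff[OF P[OF i] wt(2) ndvd(1), of "n i"] pole by simp
  qed
  define M where "M = A2 ^ 2 - B2 ^ 2 * F"
  have M: "map_poly to_ac M = h.norm_poly A3 B3"
  proof -
    interpret m: ring_morphism "map_poly to_ac"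
      by (rule to_ac.map_poly_morphism)
    show ?thesis
      unfolding h.norm_poly_def by (simp add: M_def A3_def B3_def F'_def)
  qed
  have M_nz: "map_poly to_ac M \<noteq> 0"
    unfolding M by (rule h.norm_poly_nonzero[OF AB3])
  have order_M: "int (order (to_ac (x i)) (map_poly to_ac M)) =
      h.val (P i) [:A3, B3:] + h.val (P i) [:A3, - B3:]" if i: "i \<in> I" for i
    using h.val_norm_poly[OF P[OF i] AB3] h.val_poly[OF P[OF i] M_nz] on_curve(2)[OF i]
    unfolding M[symmetric] by (simp add: P_def)
  have nonneg: "h.val (P i) [:A3, - B3:] \<ge> 0" if "i \<in> I" for i
    using h.val_affine_nonneg[OF P[OF that, unfolded P_def] ndvd(2)] by (simp add: P_def)
  have order_ge: "n i \<le> order (to_ac (x i)) (map_poly to_ac M)" if i: "i \<in> I" for i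
    using order_M[OF i] nonneg[OF i] val_P[OF i] by linarith
  define \<pi> where "\<pi> = (\<Prod>i\<in>I. [:- x i, 1:] ^ n i)"
  have \<pi>': "map_poly to_ac \<pi> = (\<Prod>i\<in>I. [:- to_ac (x i), 1:] ^ n i)"
  proof -
    interpret m: ring_morphism "map_poly to_ac"
      by (rule to_ac.map_poly_morphism)
    have "map_poly to_ac (prod g J) = (\<Prod>i\<in>J. map_poly to_ac (g i))" for g :: "'a \<Rightarrow> 'k poly" and J
      by (induction J rule: infinite_finite_induct) auto
    thus ?thesis
      by (simp add: \<pi>_def)
  qed
  have "map_poly to_ac \<pi> dvd map_poly to_ac M"
    unfolding \<pi>' using I order_ge M_nz
    by (intro prod_power_dvd_of_order) (auto simp: inj_on_def)
  then obtain q where q: "map_poly to_ac M = map_poly to_ac \<pi> * q"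
    by (elim dvdE)
  have deg_\<pi>: "degree \<pi> = sum n I" "lead_coeff \<pi> = 1"
    unfolding \<pi>_def by (rule degree_prod_linear[OF I(1)])+
  have deg_M: "degree M \<le> sum n I"
  proof -
    have "degree (B2 ^ 2 * F) \<le> sum n I"
    proof (cases "B2 = 0")
      case False
      thus ?thesis
        using deg2(2) F(2) by (subst degree_mult_eq) (auto simp: degree_power_eq)
    qed simp
    moreover have "degree (A2 ^ 2) \<le> sum n I"
      using deg2(1) degree_power_le[of A2 2] by (simp add: mult.commute)
    ultimately show ?thesis
      unfolding M_def by (intro degree_diff_le)
  qed
  have "degree q = 0"
  proof -
    have "degree (map_poly to_ac M) = degree (map_poly to_ac \<pi>) + degree q"
      unfolding q using M_nz q by (intro degree_mult_eq) auto
    thus ?thesis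
      using deg_M deg_\<pi> by simp
  qed
  then obtain c' where c': "q = [:c':]"
    by (metis degree_eq_zeroE)
  have c'_nz: "c' \<noteq> 0"
    using q M_nz c' by auto
  have "coeff (map_poly to_ac M) (sum n I) = to_ac (coeff \<pi> (sum n I)) * c'"
    unfolding q c' by simp
  hence c'_eq: "c' = to_ac (coeff M (sum n I))"
    using deg_\<pi> by simp
  define c where "c = coeff M (sum n I)"
  have c: "c \<noteq> 0"
    using c'_nz c'_eq by (auto simp: c_def)
  have "map_poly to_ac M = map_poly to_ac (smult c \<pi>)"
    unfolding q c' c'_eq c_def[symmetric] by (simp add: poly_eq_iff mult.commute)
  hence norm: "A2 ^ 2 - B2 ^ 2 * F = smult c \<pi>"
    unfolding map_poly_to_ac_eq_iff M_def .
  have at: "poly A2 (x i) = - poly B2 (x i) * y i \<and> poly A2 (x i) \<noteq> 0" if i: "i \<in> I" for i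
  proof -
    define r where "r = (\<Prod>j\<in>I - {i}. [:- to_ac (x j), 1:] ^ n j)"
    have "map_poly to_ac \<pi> = [:- to_ac (x i), 1:] ^ n i * r"
      unfolding \<pi>' r_def using I(1) i by (rule prod.remove)
    hence eq: "map_poly to_ac M = [:- to_ac (x i), 1:] ^ n i * (r * q)"
      unfolding q by (simp only: mult.assoc)
    have "poly (r * q) (to_ac (x i)) \<noteq> 0"
      unfolding r_def poly_mult poly_prod using I i c'_nz by (auto simp: inj_on_def c')
    hence "order (to_ac (x i)) (map_poly to_ac M) = n i"
      using M_nz unfolding eq by (subst order_mult) (auto simp: order_power_n_n order_0I)
    \<comment> \<open>The form at P i already uses up the whole order n i of the norm, so its
      conjugate does not vanish there. From A + B y = 0 and A - B y nonzero it follows that A is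
      nonzero.\<close>
    hence "h.val (P i) [:A3, - B3:] = 0" "h.val (P i) [:A3, B3:] \<noteq> 0"
      using order_M[OF i] nonneg[OF i] val_P[OF i] I(3)[OF i] by linarith+
    hence "poly A3 (to_ac (x i)) - poly B3 (to_ac (x i)) * to_ac (y i) \<noteq> 0"
      "poly A3 (to_ac (x i)) + poly B3 (to_ac (x i)) * to_ac (y i) = 0"
      using h.val_affine_eq_0_iff[OF P[OF i, unfolded P_def] AB3]
        h.val_affine_eq_0_iff[OF P[OF i, unfolded P_def], of A3 "- B3"] AB3 by (auto simp: P_def)
    hence "poly A2 (x i) - poly B2 (x i) * y i \<noteq> 0" "poly A2 (x i) + poly B2 (x i) * y i = 0"
      unfolding A3_def B3_def to_ac.hom_poly[symmetric]
      by (auto simp flip: to_ac_mult to_ac_add to_ac_diff)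
    thus ?thesis
      by (auto simp: eq_neg_iff_add_eq_0)
  qed
  show ?thesis
    using residue_sum[OF F(1,2) I norm[unfolded \<pi>_def] c _ _ deg2, of y] at by blast
qed

text \<open>Negative coefficients are made positive with \<open>P + P' \<sim> 2\<infinity>\<close>, where \<open>P'\<close> is the conjugate of \<open>P\<close>.\<close>

lemma points_relation:
  fixes F :: "'k poly" and n :: "'i \<Rightarrow> int"
  assumes F: "\<theta> F = smult \<mu> F" "degree F \<ge> 3" "odd (degree F)"
    and sqf: "rsquarefree (map_poly to_ac F)"
    and I: "finite I" "inj_on x I"
    and on_curve: "\<And>i. i \<in> I \<Longrightarrow> y i ^ 2 = poly F (x i)" "\<And>i. i \<in> I \<Longrightarrow> y i \<noteq> 0"
    and principal: "(\<Sum>i\<in>I. frag_cmul (n i) (frag_of (Affine (to_ac (x i)) (to_ac (y i))) -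
        frag_of (Infinite 0))) \<in> principal_divisors 1 (map_poly to_ac F)"
  shows "(\<Sum>i\<in>I. of_int (n i) * poly (\<theta> [:- x i, 1:]) (x i) / y i) = 0"
proof -
  define F' where "F' = map_poly to_ac F"
  interpret h: hyperelliptic "1 :: 'k alg_closure" F'
    using sqf F(2) by unfold_locales (auto simp: F'_def)
  define P where "P i = Affine (to_ac (x i)) (to_ac (y i))" for i
  have P: "P i \<in> curve_points 1 F'" if "i \<in> I" for i
    using to_ac_in_points[of "Affine (x i) (y i)" 1 F] on_curve(1)[OF that]
    by (simp add: P_def F'_def curve_points_def)
  have "degree F' = degree F"
    by (simp add: F'_def)
  hence w: "Infinite 0 \<in> curve_points 1 F'"
    using F(3) by (intro Infinite_0_in_points) simp
  define y' where "y' i = (if n i < 0 then - y i else y i)" for i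
  define n' where "n' i = nat \<bar>n i\<bar>" for i
  define J where "J = {i \<in> I. n i \<noteq> 0}"
  define E where "E i = frag_cmul (int (nat (- n i)))
     (frag_of (P i) + frag_of (curve_conj (P i)) - frag_cmul 2 (frag_of (Infinite 0)))" for i
  have E: "E i \<in> principal_divisors 1 F'" if "i \<in> I" for i
    unfolding E_def by (intro h.principal_cmul_nat h.principal_fibre P[OF that] w)
  have term_eq: "frag_cmul (int (n' i)) (frag_of (Affine (to_ac (x i)) (to_ac (y' i))) - frag_of (Infinite 0)) =
      frag_cmul (n i) (frag_of (P i) - frag_of (Infinite 0)) + E i" for i
    by (rule poly_mapping_eqI)
       (auto simp: n'_def y'_def E_def P_def lookup_add lookup_minus algebra_simps)
  have "(\<Sum>i\<in>J. frag_cmul (int (n' i)) (frag_of (Affine (to_ac (x i)) (to_ac (y' i))) - frag_of (Infinite 0))) =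
    (\<Sum>i\<in>I. frag_cmul (int (n' i)) (frag_of (Affine (to_ac (x i)) (to_ac (y' i))) - frag_of (Infinite 0)))"
    unfolding J_def using I(1) by (intro sum.mono_neutral_left) (auto simp: n'_def)
  also have "\<dots> = (\<Sum>i\<in>I. frag_cmul (n i) (frag_of (P i) - frag_of (Infinite 0))) + sum E I"
    unfolding term_eq sum.distrib ..
  also have "\<dots> \<in> principal_divisors 1 F'"
    using principal h.principal_sum[OF E] by (intro h.principal_add) (simp_all add: P_def F'_def)
  finally have "(\<Sum>i\<in>J. of_nat (n' i) * poly (\<theta> [:- x i, 1:]) (x i) / y' i) = 0"
    unfolding F'_def using I on_curve
    by (intro points_relation_nat[OF F sqf])
       (auto simp: J_def n'_def y'_def inj_on_def)
  \<comment> \<open>\<open>n\<close> and \<open>y\<close> change sign together, so each term is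
    unchanged.\<close>
  also have "(\<Sum>i\<in>J. of_nat (n' i) * poly (\<theta> [:- x i, 1:]) (x i) / y' i) =
      (\<Sum>i\<in>I. of_int (n i) * poly (\<theta> [:- x i, 1:]) (x i) / y i)"
    unfolding J_def using I(1) by (intro sum.mono_neutral_cong_left) (auto simp: n'_def y'_def)
  finally show ?thesis .
qed

end

section \<open>Independence in the Picard group\<close>

context hyperelliptic
begin

lemma divisor_group_comm: "comm_group (divisor_group d f)"
  by (simp add: divisor_group_def abelian_free_Abelian_group)

lemma principal_divisors_normal: "principal_divisors d f \<lhd> divisor_group d f"
  using comm_group.subgroup_imp_normal[OF divisor_group_comm principal_divisors_subgroup] .

lemma picard_group_comm: "comm_group (picard_group d f)"
  unfolding picard_group_def
  by (rule comm_group.abelian_FactGroup[OF divisor_group_comm principal_divisors_subgroup])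

lemma divisor_class_hom: "divisor_class d f \<in> hom (divisor_group d f) (picard_group d f)"
  using normal.r_coset_hom_Mod[OF principal_divisors_normal]
  unfolding divisor_class_def[abs_def] picard_group_def .

lemma divisor_class_group_hom: "group_hom (divisor_group d f) (picard_group d f) (divisor_class d f)"
  using divisor_class_hom divisor_group_comm picard_group_comm
  by (simp add: group_hom_def group_hom_axioms_def comm_group_def)

lemma divisor_class_eq_one_iff:
  assumes "D \<in> carrier (divisor_group d f)"
  shows "divisor_class d f D = \<one>\<^bsub>picard_group d f\<^esub> \<longleftrightarrow> D \<in> principal_divisors d f"
proof -
  interpret G: comm_group "divisor_group d f"
    by (rule divisor_group_comm)
  have "\<one>\<^bsub>picard_group d f\<^esub> = principal_divisors d f"
    by (simp add: picard_group_def FactGroup_def)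
  thus ?thesis
    unfolding divisor_class_def
    using G.coset_join1[OF _ assms principal_divisors_subgroup]
      G.coset_join2[OF assms principal_divisors_subgroup] by metis
qed

lemma divisor_class_closed:
  "D \<in> carrier (divisor_group d f) \<Longrightarrow> divisor_class d f D \<in> carrier (picard_group d f)"
  using divisor_class_hom by (auto simp: hom_def)

lemma frag_cmul_closed:
  "D \<in> carrier (divisor_group d f) \<Longrightarrow> frag_cmul k D \<in> carrier (divisor_group d f)"
  using keys_cmul[of k D] by (auto simp: divisor_group_def)

lemma divisor_class_cmul:
  assumes "D \<in> carrier (divisor_group d f)"
  shows "divisor_class d f (frag_cmul k D) = divisor_class d f D [^]\<^bsub>picard_group d f\<^esub> k"
proof -
  interpret h: group_hom "divisor_group d f" "picard_group d f" "divisor_class d f"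
    by (rule divisor_class_group_hom)
  show ?thesis
    using h.hom_int_pow[OF assms, of k] assms by (simp add: divisor_group_def)
qed

lemma sum_closed:
  "(\<And>i. i \<in> I \<Longrightarrow> D i \<in> carrier (divisor_group d f)) \<Longrightarrow> sum D I \<in> carrier (divisor_group d f)"
  unfolding divisor_group_def by (rule sum_closed_free_Abelian_group) auto

lemma divisor_class_sum:
  assumes "finite I" "\<And>i. i \<in> I \<Longrightarrow> D i \<in> carrier (divisor_group d f)"
  shows "divisor_class d f (sum D I) = finprod (picard_group d f) (\<lambda>i. divisor_class d f (D i)) I"
  using assms
proof (induction I rule: finite_induct)
  case empty
  interpret h: group_hom "divisor_group d f" "picard_group d f" "divisor_class d f"
    by (rule divisor_class_group_hom)
  interpret Pic: comm_group "picard_group d f"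
    by (rule picard_group_comm)
  show ?case
    using h.hom_one by (simp add: divisor_group_def)
next
  case (insert a I)
  interpret h: group_hom "divisor_group d f" "picard_group d f" "divisor_class d f"
    by (rule divisor_class_group_hom)
  interpret Pic: comm_group "picard_group d f"
    by (rule picard_group_comm)
  have "divisor_class d f (D a + sum D I) =
      divisor_class d f (D a) \<otimes>\<^bsub>picard_group d f\<^esub> divisor_class d f (sum D I)"
    using h.hom_mult[of "D a" "sum D I"] insert.prems sum_closed[of I D] by (simp add: divisor_group_def)
  thus ?case
    using insert divisor_class_closed by (subst Pic.finprod_insert) (auto simp: Pi_def)
qed

text \<open>\<open>int_independent\<close> speaks of a set of classes, while the divisors form a
  family. Two indices with equal classes would give a relation with coefficients 1 and -1, so the
  family is injective and no class is lost in the set.\<close>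

lemma independent_classes:
  fixes D :: "'i \<Rightarrow> _"
  assumes I: "finite I" and D: "\<And>i. i \<in> I \<Longrightarrow> D i \<in> carrier (divisor_group d f)"
    and indep: "\<And>n :: 'i \<Rightarrow> int. (\<Sum>i\<in>I. frag_cmul (n i) (D i)) \<in> principal_divisors d f \<Longrightarrow>
      \<forall>i\<in>I. n i = 0"
  shows "int_independent (picard_group d f) ((\<lambda>i. divisor_class d f (D i)) ` I)"
    and "card ((\<lambda>i. divisor_class d f (D i)) ` I) = card I"
proof -
  interpret Pic: comm_group "picard_group d f"
    by (rule picard_group_comm)
  define c where "c i = divisor_class d f (D i)" for i
  have c: "c i \<in> carrier (picard_group d f)" if "i \<in> I" for i
    using D[OF that] divisor_class_closed by (simp add: c_def)
  have prod: "finprod (picard_group d f) (\<lambda>i. c i [^]\<^bsub>picard_group d f\<^esub> n i) I = \<one>\<^bsub>picard_group d f\<^esub>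
      \<Longrightarrow> \<forall>i\<in>I. n i = 0" for n :: "'i \<Rightarrow> int"
  proof -
    assume "finprod (picard_group d f) (\<lambda>i. c i [^]\<^bsub>picard_group d f\<^esub> n i) I = \<one>\<^bsub>picard_group d f\<^esub>"
    also have "finprod (picard_group d f) (\<lambda>i. c i [^]\<^bsub>picard_group d f\<^esub> n i) I =
       finprod (picard_group d f) (\<lambda>i. divisor_class d f (frag_cmul (n i) (D i))) I"
      using D c divisor_class_closed[OF frag_cmul_closed]
      by (intro Pic.finprod_cong) (auto simp: c_def divisor_class_cmul simp_implies_def)
    also have "\<dots> = divisor_class d f (\<Sum>i\<in>I. frag_cmul (n i) (D i))"
      using I D frag_cmul_closed by (intro divisor_class_sum[symmetric]) auto
    finally have "divisor_class d f (\<Sum>i\<in>I. frag_cmul (n i) (D i)) = \<one>\<^bsub>picard_group d f\<^esub>" .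
    moreover have "(\<Sum>i\<in>I. frag_cmul (n i) (D i)) \<in> carrier (divisor_group d f)"
      using D by (intro sum_closed frag_cmul_closed)
    ultimately show "\<forall>i\<in>I. n i = 0"
      using divisor_class_eq_one_iff indep by blast
  qed
  have inj: "inj_on c I"
  proof (rule inj_onI, rule ccontr)
    fix i j
    assume ij: "i \<in> I" "j \<in> I" "c i = c j" "i \<noteq> j"
    define n where "n k = (if k = i then 1 else if k = j then - 1 else 0 :: int)" for k
    have "finprod (picard_group d f) (\<lambda>k. c k [^]\<^bsub>picard_group d f\<^esub> n k) I =
        finprod (picard_group d f) (\<lambda>k. c k [^]\<^bsub>picard_group d f\<^esub> n k) {i, j}"
      using I ij c by (intro Pic.finprod_mono_neutral_cong_right) (auto simp: n_def)
    also have "\<dots> = c i [^]\<^bsub>picard_group d f\<^esub> (1 :: int) \<otimes>\<^bsub>picard_group d f\<^esub> c j [^]\<^bsub>picard_group d f\<^esub> (- 1 :: int)"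
      using ij c by (simp add: n_def)
    also have "\<dots> = \<one>\<^bsub>picard_group d f\<^esub>"
      using ij c by (simp add: Pic.int_pow_neg Pic.int_pow_1)
    finally have "\<forall>k\<in>I. n k = 0"
      by (rule prod)
    thus False
      using ij by (auto simp: n_def)
  qed
  show "card ((\<lambda>i. divisor_class d f (D i)) ` I) = card I"
    using card_image[OF inj] by (simp add: c_def)
  show "int_independent (picard_group d f) ((\<lambda>i. divisor_class d f (D i)) ` I)"
    unfolding int_independent_def c_def[symmetric]
  proof (intro conjI allI impI)
    show "finite (c ` I)"
      using I by simp
    fix n :: "('k curve_point \<Rightarrow>\<^sub>0 int) set \<Rightarrow> int"
    assume "finprod (picard_group d f) (\<lambda>b. b [^]\<^bsub>picard_group d f\<^esub> n b) (c ` I) = \<one>\<^bsub>picard_group d f\<^esub>"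
    moreover have "finprod (picard_group d f) (\<lambda>b. b [^]\<^bsub>picard_group d f\<^esub> n b) (c ` I) =
       finprod (picard_group d f) (\<lambda>i. c i [^]\<^bsub>picard_group d f\<^esub> n (c i)) I"
      using c inj by (intro Pic.finprod_reindex) auto
    ultimately show "\<forall>b\<in>c ` I. n b = 0"
      using prod[of "\<lambda>i. n (c i)"] by auto
  qed
qed

lemma independent_imp_nontorsion:
  assumes "int_independent (picard_group d f) B" "B \<subseteq> carrier (picard_group d f)"
    and "D \<in> carrier (divisor_group d f)" "divisor_class d f D \<in> B"
    and "frag_cmul k D \<in> principal_divisors d f"
  shows "k = 0"
proof -
  interpret Pic: comm_group "picard_group d f"
    by (rule picard_group_comm)
  define b where "b = divisor_class d f D"
  define n where "n a = (if a = b then k else 0)" for a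
  have B: "finite B"
    using assms(1) by (simp add: int_independent_def)
  have "finprod (picard_group d f) (\<lambda>a. a [^]\<^bsub>picard_group d f\<^esub> n a) B =
      finprod (picard_group d f) (\<lambda>a. a [^]\<^bsub>picard_group d f\<^esub> n a) {b}"
    using B assms(2,4) by (intro Pic.finprod_mono_neutral_cong_right) (auto simp: n_def b_def)
  also have "\<dots> = b [^]\<^bsub>picard_group d f\<^esub> k"
    using assms(2,4) by (auto simp: n_def b_def)
  also have "\<dots> = divisor_class d f (frag_cmul k D)"
    unfolding b_def by (rule divisor_class_cmul[OF assms(3), symmetric])
  also have "\<dots> = \<one>\<^bsub>picard_group d f\<^esub>"
    using assms(5) divisor_class_eq_one_iff[OF frag_cmul_closed[OF assms(3)]] by simp
  finally have "\<forall>a\<in>B. n a = 0"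
    using assms(1) unfolding int_independent_def by blast
  thus ?thesis
    using assms(4) by (auto simp: n_def b_def)
qed

lemma point_difference_closed:
  "P \<in> curve_points d f \<Longrightarrow> Q \<in> curve_points d f \<Longrightarrow> frag_of P - frag_of Q \<in> carrier (divisor_group d f)"
  using keys_diff[of "frag_of P" "frag_of Q"] by (auto simp: divisor_group_def)

text \<open>Forms describe natural multiples only, so a relation with a negative coefficient is
  inverted first.\<close>

lemma principal_of_abs:
  assumes "frag_cmul k D \<in> principal_divisors d f"
  shows "frag_cmul (int (nat \<bar>k\<bar>)) D \<in> principal_divisors d f"
proof (cases "k \<ge> 0")
  case False
  have "inv\<^bsub>divisor_group d f\<^esub> (frag_cmul k D) \<in> principal_divisors d f"
    using assms by (rule subgroup.m_inv_closed[OF principal_divisors_subgroup])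
  moreover have "frag_cmul k D \<in> carrier (divisor_group d f)"
    using assms by (simp add: principal_divisors_iff)
  ultimately show ?thesis
    using False by (simp add: divisor_group_def)
qed (use assms in simp)

end

lemma subgroup_rank_ge:
  assumes "B \<subseteq> S" "B \<subseteq> carrier G" "int_independent G B" "card B = n"
  shows "subgroup_rank G S \<ge> enat n"
  unfolding subgroup_rank_def using assms by (intro SUP_upper2[of B]) auto

lemma subgroup_rank_pos:
  assumes "subgroup_rank G S > 0"
  obtains B b where "B \<subseteq> S" "B \<subseteq> carrier G" "int_independent G B" "b \<in> B"
proof -
  obtain B where B: "B \<subseteq> S" "B \<subseteq> carrier G" "int_independent G B" "0 < enat (card B)"
    using assms unfolding subgroup_rank_def less_SUP_iff by blast
  have "B \<noteq> {}"
    using B(4) by (auto simp: zero_enat_def)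
  thus ?thesis
    using that B by blast
qed

section \<open>Derivations of rational function fields\<close>

text \<open>The difference of the two sides is a combination of a d - c b and its derivative. This
  makes the quotient rule independent of the chosen fraction.\<close>

lemma quotient_rule_well_defined:
  fixes a b c d :: "'a::idom poly"
  assumes "a * d = c * b"
  shows "(pderiv a * b - a * pderiv b) * (d * d) = (pderiv c * d - c * pderiv d) * (b * b)"
proof -
  have "pderiv (a * d) = pderiv (c * b)"
    using assms by simp
  hence eq': "a * pderiv d + d * pderiv a = c * pderiv b + b * pderiv c"
    by (simp add: pderiv_mult)
  have "(pderiv a * b - a * pderiv b) * (d * d) - (pderiv c * d - c * pderiv d) * (b * b) =
      b * d * (a * pderiv d + d * pderiv a - (c * pderiv b + b * pderiv c)) +
      (c * b - a * d) * (d * pderiv b + b * pderiv d)"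
    by (simp only: algebra_simps)
  also have "\<dots> = 0"
    using assms eq' by simp
  finally show ?thesis
    by simp
qed

text \<open>Differentiation by the outermost polynomial variable. In \<open>ratfun3\<close> that
  variable is \<open>t\<close> below, and the other two variables count as constants.\<close>

definition fract_deriv :: "'a::idom poly fract \<Rightarrow> 'a poly fract" where
  "fract_deriv q = (THE r. \<exists>a b. b \<noteq> 0 \<and> q = Fract a b \<and> r = Fract (pderiv a * b - a * pderiv b) (b * b))"

lemma fract_deriv_Fract:
  assumes "b \<noteq> 0"
  shows "fract_deriv (Fract a b) = Fract (pderiv a * b - a * pderiv b) (b * b)"
  unfolding fract_deriv_def
proof (rule the_equality)
  show "\<exists>a' b'. b' \<noteq> 0 \<and> Fract a b = Fract a' b' \<and>
      Fract (pderiv a * b - a * pderiv b) (b * b) = Fract (pderiv a' * b' - a' * pderiv b') (b' * b')"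
    using assms by blast
  show "r = Fract (pderiv a * b - a * pderiv b) (b * b)"
    if "\<exists>a' b'. b' \<noteq> 0 \<and> Fract a b = Fract a' b' \<and> r = Fract (pderiv a' * b' - a' * pderiv b') (b' * b')" for r
    using that assms by (auto simp: eq_fract intro: quotient_rule_well_defined[symmetric])
qed

lemma fract_deriv_add: "fract_deriv (p + q) = fract_deriv p + fract_deriv q"
proof (cases p; cases q)
  fix a b c d :: "'a poly"
  assume "p = Fract a b" "b \<noteq> 0" "q = Fract c d" "d \<noteq> 0"
  thus ?thesis
    by (simp add: fract_deriv_Fract eq_fract pderiv_add pderiv_mult) (simp only: algebra_simps)
qed

lemma fract_deriv_mult: "fract_deriv (p * q) = p * fract_deriv q + q * fract_deriv p"
proof (cases p; cases q)
  fix a b c d :: "'a poly"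
  assume "p = Fract a b" "b \<noteq> 0" "q = Fract c d" "d \<noteq> 0"
  thus ?thesis
    by (simp add: fract_deriv_Fract eq_fract pderiv_add pderiv_mult) (simp only: algebra_simps)
qed

lemma fract_deriv_to_fract: "fract_deriv (to_fract p) = to_fract (pderiv p)"
  by (simp add: to_fract_def fract_deriv_Fract)

locale field_derivation =
  fixes \<delta> :: "'k::field_char_0 \<Rightarrow> 'k"
  assumes add: "\<delta> (a + b) = \<delta> a + \<delta> b"
    and mult: "\<delta> (a * b) = a * \<delta> b + b * \<delta> a"
begin

lemma zero [simp]: "\<delta> 0 = 0"
  using add[of 0 0] by simp

lemma one [simp]: "\<delta> 1 = 0"
  using mult[of 1 1] by simp

lemma uminus: "\<delta> (- a) = - \<delta> a"
  using add[of a "- a"] by (simp add: eq_neg_iff_add_eq_0 add.commute)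

lemma diff: "\<delta> (a - b) = \<delta> a - \<delta> b"
  using add[of a "- b"] by (simp add: uminus)

lemma of_nat [simp]: "\<delta> (of_nat n) = 0"
  by (induction n) (auto simp: add)

lemma numeral [simp]: "\<delta> (numeral n) = 0"
  using of_nat[of "numeral n"] by simp

lemma sum: "\<delta> (sum g A) = (\<Sum>x\<in>A. \<delta> (g x))"
  by (induction A rule: infinite_finite_induct) (auto simp: add)

lemma power: "a * \<delta> (a ^ n) = of_nat n * a ^ n * \<delta> a"
proof (induction n)
  case (Suc n)
  have "a * \<delta> (a ^ Suc n) = a * (a * \<delta> (a ^ n)) + a * a ^ n * \<delta> a"
    by (simp add: mult algebra_simps)
  also have "\<dots> = of_nat (Suc n) * a ^ Suc n * \<delta> a"
    unfolding Suc by (simp add: algebra_simps)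
  finally show ?case .
qed simp

text \<open>The extension of \<open>\<delta>\<close> to polynomials in \<open>x\<close> with \<open>\<delta> x = e x\<close>.\<close>

definition extend :: "'k \<Rightarrow> 'k poly \<Rightarrow> 'k poly" where
  "extend e p = map_poly \<delta> p + [:e:] * ([:0, 1:] * pderiv p)"

lemma poly_derivation_extend: "poly_derivation (extend e)"
proof
  have madd: "map_poly \<delta> (p + q) = map_poly \<delta> p + map_poly \<delta> q" for p q
    by (rule poly_eqI) (simp add: coeff_map_poly add)
  have mmult: "map_poly \<delta> (p * q) = p * map_poly \<delta> q + q * map_poly \<delta> p" for p q
  proof (rule poly_eqI)
    fix n
    have "coeff (map_poly \<delta> (p * q)) n =
        (\<Sum>i\<le>n. coeff p i * \<delta> (coeff q (n - i))) + (\<Sum>i\<le>n. coeff q (n - i) * \<delta> (coeff p i))"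
      by (simp add: coeff_map_poly coeff_mult sum mult sum.distrib)
    also have "(\<Sum>i\<le>n. coeff q (n - i) * \<delta> (coeff p i)) = (\<Sum>i\<le>n. coeff q i * \<delta> (coeff p (n - i)))"
      by (rule sum.reindex_bij_witness[of _ "\<lambda>i. n - i" "\<lambda>i. n - i"]) auto
    finally show "coeff (map_poly \<delta> (p * q)) n = coeff (p * map_poly \<delta> q + q * map_poly \<delta> p) n"
      by (simp add: coeff_mult coeff_map_poly)
  qed
  show "extend e (p + q) = extend e p + extend e q" for p q
    unfolding extend_def madd pderiv_add by (simp only: algebra_simps)
  show "extend e (p * q) = p * extend e q + q * extend e p" for p q
    unfolding extend_def mmult pderiv_mult by (simp only: algebra_simps)
  show "degree (extend e p) \<le> degree p" for p
  proof -
    have "degree ([:0, 1:] * pderiv p) \<le> degree p"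
    proof (cases "degree p = 0")
      case True
      hence "pderiv p = 0"
        by (simp add: pderiv_eq_0_iff)
      thus ?thesis
        by simp
    next
      case False
      thus ?thesis
        using degree_mult_le[of "[:0, 1:]" "pderiv p"] by (simp add: degree_pderiv)
    qed
    thus ?thesis
      unfolding extend_def using map_poly_degree_leq[of \<delta> p]
      by (intro degree_add_le) (auto intro: order.trans[OF degree_smult_le])
  qed
qed

lemma poly_extend_linear: "poly (extend e [:- a, 1:]) a = e * a - \<delta> a"
  by (simp add: extend_def map_poly_pCons pderiv_pCons uminus)

text \<open>The value of \<open>e\<close> balances the two terms: x^m is multiplied by m
  \<open>e\<close> and w^2 by 2 \<delta>(w) / w, and these agree.\<close>

lemma extend_weighted:
  assumes "w \<noteq> 0" "m > 0"
  defines "e \<equiv> 2 * \<delta> w / (of_nat m * w)"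
  shows "extend e (monom 1 m + [:w ^ 2:]) = smult (2 * \<delta> w / w) (monom 1 m + [:w ^ 2:])"
proof -
  obtain k where k: "m = Suc k"
    using assms(2) gr0_conv_Suc by auto
  have "map_poly \<delta> (monom 1 m + [:w ^ 2:]) = [:2 * w * \<delta> w:]"
    by (rule poly_eqI)
       (simp add: coeff_map_poly k coeff_pCons power2_eq_square mult split: nat.split)
  moreover have "[:0, 1:] * pderiv (monom 1 m + [:w ^ 2:]) = monom (of_nat m) m"
    by (rule poly_eqI) (auto simp: k coeff_pCons coeff_pderiv split: nat.split)
  ultimately show ?thesis
    using assms(1) of_nat_neq_0[of k, where 'a = 'k]
    by (simp add: extend_def e_def k smult_monom smult_add_right power2_eq_square)
qed

end

text \<open>Ordered coefficients make the fraction field an ordered field, hence one of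
  characteristic 0.\<close>

interpretation fract_deriv: field_derivation "fract_deriv :: 'a::linordered_idom poly fract \<Rightarrow> _"
  by unfold_locales (rule fract_deriv_add fract_deriv_mult)+

section \<open>The elliptic curve\<close>

text \<open>Having no multiple root over the closure of the rationals makes the gcd of f and f'
  constant. The resulting Bezout identity survives every morphism and excludes a multiple root in
  the target.\<close>

lemma rsquarefree_base_change:
  fixes f :: "rat poly" and \<iota> :: "rat \<Rightarrow> 'b::field_char_0"
  assumes \<iota>: "ring_morphism \<iota>" and sqf: "rsquarefree (map_poly to_ac f)"
  shows "rsquarefree (map_poly \<iota> f)"
  unfolding rsquarefree_roots
proof (intro allI notI)
  interpret \<iota>: ring_morphism \<iota> by fact
  have map_pderiv: "map_poly h (pderiv f) = pderiv (map_poly h f)"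
    if "ring_morphism h" for h :: "rat \<Rightarrow> 'z::field_char_0"
  proof -
    interpret h: ring_morphism h by fact
    show ?thesis
      by (intro poly_eqI) (simp add: coeff_pderiv h.hom_of_nat flip: of_nat_Suc)
  qed
  fix a
  assume root: "poly (map_poly \<iota> f) a = 0 \<and> poly (pderiv (map_poly \<iota> f)) a = 0"
  define g where "g = gcd f (pderiv f)"
  have "f \<noteq> 0"
    using sqf by (auto simp: rsquarefree_def)
  have "degree g = 0"
  proof (rule ccontr)
    assume "degree g \<noteq> 0"
    then obtain r where r: "poly (map_poly to_ac g) r = 0"
      using alg_closed_imp_poly_has_root[of "map_poly to_ac g"] by auto
    interpret e: ring_morphism "\<lambda>p. poly (map_poly to_ac p) r"
      by (rule to_ac.eval_morphism)
    obtain u v where "f = g * u" "pderiv f = g * v"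
      unfolding g_def by (metis dvdE gcd_dvd1 gcd_dvd2)
    hence "poly (map_poly to_ac f) r = 0" "poly (map_poly to_ac (pderiv f)) r = 0"
      using r e.hom_mult by auto
    thus False
      using sqf unfolding rsquarefree_roots map_pderiv[OF to_ac.ring_morphism_axioms] by blast
  qed
  then obtain c where c: "g = [:c:]"
    by (metis degree_eq_zeroE)
  have "c \<noteq> 0"
    using c \<open>f \<noteq> 0\<close> by (auto simp: g_def)
  obtain u v where "u * f + v * pderiv f = g"
    unfolding g_def using bezout_coefficients_fst_snd by blast
  moreover interpret e: ring_morphism "\<lambda>p. poly (map_poly \<iota> p) a"
    by (rule \<iota>.eval_morphism)
  have "poly (map_poly \<iota> (u * f + v * pderiv f)) a = 0"
    unfolding e.hom_add e.hom_mult map_pderiv[OF \<iota>] using root by simp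
  ultimately have "\<iota> c = 0"
    unfolding c by simp
  thus False
    using \<iota>.hom_mult[of c "inverse c"] \<open>c \<noteq> 0\<close> by simp
qed

interpretation ratfun3_const: ring_morphism ratfun3_const
  by unfold_locales (auto simp: ratfun3_const_def simp flip: to_fract_1 to_fract_add to_fract_mult one_pCons)

lemma ratfun3_const_eq_0_iff [simp]: "ratfun3_const c = 0 \<longleftrightarrow> c = 0"
  by (simp add: ratfun3_const_def)

lemma elliptic_curve_hyperelliptic:
  assumes "elliptic_curve d f P"
  shows "hyperelliptic (to_ac d) (map_poly to_ac f)"
  using assms by unfold_locales (auto simp: elliptic_curve_def)

text \<open>The map (x, y) to (x, y / s) is an isomorphism onto the twist and carries the origin
  along. Positive rank supplies one point of infinite order, and it suffices that its image is not
  torsion, which \<open>principal_descent\<close> gives.\<close>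

lemma mordell_weil_rank_square_twist:
  fixes f :: "rat poly" and s :: ratfun3
  assumes E: "elliptic_curve 1 f O\<^sub>E" and rank: "mordell_weil_rank 1 f O\<^sub>E > 0" and s: "s \<noteq> 0"
  shows "\<exists>O\<^sub>D. elliptic_curve (s ^ 2) (map_poly ratfun3_const f) O\<^sub>D \<and>
    mordell_weil_rank (s ^ 2) (map_poly ratfun3_const f) O\<^sub>D > 0"
proof -
  define \<iota> where "\<iota> = (\<lambda>c. to_ac (ratfun3_const c))"
  have \<iota>: "ring_morphism \<iota>"
    unfolding \<iota>_def by (rule ring_morphism_comp[OF to_ac.ring_morphism_axioms
          ratfun3_const.ring_morphism_axioms])
  interpret \<iota>: ring_morphism \<iota> by (fact \<iota>)
  define f1 where "f1 = map_poly ratfun3_const f"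
  define tw where "tw P = twist_point s (map_curve_point ratfun3_const P)" for P
  have f1: "map_poly to_ac f1 = map_poly \<iota> f"
    by (simp add: f1_def \<iota>_def map_poly_map_poly comp_def)
  have deg: "degree f1 = degree f"
    unfolding f1_def by (rule degree_map_poly) simp
  have genus: "curve_genus f1 = curve_genus f"
    by (simp add: curve_genus_def deg)
  have tw_pts: "tw P \<in> curve_points (s ^ 2) f1" if "P \<in> curve_points 1 f" for P
    using that s unfolding tw_def curve_points_def
    by (auto simp: genus[unfolded f1_def] power_divide f1_def simp flip: ratfun3_const.hom_poly ratfun3_const.hom_power)
  have "rsquarefree (map_poly \<iota> f)"
    using E by (intro rsquarefree_base_change[OF \<iota>]) (simp add: elliptic_curve_def)
  hence ED: "elliptic_curve (s ^ 2) f1 (tw O\<^sub>E)"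
    using E s tw_pts by (simp add: elliptic_curve_def deg f1)
  interpret c: hyperelliptic "to_ac 1" "map_poly to_ac f"
    by (rule elliptic_curve_hyperelliptic[OF E])
  interpret b: hyperelliptic "to_ac (s ^ 2)" "map_poly to_ac f1"
    by (rule elliptic_curve_hyperelliptic[OF ED])
  have O: "O\<^sub>E \<in> curve_points 1 f"
    using E by (simp add: elliptic_curve_def)
  have ac_tw: "map_curve_point to_ac (tw P) = twist_point (to_ac s) (map_curve_point \<iota> P)" for P
    by (cases P) (simp_all add: tw_def \<iota>_def)
  obtain B b where B: "B \<subseteq> mordell_weil_group 1 f O\<^sub>E" "B \<subseteq> carrier (picard_group (to_ac 1) (map_poly to_ac f))"
      "int_independent (picard_group (to_ac 1) (map_poly to_ac f)) B" "b \<in> B"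
    using subgroup_rank_pos[OF rank[unfolded mordell_weil_rank_def]] .
  then obtain P where P: "P \<in> curve_points 1 f"
    and b: "b = divisor_class (to_ac 1) (map_poly to_ac f)
        (frag_of (map_curve_point to_ac P) - frag_of (map_curve_point to_ac O\<^sub>E))"
    unfolding mordell_weil_group_def by blast
  define D where "D = frag_of (map_curve_point to_ac (tw P)) - frag_of (map_curve_point to_ac (tw O\<^sub>E))"
  have D: "D \<in> carrier (divisor_group (to_ac (s ^ 2)) (map_poly to_ac f1))"
    unfolding D_def by (intro b.point_difference_closed to_ac_in_points tw_pts P O)
  have nontorsion: "k = 0"
    if "frag_cmul k D \<in> principal_divisors (to_ac (s ^ 2)) (map_poly to_ac f1)" for k
  proof -
    have "frag_cmul (int (nat \<bar>k\<bar>)) D \<in> principal_divisors (to_ac (s ^ 2)) (map_poly to_ac f1)"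
      by (rule b.principal_of_abs[OF that])
    hence "frag_cmul (int (nat \<bar>k\<bar>)) (frag_of (twist_point (to_ac s) (map_curve_point \<iota> P)) -
        frag_of (twist_point (to_ac s) (map_curve_point \<iota> O\<^sub>E)))
        \<in> principal_divisors (\<iota> 1 * to_ac s ^ 2) (map_poly \<iota> f)"
      by (simp add: D_def ac_tw f1)
    moreover have "hyperelliptic (\<iota> 1 * to_ac s ^ 2) (map_poly \<iota> f)"
      using b.hyperelliptic_axioms by (simp add: f1)
    ultimately have "frag_cmul (int (nat \<bar>k\<bar>)) (frag_of (map_curve_point to_ac P) -
        frag_of (map_curve_point to_ac O\<^sub>E)) \<in> principal_divisors (to_ac 1) (map_poly to_ac f)"
      using s c.hyperelliptic_axioms P O
      by (intro principal_descent[OF \<iota> to_ac.ring_morphism_axioms, of "to_ac s" 1 f]) simp_all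
    hence "int (nat \<bar>k\<bar>) = 0"
      by (rule c.independent_imp_nontorsion[OF B(3,2)
            c.point_difference_closed[OF to_ac_in_points[OF P] to_ac_in_points[OF O]] B(4)[unfolded b]])
    thus ?thesis
      by simp
  qed
  have "int_independent (picard_group (to_ac (s ^ 2)) (map_poly to_ac f1))
      ((\<lambda>_::unit. divisor_class (to_ac (s ^ 2)) (map_poly to_ac f1) D) ` {()})"
    by (rule b.independent_classes) (use D nontorsion in auto)
  hence "subgroup_rank (picard_group (to_ac (s ^ 2)) (map_poly to_ac f1))
      (mordell_weil_group (s ^ 2) f1 (tw O\<^sub>E)) \<ge> enat 1"
    using b.divisor_class_closed[OF D] tw_pts[OF P]
    by (intro subgroup_rank_ge[of "{divisor_class (to_ac (s ^ 2)) (map_poly to_ac f1) D}"])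
       (auto simp: mordell_weil_group_def D_def)
  hence "mordell_weil_rank (s ^ 2) f1 (tw O\<^sub>E) > 0"
    unfolding mordell_weil_rank_def by (metis enat_0_iff(1) gr_zeroI le_zero_eq one_neq_zero)
  thus ?thesis
    using ED unfolding f1_def by blast
qed

section \<open>Three points on \<open>y\<^sup>2 = x\<^sup>m + W\<^sup>2\<close>\<close>

interpretation to_fract: ring_morphism "to_fract :: 'a::idom \<Rightarrow> 'a fract"
  by unfold_locales auto

text \<open>
  With \<open>C = t\<^sup>m\<close>, the points below come from \<open>s (s + 1) = c\<^sup>m T\<close> for \<open>c = 1, t, -1\<close>: the curve
  \<open>s\<^sub>1 (s\<^sub>1 + 1) = s\<^sub>2 (s\<^sub>2 + 1) / C\<^sub>2 = s\<^sub>3 (s\<^sub>3 + 1) / C\<^sub>3\<close> of genus one meets the plane \<open>s\<^sub>1 = s\<^sub>2 + s\<^sub>3\<close> in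
  three trivial points and one further point, which is specialised to \<open>C\<^sub>2 = C\<close> and \<open>C\<^sub>3 = -1\<close>.
\<close>

locale three_points =
  fixes m k :: nat
  assumes m: "m = 2 * k + 1" and k: "k > 0"
begin

definition t :: ratfun3 where "t = to_fract [:0, 1:]"
definition C :: ratfun3 where "C = t ^ m"
definition U :: ratfun3 where "U = 2 * C ^ 3 - 8 * C"
definition V :: ratfun3 where "V = C ^ 2 + 4"
text \<open>With y = W (2 s + 1) the equation reads x^m = 4 W^2 s (s + 1) = 4 W^2 c^m T. The
  solution has 2 s_i + 1 = \<open>Y i\<close> / \<open>V\<close> and T = \<open>U\<close> /
  \<open>V\<close>^2, and this \<open>W\<close> makes 4 W^2 T equal to \<open>U\<close>^(2k+1), an
  m-th power because m is odd. Hence x = c \<open>U\<close>.\<close>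

definition W :: ratfun3 where "W = U ^ k * V / 2"
definition Y :: "nat \<Rightarrow> ratfun3" where
  "Y i = (if i = 0 then C ^ 2 + 4 * C - 4 else if i = 1 then 3 * C ^ 2 - 4 else 4 + 4 * C - C ^ 2)"
definition px :: "nat \<Rightarrow> ratfun3" where
  "px i = (if i = 0 then U else if i = 1 then t * U else - U)"
definition py :: "nat \<Rightarrow> ratfun3" where
  "py i = U ^ k * Y i / 2"
definition F :: "ratfun3 poly" where "F = monom 1 m + [:W ^ 2:]"

lemma m_ge_3: "m \<ge> 3" and odd_m: "odd m"
  using m k by auto

text \<open>The field is ordered by leading coefficients, so \<open>t\<close> exceeds every constant.\<close>

lemma t_large: "t > 6"
proof -
  have six: "(6 :: ratfun3) = to_fract 6"
    using to_fract.hom_of_nat[of 6, where 'a = "rat poly poly poly"] by simp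
  have "(6 :: rat poly poly poly) < [:0, 1:]"
    by (simp add: less_poly_def numeral_poly pos_poly_def)
  thus ?thesis
    unfolding six t_def by (simp add: to_fract_def)
qed

lemma C_large: "C > 6"
proof -
  have "t ^ 1 \<le> t ^ m"
    using t_large m_ge_3 by (intro power_increasing) auto
  thus ?thesis
    using t_large by (simp add: C_def)
qed

lemma U_pos: "U > 0"
proof -
  have "U = 2 * C * ((C - 2) * (C + 2))"
    by (simp add: U_def algebra_simps power3_eq_cube)
  thus ?thesis
    using C_large by simp
qed

lemma V_pos: "V > 0"
  by (simp add: V_def add_nonneg_pos)

lemma W_nonzero: "W \<noteq> 0"
  using U_pos V_pos by (simp add: W_def)

text \<open>The bound 6 lies above 2 + 2 sqrt 2, the largest real root of the three quadratics in
  \<open>C\<close>.\<close>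

lemma Y_nonzero: "Y i \<noteq> 0"
proof -
  have sq: "C * C > 6 * C"
    using C_large by simp
  have "C * C + 4 * C - 4 \<noteq> 0" "3 * (C * C) - 4 \<noteq> 0" "4 + 4 * C - C * C \<noteq> 0"
    using sq C_large by linarith+
  thus ?thesis
    by (simp add: Y_def power2_eq_square)
qed

lemma py_nonzero: "py i \<noteq> 0"
  using U_pos Y_nonzero by (simp add: py_def)

lemma inj_px: "inj_on px {..<3}"
proof -
  have "t * U > 0"
    using t_large U_pos by simp
  moreover have "t * U \<noteq> U"
    using t_large U_pos by simp
  ultimately have "t * U \<noteq> U" "t * U \<noteq> - U" "U \<noteq> - U"
    using U_pos by linarith+
  thus ?thesis
    by (auto simp: inj_on_def px_def)
qed

lemma on_curve: "py i ^ 2 = poly F (px i)"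
proof -
  have m': "m = Suc (2 * k)"
    by (simp add: m)
  have Um: "U ^ m = U ^ (2 * k) * U"
    by (simp add: m' mult.commute)
  have x: "px i ^ m = U ^ (2 * k) * U * (if i = 0 then 1 else if i = 1 then C else - 1)"
    using odd_m by (auto simp: px_def power_mult_distrib Um C_def)
  \<comment> \<open>The identity 4 \<open>U\<close> c^m = (\<open>Y i\<close> - \<open>V\<close>)
    (\<open>Y i\<close> + \<open>V\<close>) for c = 1, t, -1, which expresses that the three values
    s (s + 1) are in the ratio 1 : \<open>C\<close> : -1.\<close>
  have "4 * U * (if i = 0 then 1 else if i = 1 then C else - 1) = Y i ^ 2 - V ^ 2"
    by (simp add: U_def V_def Y_def) (auto simp: algebra_simps power2_eq_square power3_eq_cube)
  moreover have "4 * (px i ^ m) =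
      U ^ (2 * k) * (4 * U * (if i = 0 then 1 else if i = 1 then C else - 1))"
    unfolding x by (simp only: ac_simps)
  ultimately have "4 * (px i ^ m) = U ^ (2 * k) * (Y i ^ 2 - V ^ 2)"
    by (simp only:)
  hence "px i ^ m = U ^ (2 * k) * (Y i ^ 2 - V ^ 2) / 4"
    by simp
  moreover have "py i ^ 2 = U ^ (2 * k) * Y i ^ 2 / 4" "W ^ 2 = U ^ (2 * k) * V ^ 2 / 4"
    by (simp_all add: py_def W_def power_divide power_mult_distrib mult.commute flip: power_mult)
  ultimately show ?thesis
    by (simp add: F_def poly_monom algebra_simps diff_divide_distrib)
qed

lemma degree_F: "degree F = m"
  unfolding F_def using m_ge_3 by (subst degree_add_eq_left) (auto simp: degree_monom_eq)

text \<open>The derivative m x^(m-1) vanishes only at 0, where the polynomial takes the value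
  W^2.\<close>

lemma rsquarefree_F: "rsquarefree (map_poly to_ac F)"
  unfolding rsquarefree_roots
proof (intro allI notI)
  interpret h: ring_morphism "map_poly to_ac"
    by (rule to_ac.map_poly_morphism)
  fix a
  assume "poly (map_poly to_ac F) a = 0 \<and> poly (pderiv (map_poly to_ac F)) a = 0"
  moreover have "map_poly to_ac F = monom 1 m + [:to_ac W ^ 2:]"
    by (simp add: F_def map_poly_monom)
  ultimately have "a ^ m + to_ac W ^ 2 = 0" "of_nat m * a ^ (m - 1) = 0"
    by (simp_all add: poly_monom pderiv_add pderiv_monom pderiv_pCons)
  moreover from this have "a = 0"
    using m_ge_3 by simp
  ultimately show False
    using W_nonzero m_ge_3 by (simp add: power_0_left)
qed

abbreviation \<delta> :: "ratfun3 \<Rightarrow> ratfun3" where "\<delta> \<equiv> fract_deriv"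

definition e :: ratfun3 where "e = 2 * \<delta> W / (of_nat m * W)"

lemma deriv_t: "\<delta> t = 1"
  by (simp add: t_def fract_deriv_to_fract pderiv_pCons flip: one_pCons)

lemma deriv_C: "t * \<delta> C = of_nat m * C"
  unfolding C_def fract_deriv.power deriv_t by simp

lemma deriv_U: "t * \<delta> U = of_nat m * (6 * C ^ 3 - 8 * C)"
proof -
  have "t * \<delta> U = (6 * C ^ 2 - 8) * (t * \<delta> C)"
    by (simp add: U_def fract_deriv.diff fract_deriv.mult power3_eq_cube power2_eq_square algebra_simps)
  thus ?thesis
    unfolding deriv_C by (simp add: power3_eq_cube power2_eq_square algebra_simps)
qed

lemma deriv_V: "t * \<delta> V = of_nat m * (2 * C ^ 2)"
proof -
  have "t * \<delta> V = 2 * C * (t * \<delta> C)"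
    by (simp add: V_def fract_deriv.add fract_deriv.mult power2_eq_square algebra_simps)
  thus ?thesis
    unfolding deriv_C by (simp add: power2_eq_square algebra_simps)
qed

text \<open>Logarithmic differentiation of \<open>W\<close> gives m \<open>e\<close> = 2 (k
  \<delta>(U) / U + \<delta>(V) / V). The factor m cancels against the one produced by
  \<delta>(C).\<close>

lemma e_eq: "t * U * V * e = 2 * (of_nat k * (6 * C ^ 3 - 8 * C) * V + 2 * C ^ 2 * U)"
proof -
  have "2 * W = U ^ k * V"
    by (simp add: W_def)
  hence "\<delta> (2 * W) = \<delta> (U ^ k * V)"
    by simp
  hence "2 * \<delta> W = U ^ k * \<delta> V + V * \<delta> (U ^ k)"
    by (simp add: fract_deriv.mult)
  hence "t * U * (2 * \<delta> W) = U ^ k * U * (t * \<delta> V) + V * t * (U * \<delta> (U ^ k))"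
    by (simp add: algebra_simps)
  also have "\<dots> = U ^ k * (U * (t * \<delta> V) + of_nat k * V * (t * \<delta> U))"
    unfolding fract_deriv.power by (simp add: algebra_simps)
  also have "\<dots> = U ^ k * (of_nat m * (of_nat k * (6 * C ^ 3 - 8 * C) * V + 2 * C ^ 2 * U))"
    unfolding deriv_U deriv_V by (simp add: algebra_simps)
  finally have eq: "t * U * (2 * \<delta> W) =
      U ^ k * (of_nat m * (of_nat k * (6 * C ^ 3 - 8 * C) * V + 2 * C ^ 2 * U))" .
  have nz: "(of_nat m :: ratfun3) \<noteq> 0" "U ^ k \<noteq> 0" "V \<noteq> 0"
    using m_ge_3 U_pos V_pos by auto
  have "t * U * V * e = V * (t * U * (2 * \<delta> W)) / (of_nat m * W)"
    by (simp add: e_def)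
  also have "\<dots> = 2 * (of_nat k * (6 * C ^ 3 - 8 * C) * V + 2 * C ^ 2 * U)"
    unfolding eq unfolding W_def using nz by (simp add: field_simps)
  finally show ?thesis .
qed

text \<open>The terms with k combine through 2 k - m = -1, which leaves a polynomial in
  \<open>C\<close> alone. It contains the factor \<open>Y 0\<close> of the ordinate, so the later
  division by \<open>Y 0\<close> is exact, and \<open>Y 2\<close> for the same reason serves the
  third point.\<close>

lemma residue_0: "t * V * (e * U - \<delta> U) = - 2 * C * Y 0 * Y 2"
proof -
  define c where "c = 6 * C ^ 3 - 8 * C"
  have "U * (t * V * (e * U - \<delta> U)) = U * (t * U * V * e) - U * V * (t * \<delta> U)"
    by (simp add: algebra_simps)
  also have "\<dots> = U * (2 * (of_nat k * c * V + 2 * C ^ 2 * U) - V * (of_nat m * c))"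
    unfolding e_eq deriv_U c_def by (simp only: algebra_simps)
  also have "2 * (of_nat k * c * V + 2 * C ^ 2 * U) - V * (of_nat m * c) = 4 * C ^ 2 * U - c * V"
    by (simp add: m algebra_simps)
  also have "\<dots> = - 2 * C * Y 0 * Y 2"
    by (simp add: c_def U_def V_def Y_def algebra_simps power2_eq_square power3_eq_cube)
  finally show ?thesis
    using U_pos by (simp only: mult_cancel_left) auto
qed

lemma residue_1: "t * V * (e * px 1 - \<delta> (px 1)) = - 16 * C * Y 1 * t"
proof -
  have "\<delta> (px 1) = t * \<delta> U + U"
    by (simp add: px_def fract_deriv.mult deriv_t)
  hence "t * V * (e * px 1 - \<delta> (px 1)) = t * (t * V * (e * U - \<delta> U) - U * V)"
    by (simp add: px_def algebra_simps)
  also have "\<dots> = - 16 * C * Y 1 * t"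
    unfolding residue_0 by (simp add: U_def V_def Y_def algebra_simps power2_eq_square power3_eq_cube)
  finally show ?thesis .
qed

text \<open>As a polynomial in t the relation involves the exponents 0, 1, m and 2 m, which are
  distinct. The coefficient of t isolates the second integer, while the coefficients of 1 and t^m
  give the sum and the difference of the other two.\<close>

lemma relation_trivial:
  fixes n :: "nat \<Rightarrow> int"
  assumes "of_int (n 0) * Y 2 + 8 * of_int (n 1) * t - of_int (n 2) * Y 0 = 0"
  shows "n 0 = 0" "n 1 = 0" "n 2 = 0"
proof -
  define p :: "rat poly poly poly" where
    "p = [:of_int (4 * n 0 + 4 * n 2):] + monom (of_int (8 * n 1)) 1 +
       monom (of_int (4 * n 0 - 4 * n 2)) m + monom (of_int (- n 0 - n 2)) (2 * m)"
  have const: "to_fract [:of_int j:] = (of_int j :: ratfun3)" for j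
    by (metis of_int_poly to_fract.hom_of_int)
  have mono: "to_fract (monom (of_int j) l) = of_int j * t ^ l" for j l
  proof -
    have "monom (of_int j :: rat poly poly) l = [:of_int j:] * [:0, 1:] ^ l"
      by (simp add: monom_altdef)
    thus ?thesis
      by (simp only: to_fract.hom_mult to_fract.hom_power const t_def)
  qed
  have "to_fract p = of_int (4 * n 0 + 4 * n 2) + of_int (8 * n 1) * t +
      of_int (4 * n 0 - 4 * n 2) * C + of_int (- n 0 - n 2) * C ^ 2"
    unfolding p_def to_fract_add const mono C_def by (simp add: power_mult mult.commute flip: power_mult)
  also have "\<dots> = of_int (n 0) * Y 2 + 8 * of_int (n 1) * t - of_int (n 2) * Y 0"
    by (simp add: Y_def algebra_simps)
  finally have p: "p = 0"
    using assms by simp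
  have "coeff p 0 = of_int (4 * n 0 + 4 * n 2)" "coeff p 1 = of_int (8 * n 1)"
      "coeff p m = of_int (4 * n 0 - 4 * n 2)"
    using m_ge_3 by (simp_all add: p_def coeff_pCons split: nat.split)
  hence "4 * n 0 + 4 * n 2 = 0" "8 * n 1 = 0" "4 * n 0 - 4 * n 2 = 0"
    unfolding p coeff_0 by (metis of_int_eq_0_iff)+
  thus "n 0 = 0" "n 1 = 0" "n 2 = 0"
    by simp_all
qed

lemma points_independent:
  fixes n :: "nat \<Rightarrow> int"
  assumes "(\<Sum>i<3. frag_cmul (n i) (frag_of (Affine (to_ac (px i)) (to_ac (py i))) -
        frag_of (Infinite 0))) \<in> principal_divisors 1 (map_poly to_ac F)"
  shows "\<forall>i\<in>{..<3}. n i = 0"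
proof -
  interpret ext: poly_derivation "fract_deriv.extend e"
    by (rule fract_deriv.poly_derivation_extend)
  have "(\<Sum>i<3. of_int (n i) * poly (fract_deriv.extend e [:- px i, 1:]) (px i) / py i) = 0"
  proof (rule ext.points_relation[OF _ _ _ rsquarefree_F _ inj_px _ _ assms])
    show "fract_deriv.extend e F = smult (2 * \<delta> W / W) F"
      unfolding e_def F_def using m_ge_3 by (intro fract_deriv.extend_weighted[OF W_nonzero]) simp
  qed (use m_ge_3 odd_m in \<open>auto simp: degree_F on_curve py_nonzero\<close>)
  hence "(\<Sum>i<3. of_int (n i) * ((e * px i - \<delta> (px i)) / py i)) = 0"
    by (simp add: fract_deriv.poly_extend_linear)
  \<comment> \<open>The factor \<open>U\<close>^k / 2 is common to all ordinates. Multiplying the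
    relation by it and by t \<open>V\<close> clears the denominators other than
    \<open>Y i\<close>.\<close>
  moreover have "t * V * z / Y i = t * V * U ^ k / 2 * (z / py i)" for i z
    using U_pos by (simp add: py_def)
  hence "(\<Sum>i<3. of_int (n i) * (t * V * (e * px i - \<delta> (px i)) / Y i)) =
      t * V * U ^ k / 2 * (\<Sum>i<3. of_int (n i) * ((e * px i - \<delta> (px i)) / py i))"
    by (simp only: sum_distrib_left mult.left_commute)
  ultimately have sum: "of_int (n 0) * (t * V * (e * px 0 - \<delta> (px 0)) / Y 0) +
      of_int (n 1) * (t * V * (e * px 1 - \<delta> (px 1)) / Y 1) +
      of_int (n 2) * (t * V * (e * px 2 - \<delta> (px 2)) / Y 2) = 0"
    by (simp add: numeral_3_eq_3 numeral_2_eq_2)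
  have r0: "t * V * (e * px 0 - \<delta> (px 0)) / Y 0 = - 2 * C * Y 2"
  proof -
    have *: "t * V * (e * px 0 - \<delta> (px 0)) = - 2 * C * Y 2 * Y 0"
      using residue_0 by (simp add: px_def mult.commute mult.left_commute)
    show ?thesis
      unfolding * by (simp add: Y_nonzero)
  qed
  have r1: "t * V * (e * px 1 - \<delta> (px 1)) / Y 1 = - 16 * C * t"
  proof -
    have *: "t * V * (e * px 1 - \<delta> (px 1)) = - 16 * C * t * Y 1"
      unfolding residue_1 by (simp add: mult.commute mult.left_commute)
    show ?thesis
      unfolding * by (simp add: Y_nonzero)
  qed
  have r2: "t * V * (e * px 2 - \<delta> (px 2)) / Y 2 = 2 * C * Y 0"
  proof -
    have "t * V * (e * px 2 - \<delta> (px 2)) = - (t * V * (e * U - \<delta> U))"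
      by (simp add: px_def fract_deriv.uminus algebra_simps)
    also have "\<dots> = 2 * C * Y 0 * Y 2"
      unfolding residue_0 by simp
    finally have *: "t * V * (e * px 2 - \<delta> (px 2)) = 2 * C * Y 0 * Y 2" .
    show ?thesis
      unfolding * by (simp add: Y_nonzero)
  qed
  have "(- 2 * C) * (of_int (n 0) * Y 2 + 8 * of_int (n 1) * t - of_int (n 2) * Y 0) = 0"
    using sum unfolding r0 r1 r2 by (simp add: algebra_simps)
  hence "of_int (n 0) * Y 2 + 8 * of_int (n 1) * t - of_int (n 2) * Y 0 = 0"
    using C_large by simp
  from relation_trivial[OF this] show ?thesis
    by (auto simp: less_Suc_eq numeral_3_eq_3 numeral_2_eq_2)
qed

lemma jacobian_rank_ge_3: "jacobian_rank 1 F \<ge> 3"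
proof -
  define F' where "F' = map_poly to_ac F"
  interpret h: hyperelliptic "to_ac (1 :: ratfun3)" F'
    using rsquarefree_F m_ge_3 by unfold_locales (auto simp: F'_def degree_F)
  define P where "P i = Affine (to_ac (px i)) (to_ac (py i))" for i
  define D where "D i = frag_of (P i) - frag_of (Infinite (0 :: ratfun3 alg_closure))" for i
  have P: "P i \<in> curve_points (to_ac 1) F'" for i
    using to_ac_in_points[of "Affine (px i) (py i)" 1 F] on_curve[of i]
    by (simp add: P_def F'_def curve_points_def)
  have w: "Infinite 0 \<in> curve_points (to_ac 1) F'"
    using odd_m by (intro Infinite_0_in_points) (simp add: F'_def degree_F)
  have D: "D i \<in> carrier (divisor_group (to_ac 1) F')" for i
    unfolding D_def by (rule h.point_difference_closed[OF P w])
  have degree_0: "divisor_degree (D i) = 0" for i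
  proof -
    have "Poly_Mapping.keys (D i) = {P i, Infinite 0}"
      by (auto simp: D_def P_def in_keys_iff lookup_minus split: if_splits)
    thus ?thesis
      unfolding divisor_degree_def by (simp add: D_def P_def lookup_minus)
  qed
  \<comment> \<open>The divisors themselves are invariant, not only their classes: the affine points
    have coordinates in the ground field, and the point at infinity has w = 0.\<close>
  have galois: "frag_extend (frag_of \<circ> map_curve_point \<sigma>) (D i) = D i" if "\<sigma> \<in> galois_group" for \<sigma> i
  proof -
    have "\<sigma> 0 = 0"
      using that unfolding galois_group_def by (metis (mono_tags, lifting) mem_Collect_eq to_ac_0)
    thus ?thesis
      using that by (simp add: D_def P_def frag_extend_diff galois_group_def)
  qed
  have "divisor_class (to_ac 1) F' (D i) \<in> jacobian_points 1 F" for i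
    unfolding jacobian_points_def Let_def F'_def[symmetric]
    by (intro CollectI exI[of _ "D i"] conjI ballI refl D degree_0) (simp only: galois)
  hence "(\<lambda>i. divisor_class (to_ac 1) F' (D i)) ` {..<3} \<subseteq> jacobian_points 1 F"
    by blast
  moreover have indep: "\<forall>i\<in>{..<3}. n i = 0"
    if "(\<Sum>i<3. frag_cmul (n i) (D i)) \<in> principal_divisors (to_ac 1) F'" for n
    using points_independent[of n] that by (simp add: D_def P_def F'_def)
  moreover have "(\<lambda>i. divisor_class (to_ac 1) F' (D i)) ` {..<3} \<subseteq> carrier (picard_group (to_ac 1) F')"
    using h.divisor_class_closed[OF D] by blast
  ultimately have "subgroup_rank (picard_group (to_ac 1) F') (jacobian_points 1 F) \<ge> enat 3"
    using h.independent_classes[OF _ D, of "{..<3::nat}"]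
    by (intro subgroup_rank_ge[of "(\<lambda>i. divisor_class (to_ac 1) F' (D i)) ` {..<3}"]) auto
  thus ?thesis
    by (simp add: jacobian_rank_def F'_def numeral_eq_enat)
qed

end

theorem theorem3p2:
  fixes f :: "rat poly" and O\<^sub>E :: "rat curve_point" and m :: nat and a :: rat
  assumes "elliptic_curve 1 f O\<^sub>E"
    and "mordell_weil_rank 1 f O\<^sub>E > 0"
    and "odd m" and "m \<ge> 3"
    and "a \<noteq> 0"
  shows "\<exists>D :: ratfun3.
    (\<exists>O\<^sub>D. elliptic_curve D (map_poly ratfun3_const f) O\<^sub>D \<and>
          mordell_weil_rank D (map_poly ratfun3_const f) O\<^sub>D > 0) \<and>
    jacobian_rank 1 (monom 1 m + [:ratfun3_const a ^ 2 * D:]) \<ge> 3"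
proof -
  obtain k where k: "m = 2 * k + 1"
    using \<open>odd m\<close> by (elim oddE)
  interpret three_points m k
    using k \<open>m \<ge> 3\<close> by unfold_locales auto
  define s where "s = W / ratfun3_const a"
  have "s \<noteq> 0"
    using W_nonzero \<open>a \<noteq> 0\<close> by (simp add: s_def)
  have "ratfun3_const a ^ 2 * s ^ 2 = W ^ 2"
    using \<open>a \<noteq> 0\<close> by (simp add: s_def power_divide)
  hence "jacobian_rank 1 (monom 1 m + [:ratfun3_const a ^ 2 * s ^ 2:]) \<ge> 3"
    using jacobian_rank_ge_3 by (simp add: F_def)
  thus ?thesis
    using mordell_weil_rank_square_twist[OF assms(1,2) \<open>s \<noteq> 0\<close>] by blast
qed

end
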